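(* Let $F\colon A\to B$ and $F'\colon A'\to B'$ be two $*$-functors between small $\mathrm{C}^*$-categories and let $$F\Box F'\colon (B\otimes_{\max}A')\sqcup_{A\otimes_{\max}A'}(A\otimes_{\max}B')\longrightarrow B\otimes_{\max}B'$$ be the $*$-functor they induce by the pushout property (pushout in $\mathsf{C}_1^*\mathsf{cat}$). Then: (i) If $F$ and $F'$ are cofibrations, then $F\Box F'$ is a cofibration. (ii) If moreover $F$ or $F'$ is a unitary equivalence, then $F\Box F'$ is a unitary equivalence.
   Context: Let $\mathbb F$ be $\mathbb R$ or $\mathbb C$. All categories have identities and all functors preserve them. An $\mathbb F$-category is a category enriched over $\mathbb F$-vector spaces. A $*$-category is an $\mathbb F$-category with an involution: maps $A(x,y)\to A(y,x)$, $a\mapsto a^*$, which are antilinear, with $(ba)^*=a^*b^*$ and $(a^* )^*=a$. A $*$-functor is an $\mathbb F$-linear functor with $F(a^* )=F(a)^*$. A $\mathrm{C}^*$-category is a $*$-category whose Hom spaces are Banach spaces, with $\|ba\|\le\|b\|\|a\|$, $\|a^*a\|=\|a\|^2$, and such that for each $a\in A(x,y)$ the element $a^*a$ of $A(x,x)$ is positive (its spectrum $\{z\in\mathbb F\mid a^*a-z1_x \text{ not invertible}\}$ lies in $[0,\infty)$). $\mathsf{C}_1^*\mathsf{cat}$ is the category of small $\mathrm{C}^*$-categories and $*$-functors; it is complete and cocomplete. A cofibration is a $*$-functor injective on objects. An arrow $a\in A(x,y)$ is unitary if $a^*a=1_x$ and $aa^*=1_y$. A $*$-functor $F\colon A\to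 B$ is a unitary equivalence if there are a $*$-functor $G\colon B\to A$ and natural isomorphisms $GF\simeq\mathrm{id}_A$, $FG\simeq\mathrm{id}_B$ with unitary components. For $*$-categories $A,B$ the algebraic tensor product $A\otimes_{\mathbb F}B$ has objects $\mathrm{ob} A\times\mathrm{ob} B$, Hom spaces $A(x,x')\otimes_{\mathbb F}B(y,y')$ and involution $(a\otimes b)^*=a^*\otimes b^*$. For small $\mathrm{C}^*$-categories $A,B$, the maximal tensor product $A\otimes_{\max}B$ is the completion of $A\otimes_{\mathbb F}B$ with respect to $\|f\|_\infty=\sup_\rho\|\rho(f)\|$ over all $*$-functors $\rho$ from $A\otimes_{\mathbb F}B$ to $\mathrm{C}^*$-categories; every $*$-functor from $A\otimes_{\mathbb F}B$ to a $\mathrm{C}^*$-category extends uniquely to it. *)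

theory Defs
  imports
    "HOL-Analysis.Analysis"
    "HOL-Algebra.Module"
    "HOL-Library.Poly_Mapping"
    "HOL-Library.Nonpos_Ints"
begin

section \<open>C*-categories\<close>

text \<open>
  The ground field is a set \<open>K\<close> of complex numbers, either \<open>\<real>\<close> or \<open>UNIV\<close>; conjugation is then
  complex conjugation, which is trivial on \<open>\<real>\<close>.
\<close>

definition scalars :: "complex set \<Rightarrow> complex ring" where
  "scalars K = \<lparr>carrier = K, monoid.mult = (*), one = 1, ring.zero = 0, add = (+)\<rparr>"

text \<open>
  Hom spaces are modules in the sense of HOL-Algebra; the fields \<open>mult\<close> and \<open>one\<close>, which the
  record type inherits from rings, are never used.  Hom spaces of different pairs of objects need not
  be disjoint, hence all operations take the objects as arguments.  The composite \<open>ba\<close> of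
  \<open>a \<in> A(x,y)\<close> and \<open>b \<in> A(y,z)\<close> is \<open>Comp A x y z b a\<close>.
\<close>

record ('o, 'm) star_cat =
  Ob :: "'o set"
  Hom :: "'o \<Rightarrow> 'o \<Rightarrow> (complex, 'm) module"
  Comp :: "'o \<Rightarrow> 'o \<Rightarrow> 'o \<Rightarrow> 'm \<Rightarrow> 'm \<Rightarrow> 'm"
  Idn :: "'o \<Rightarrow> 'm"
  Star :: "'o \<Rightarrow> 'o \<Rightarrow> 'm \<Rightarrow> 'm"

record ('o, 'm) cstar_cat = "('o, 'm) star_cat" +
  Nrm :: "'o \<Rightarrow> 'o \<Rightarrow> 'm \<Rightarrow> real"

abbreviation Arr :: "('o, 'm, 'z) star_cat_scheme \<Rightarrow> 'o \<Rightarrow> 'o \<Rightarrow> 'm set" where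
  "Arr A x y \<equiv> carrier (Hom A x y)"

locale star_category =
  fixes K :: "complex set" and A :: "('o, 'm, 'z) star_cat_scheme"
  assumes Hom_module: "\<And>x y. \<lbrakk>x \<in> Ob A; y \<in> Ob A\<rbrakk> \<Longrightarrow> Module.module (scalars K) (Hom A x y)"
    and Comp_closed: "\<And>x y z a b. \<lbrakk>x \<in> Ob A; y \<in> Ob A; z \<in> Ob A; a \<in> Arr A x y; b \<in> Arr A y z\<rbrakk>
      \<Longrightarrow> Comp A x y z b a \<in> Arr A x z"
    and Idn_closed: "\<And>x. x \<in> Ob A \<Longrightarrow> Idn A x \<in> Arr A x x"
    and Comp_assoc: "\<And>w x y z a b c. \<lbrakk>w \<in> Ob A; x \<in> Ob A; y \<in> Ob A; z \<in> Ob A;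
        a \<in> Arr A w x; b \<in> Arr A x y; c \<in> Arr A y z\<rbrakk>
      \<Longrightarrow> Comp A w x z (Comp A x y z c b) a = Comp A w y z c (Comp A w x y b a)"
    and Comp_Idn_right: "\<And>x y a. \<lbrakk>x \<in> Ob A; y \<in> Ob A; a \<in> Arr A x y\<rbrakk>
      \<Longrightarrow> Comp A x x y a (Idn A x) = a"
    and Comp_Idn_left: "\<And>x y a. \<lbrakk>x \<in> Ob A; y \<in> Ob A; a \<in> Arr A x y\<rbrakk>
      \<Longrightarrow> Comp A x y y (Idn A y) a = a"
    and Comp_add_right: "\<And>x y z a a' b. \<lbrakk>x \<in> Ob A; y \<in> Ob A; z \<in> Ob A;
        a \<in> Arr A x y; a' \<in> Arr A x y; b \<in> Arr A y z\<rbrakk>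
      \<Longrightarrow> Comp A x y z b (a \<oplus>\<^bsub>Hom A x y\<^esub> a') = Comp A x y z b a \<oplus>\<^bsub>Hom A x z\<^esub> Comp A x y z b a'"
    and Comp_add_left: "\<And>x y z a b b'. \<lbrakk>x \<in> Ob A; y \<in> Ob A; z \<in> Ob A;
        a \<in> Arr A x y; b \<in> Arr A y z; b' \<in> Arr A y z\<rbrakk>
      \<Longrightarrow> Comp A x y z (b \<oplus>\<^bsub>Hom A y z\<^esub> b') a = Comp A x y z b a \<oplus>\<^bsub>Hom A x z\<^esub> Comp A x y z b' a"
    and Comp_smult_right: "\<And>x y z a b c. \<lbrakk>x \<in> Ob A; y \<in> Ob A; z \<in> Ob A;
        a \<in> Arr A x y; b \<in> Arr A y z; c \<in> K\<rbrakk>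
      \<Longrightarrow> Comp A x y z b (c \<odot>\<^bsub>Hom A x y\<^esub> a) = c \<odot>\<^bsub>Hom A x z\<^esub> Comp A x y z b a"
    and Comp_smult_left: "\<And>x y z a b c. \<lbrakk>x \<in> Ob A; y \<in> Ob A; z \<in> Ob A;
        a \<in> Arr A x y; b \<in> Arr A y z; c \<in> K\<rbrakk>
      \<Longrightarrow> Comp A x y z (c \<odot>\<^bsub>Hom A y z\<^esub> b) a = c \<odot>\<^bsub>Hom A x z\<^esub> Comp A x y z b a"
    and Star_closed: "\<And>x y a. \<lbrakk>x \<in> Ob A; y \<in> Ob A; a \<in> Arr A x y\<rbrakk> \<Longrightarrow> Star A x y a \<in> Arr A y x"
    and Star_add: "\<And>x y a a'. \<lbrakk>x \<in> Ob A; y \<in> Ob A; a \<in> Arr A x y; a' \<in> Arr A x y\<rbrakk>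
      \<Longrightarrow> Star A x y (a \<oplus>\<^bsub>Hom A x y\<^esub> a') = Star A x y a \<oplus>\<^bsub>Hom A y x\<^esub> Star A x y a'"
    and Star_smult: "\<And>x y a c. \<lbrakk>x \<in> Ob A; y \<in> Ob A; a \<in> Arr A x y; c \<in> K\<rbrakk>
      \<Longrightarrow> Star A x y (c \<odot>\<^bsub>Hom A x y\<^esub> a) = cnj c \<odot>\<^bsub>Hom A y x\<^esub> Star A x y a"
    and Star_Comp: "\<And>x y z a b. \<lbrakk>x \<in> Ob A; y \<in> Ob A; z \<in> Ob A; a \<in> Arr A x y; b \<in> Arr A y z\<rbrakk>
      \<Longrightarrow> Star A x z (Comp A x y z b a) = Comp A z y x (Star A x y a) (Star A y z b)"
    and Star_Star: "\<And>x y a. \<lbrakk>x \<in> Ob A; y \<in> Ob A; a \<in> Arr A x y\<rbrakk>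
      \<Longrightarrow> Star A y x (Star A x y a) = a"

definition invertible_endo :: "('o, 'm, 'z) star_cat_scheme \<Rightarrow> 'o \<Rightarrow> 'm \<Rightarrow> bool" where
  "invertible_endo A x h \<longleftrightarrow>
     (\<exists>k \<in> Arr A x x. Comp A x x x k h = Idn A x \<and> Comp A x x x h k = Idn A x)"

definition spectrum_endo :: "complex set \<Rightarrow> ('o, 'm, 'z) star_cat_scheme \<Rightarrow> 'o \<Rightarrow> 'm \<Rightarrow> complex set" where
  "spectrum_endo K A x h =
     {z \<in> K. \<not> invertible_endo A x (h \<ominus>\<^bsub>Hom A x x\<^esub> (z \<odot>\<^bsub>Hom A x x\<^esub> Idn A x))}"

text \<open>The case distinction is needed because \<^locale>\<open>Metric_space\<close> constrains the distance on the whole type.\<close>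

definition hom_dist :: "('o, 'm, 'z) cstar_cat_scheme \<Rightarrow> 'o \<Rightarrow> 'o \<Rightarrow> 'm \<Rightarrow> 'm \<Rightarrow> real" where
  "hom_dist A x y a b =
     (if a \<in> Arr A x y \<and> b \<in> Arr A x y then Nrm A x y (a \<ominus>\<^bsub>Hom A x y\<^esub> b) else 0)"

locale cstar_category = star_category K A
  for K :: "complex set" and A :: "('o, 'm) cstar_cat" +
  assumes Nrm_nonneg: "\<And>x y a. \<lbrakk>x \<in> Ob A; y \<in> Ob A; a \<in> Arr A x y\<rbrakk> \<Longrightarrow> 0 \<le> Nrm A x y a"
    and Nrm_eq_0_iff: "\<And>x y a. \<lbrakk>x \<in> Ob A; y \<in> Ob A; a \<in> Arr A x y\<rbrakk>
      \<Longrightarrow> Nrm A x y a = 0 \<longleftrightarrow> a = \<zero>\<^bsub>Hom A x y\<^esub>"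
    and Nrm_triangle: "\<And>x y a a'. \<lbrakk>x \<in> Ob A; y \<in> Ob A; a \<in> Arr A x y; a' \<in> Arr A x y\<rbrakk>
      \<Longrightarrow> Nrm A x y (a \<oplus>\<^bsub>Hom A x y\<^esub> a') \<le> Nrm A x y a + Nrm A x y a'"
    and Nrm_smult: "\<And>x y a c. \<lbrakk>x \<in> Ob A; y \<in> Ob A; a \<in> Arr A x y; c \<in> K\<rbrakk>
      \<Longrightarrow> Nrm A x y (c \<odot>\<^bsub>Hom A x y\<^esub> a) = cmod c * Nrm A x y a"
    and Hom_complete: "\<And>x y. \<lbrakk>x \<in> Ob A; y \<in> Ob A\<rbrakk>
      \<Longrightarrow> Metric_space.mcomplete (Arr A x y) (hom_dist A x y)"
    and Nrm_Comp: "\<And>x y z a b. \<lbrakk>x \<in> Ob A; y \<in> Ob A; z \<in> Ob A; a \<in> Arr A x y; b \<in> Arr A y z\<rbrakk>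
      \<Longrightarrow> Nrm A x z (Comp A x y z b a) \<le> Nrm A y z b * Nrm A x y a"
    and Nrm_cstar: "\<And>x y a. \<lbrakk>x \<in> Ob A; y \<in> Ob A; a \<in> Arr A x y\<rbrakk>
      \<Longrightarrow> Nrm A x x (Comp A x y x (Star A x y a) a) = (Nrm A x y a)\<^sup>2"
    and positive: "\<And>x y a. \<lbrakk>x \<in> Ob A; y \<in> Ob A; a \<in> Arr A x y\<rbrakk>
      \<Longrightarrow> spectrum_endo K A x (Comp A x y x (Star A x y a) a) \<subseteq> \<real>\<^sub>\<ge>\<^sub>0"


section \<open>*-functors, cofibrations and unitary equivalences\<close>

record ('o, 'm, 'p, 'n) fctr =
  fob :: "'o \<Rightarrow> 'p"
  farr :: "'o \<Rightarrow> 'o \<Rightarrow> 'm \<Rightarrow> 'n"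

locale star_functor =
  fixes K :: "complex set"
    and A :: "('o, 'm, 'z) star_cat_scheme" and B :: "('p, 'n, 'y) star_cat_scheme"
    and F :: "('o, 'm, 'p, 'n) fctr"
  assumes fob_closed: "\<And>x. x \<in> Ob A \<Longrightarrow> fob F x \<in> Ob B"
    and farr_closed: "\<And>x y a. \<lbrakk>x \<in> Ob A; y \<in> Ob A; a \<in> Arr A x y\<rbrakk>
      \<Longrightarrow> farr F x y a \<in> Arr B (fob F x) (fob F y)"
    and farr_Idn: "\<And>x. x \<in> Ob A \<Longrightarrow> farr F x x (Idn A x) = Idn B (fob F x)"
    and farr_Comp: "\<And>x y z a b. \<lbrakk>x \<in> Ob A; y \<in> Ob A; z \<in> Ob A; a \<in> Arr A x y; b \<in> Arr A y z\<rbrakk>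
      \<Longrightarrow> farr F x z (Comp A x y z b a)
          = Comp B (fob F x) (fob F y) (fob F z) (farr F y z b) (farr F x y a)"
    and farr_add: "\<And>x y a a'. \<lbrakk>x \<in> Ob A; y \<in> Ob A; a \<in> Arr A x y; a' \<in> Arr A x y\<rbrakk>
      \<Longrightarrow> farr F x y (a \<oplus>\<^bsub>Hom A x y\<^esub> a')
          = farr F x y a \<oplus>\<^bsub>Hom B (fob F x) (fob F y)\<^esub> farr F x y a'"
    and farr_smult: "\<And>x y a c. \<lbrakk>x \<in> Ob A; y \<in> Ob A; a \<in> Arr A x y; c \<in> K\<rbrakk>
      \<Longrightarrow> farr F x y (c \<odot>\<^bsub>Hom A x y\<^esub> a) = c \<odot>\<^bsub>Hom B (fob F x) (fob F y)\<^esub> farr F x y a"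
    and farr_Star: "\<And>x y a. \<lbrakk>x \<in> Ob A; y \<in> Ob A; a \<in> Arr A x y\<rbrakk>
      \<Longrightarrow> farr F y x (Star A x y a) = Star B (fob F x) (fob F y) (farr F x y a)"

definition id_fctr :: "('o, 'm, 'o, 'm) fctr" where
  "id_fctr = \<lparr>fob = (\<lambda>x. x), farr = (\<lambda>x y a. a)\<rparr>"

definition comp_fctr ::
    "('p, 'n, 'q, 'k) fctr \<Rightarrow> ('o, 'm, 'p, 'n) fctr \<Rightarrow> ('o, 'm, 'q, 'k) fctr"
    (infixl \<open>\<circ>\<^sub>F\<close> 55) where
  "G \<circ>\<^sub>F F = \<lparr>fob = (\<lambda>x. fob G (fob F x)),
              farr = (\<lambda>x y a. farr G (fob F x) (fob F y) (farr F x y a))\<rparr>"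

text \<open>Equality of functors with domain \<open>A\<close>; their values outside of \<open>A\<close> are irrelevant.\<close>

definition fctr_eq ::
    "('o, 'm, 'z) star_cat_scheme \<Rightarrow> ('o, 'm, 'p, 'n) fctr \<Rightarrow> ('o, 'm, 'p, 'n) fctr \<Rightarrow> bool" where
  "fctr_eq A F G \<longleftrightarrow> (\<forall>x \<in> Ob A. fob F x = fob G x) \<and>
     (\<forall>x \<in> Ob A. \<forall>y \<in> Ob A. \<forall>a \<in> Arr A x y. farr F x y a = farr G x y a)"

definition cofibration ::
    "complex set \<Rightarrow> ('o, 'm, 'z) star_cat_scheme \<Rightarrow> ('p, 'n, 'y) star_cat_scheme
      \<Rightarrow> ('o, 'm, 'p, 'n) fctr \<Rightarrow> bool" where
  "cofibration K A B F \<longleftrightarrow> star_functor K A B F \<and> inj_on (fob F) (Ob A)"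

definition unitary_arrow ::
    "('o, 'm, 'z) star_cat_scheme \<Rightarrow> 'o \<Rightarrow> 'o \<Rightarrow> 'm \<Rightarrow> bool" where
  "unitary_arrow A x y a \<longleftrightarrow> a \<in> Arr A x y \<and>
     Comp A x y x (Star A x y a) a = Idn A x \<and> Comp A y x y a (Star A x y a) = Idn A y"

definition unitary_nat_iso ::
    "('o, 'm, 'z) star_cat_scheme \<Rightarrow> ('p, 'n, 'y) star_cat_scheme
      \<Rightarrow> ('o, 'm, 'p, 'n) fctr \<Rightarrow> ('o, 'm, 'p, 'n) fctr \<Rightarrow> ('o \<Rightarrow> 'n) \<Rightarrow> bool" where
  "unitary_nat_iso A B F G u \<longleftrightarrow>
     (\<forall>x \<in> Ob A. unitary_arrow B (fob F x) (fob G x) (u x)) \<and>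
     (\<forall>x \<in> Ob A. \<forall>y \<in> Ob A. \<forall>a \<in> Arr A x y.
        Comp B (fob F x) (fob F y) (fob G y) (u y) (farr F x y a)
        = Comp B (fob F x) (fob G x) (fob G y) (farr G x y a) (u x))"

definition unitary_equivalence ::
    "complex set \<Rightarrow> ('o, 'm, 'z) star_cat_scheme \<Rightarrow> ('p, 'n, 'y) star_cat_scheme
      \<Rightarrow> ('o, 'm, 'p, 'n) fctr \<Rightarrow> bool" where
  "unitary_equivalence K A B F \<longleftrightarrow> star_functor K A B F \<and>
     (\<exists>G. star_functor K B A G \<and>
       (\<exists>u. unitary_nat_iso A A (G \<circ>\<^sub>F F) id_fctr u) \<and>
       (\<exists>v. unitary_nat_iso B B (F \<circ>\<^sub>F G) id_fctr v))"


section \<open>The algebraic tensor product\<close>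

text \<open>
  The tensor product of the \<open>K\<close>-vector spaces \<open>V\<close> and \<open>W\<close> is the space of finite formal
  \<open>K\<close>-linear combinations of pairs in \<open>V \<times> W\<close> modulo the span of the bilinearity relations.  Its
  elements are cosets, and operations on them are defined on chosen representatives.
\<close>

definition formal_sums ::
    "complex set \<Rightarrow> (complex, 'm) module \<Rightarrow> (complex, 'n) module \<Rightarrow> ('m \<times> 'n \<Rightarrow>\<^sub>0 complex) set" where
  "formal_sums K V W =
     {f. Poly_Mapping.keys f \<subseteq> carrier V \<times> carrier W \<and> (\<forall>p. Poly_Mapping.lookup f p \<in> K)}"

inductive_set tensor_relations ::
    "complex set \<Rightarrow> (complex, 'm) module \<Rightarrow> (complex, 'n) module \<Rightarrow> ('m \<times> 'n \<Rightarrow>\<^sub>0 complex) set"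
  for K V W where
  add_left: "\<lbrakk>a \<in> carrier V; a' \<in> carrier V; b \<in> carrier W\<rbrakk> \<Longrightarrow>
     Poly_Mapping.single (a \<oplus>\<^bsub>V\<^esub> a', b) 1 - Poly_Mapping.single (a, b) 1
       - Poly_Mapping.single (a', b) 1 \<in> tensor_relations K V W"
| add_right: "\<lbrakk>a \<in> carrier V; b \<in> carrier W; b' \<in> carrier W\<rbrakk> \<Longrightarrow>
     Poly_Mapping.single (a, b \<oplus>\<^bsub>W\<^esub> b') 1 - Poly_Mapping.single (a, b) 1
       - Poly_Mapping.single (a, b') 1 \<in> tensor_relations K V W"
| smult_left: "\<lbrakk>c \<in> K; a \<in> carrier V; b \<in> carrier W\<rbrakk> \<Longrightarrow>
     Poly_Mapping.single (c \<odot>\<^bsub>V\<^esub> a, b) 1 - Poly_Mapping.single (a, b) c \<in> tensor_relations K V W"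
| smult_right: "\<lbrakk>c \<in> K; a \<in> carrier V; b \<in> carrier W\<rbrakk> \<Longrightarrow>
     Poly_Mapping.single (a, c \<odot>\<^bsub>W\<^esub> b) 1 - Poly_Mapping.single (a, b) c \<in> tensor_relations K V W"
| zero: "0 \<in> tensor_relations K V W"
| add: "\<lbrakk>f \<in> tensor_relations K V W; g \<in> tensor_relations K V W\<rbrakk> \<Longrightarrow> f + g \<in> tensor_relations K V W"
| scale: "\<lbrakk>c \<in> K; f \<in> tensor_relations K V W\<rbrakk> \<Longrightarrow>
     Poly_Mapping.map (\<lambda>z. c * z) f \<in> tensor_relations K V W"

definition tclass ::
    "complex set \<Rightarrow> (complex, 'm) module \<Rightarrow> (complex, 'n) module
      \<Rightarrow> ('m \<times> 'n \<Rightarrow>\<^sub>0 complex) \<Rightarrow> ('m \<times> 'n \<Rightarrow>\<^sub>0 complex) set" where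
  "tclass K V W f = {g \<in> formal_sums K V W. g - f \<in> tensor_relations K V W}"

definition trep :: "'a set \<Rightarrow> 'a" where
  "trep S = (SOME f. f \<in> S)"

definition tensor_space ::
    "complex set \<Rightarrow> (complex, 'm) module \<Rightarrow> (complex, 'n) module
      \<Rightarrow> (complex, ('m \<times> 'n \<Rightarrow>\<^sub>0 complex) set) module" where
  "tensor_space K V W =
     \<lparr>carrier = tclass K V W ` formal_sums K V W,
      monoid.mult = undefined,
      one = undefined,
      ring.zero = tclass K V W 0,
      add = (\<lambda>S T. tclass K V W (trep S + trep T)),
      smult = (\<lambda>c S. tclass K V W (Poly_Mapping.map (\<lambda>z. c * z) (trep S)))\<rparr>"

text \<open>On elementary tensors, \<open>(b \<otimes> b')(a \<otimes> a') = ba \<otimes> b'a'\<close> and \<open>(a \<otimes> a')* = a* \<otimes> a'*\<close>.\<close>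

definition alg_tensor ::
    "complex set \<Rightarrow> ('o, 'm, 'z) star_cat_scheme \<Rightarrow> ('p, 'n, 'y) star_cat_scheme
      \<Rightarrow> ('o \<times> 'p, ('m \<times> 'n \<Rightarrow>\<^sub>0 complex) set) star_cat" where
  "alg_tensor K A B =
     \<lparr>Ob = Ob A \<times> Ob B,
      Hom = (\<lambda>(x, x') (y, y'). tensor_space K (Hom A x y) (Hom B x' y')),
      Comp = (\<lambda>(x, x') (y, y') (z, z') S T. tclass K (Hom A x z) (Hom B x' z')
        (\<Sum>(b, b') \<in> Poly_Mapping.keys (trep S). \<Sum>(a, a') \<in> Poly_Mapping.keys (trep T).
           Poly_Mapping.single (Comp A x y z b a, Comp B x' y' z' b' a')
             (Poly_Mapping.lookup (trep S) (b, b') * Poly_Mapping.lookup (trep T) (a, a')))),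
      Idn = (\<lambda>(x, x'). tclass K (Hom A x x) (Hom B x' x')
        (Poly_Mapping.single (Idn A x, Idn B x') 1)),
      Star = (\<lambda>(x, x') (y, y') S. tclass K (Hom A y x) (Hom B y' x')
        (\<Sum>(a, a') \<in> Poly_Mapping.keys (trep S).
           Poly_Mapping.single (Star A x y a, Star B x' y' a')
             (cnj (Poly_Mapping.lookup (trep S) (a, a')))))\<rparr>"

text \<open>\<open>F \<otimes> F'\<close> for \<open>F\<close> with codomain \<open>B\<close> and \<open>F'\<close> with codomain \<open>B'\<close>.\<close>

definition alg_tensor_fctr ::
    "complex set \<Rightarrow> ('p, 'n, 'z) star_cat_scheme \<Rightarrow> ('p', 'n', 'y) star_cat_scheme
      \<Rightarrow> ('o, 'm, 'p, 'n) fctr \<Rightarrow> ('o', 'm', 'p', 'n') fctr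
      \<Rightarrow> ('o \<times> 'o', ('m \<times> 'm' \<Rightarrow>\<^sub>0 complex) set, 'p \<times> 'p', ('n \<times> 'n' \<Rightarrow>\<^sub>0 complex) set) fctr" where
  "alg_tensor_fctr K B B' F F' =
     \<lparr>fob = (\<lambda>(x, x'). (fob F x, fob F' x')),
      farr = (\<lambda>(x, x') (y, y') S.
        tclass K (Hom B (fob F x) (fob F y)) (Hom B' (fob F' x') (fob F' y'))
          (\<Sum>(a, a') \<in> Poly_Mapping.keys (trep S).
             Poly_Mapping.single (farr F x y a, farr F' x' y' a')
               (Poly_Mapping.lookup (trep S) (a, a'))))\<rparr>"


section \<open>The maximal tensor product\<close>

text \<open>
  \<open>('o, 'm) cstar_cat\<close> plays the role of a universe of small C*-categories: all quantifications over
  C*-categories range over it.  Every C*-category whose set of objects and Hom spaces inject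
  into \<open>'o\<close> and \<open>'m\<close> has an isomorphic copy there, and for infinite \<open>'o\<close> and \<open>'m\<close> with
  \<open>|'o| \<le> |'m|\<close> and \<open>|'m|\<close> to the power \<open>aleph_0\<close> equal to \<open>|'m|\<close> the universe is closed under
  maximal tensor products and pushouts, and restricting to targets in it changes neither the
  supremum below nor the notion of pushout.
\<close>

definition max_norm ::
    "complex set \<Rightarrow> ('o, 'm) cstar_cat \<Rightarrow> ('o, 'm) cstar_cat
      \<Rightarrow> 'o \<times> 'o \<Rightarrow> 'o \<times> 'o \<Rightarrow> ('m \<times> 'm \<Rightarrow>\<^sub>0 complex) set \<Rightarrow> ereal" where
  "max_norm K A B x y f =
     (SUP (C, \<rho>) \<in> {(C :: ('o, 'm) cstar_cat, \<rho>).
         cstar_category K C \<and> star_functor K (alg_tensor K A B) C \<rho>}.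
       ereal (Nrm C (fob \<rho> x) (fob \<rho> y) (farr \<rho> x y f)))"

text \<open>
  \<open>T\<close> with \<open>i\<close> is a completion of the algebraic tensor product with respect to \<open>max_norm\<close>.
  Completions are unique only up to isomorphism, so this is a predicate; \<open>i\<close> is a bijection on
  objects, since \<open>T\<close> lives in the universe and its objects cannot literally be pairs.
\<close>

definition is_max_tensor ::
    "complex set \<Rightarrow> ('o, 'm) cstar_cat \<Rightarrow> ('o, 'm) cstar_cat \<Rightarrow> ('o, 'm) cstar_cat
      \<Rightarrow> ('o \<times> 'o, ('m \<times> 'm \<Rightarrow>\<^sub>0 complex) set, 'o, 'm) fctr \<Rightarrow> bool" where
  "is_max_tensor K A B T i \<longleftrightarrow>
     cstar_category K T \<and> star_functor K (alg_tensor K A B) T i \<and>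
     bij_betw (fob i) (Ob (alg_tensor K A B)) (Ob T) \<and>
     (\<forall>x \<in> Ob (alg_tensor K A B). \<forall>y \<in> Ob (alg_tensor K A B).
        (\<forall>f \<in> Arr (alg_tensor K A B) x y.
           ereal (Nrm T (fob i x) (fob i y) (farr i x y f)) = max_norm K A B x y f) \<and>
        (\<forall>t \<in> Arr T (fob i x) (fob i y). \<forall>e > 0.
           \<exists>f \<in> Arr (alg_tensor K A B) x y.
             Nrm T (fob i x) (fob i y) (farr i x y f \<ominus>\<^bsub>Hom T (fob i x) (fob i y)\<^esub> t) < e))"

text \<open>
  The extension by continuity of a *-functor \<open>\<rho>\<close> from \<open>D\<close> to \<open>C\<close> to the completion \<open>i\<close> from \<open>D\<close>
  to \<open>T\<close>.
\<close>

definition completion_extension ::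
    "('d, 'k, 'z) star_cat_scheme \<Rightarrow> ('o, 'm) cstar_cat \<Rightarrow> ('d, 'k, 'o, 'm) fctr
      \<Rightarrow> ('p, 'n) cstar_cat \<Rightarrow> ('d, 'k, 'p, 'n) fctr \<Rightarrow> ('o, 'm, 'p, 'n) fctr" where
  "completion_extension D T i C \<rho> =
     (let ob = inv_into (Ob D) (fob i) in
      \<lparr>fob = (\<lambda>x. fob \<rho> (ob x)),
       farr = (\<lambda>x y t. THE s. s \<in> Arr C (fob \<rho> (ob x)) (fob \<rho> (ob y)) \<and>
         (\<exists>f :: nat \<Rightarrow> 'k. (\<forall>n. f n \<in> Arr D (ob x) (ob y)) \<and>
           (\<lambda>n. Nrm T x y (farr i (ob x) (ob y) (f n) \<ominus>\<^bsub>Hom T x y\<^esub> t)) \<longlonglongrightarrow> 0 \<and>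
           (\<lambda>n. Nrm C (fob \<rho> (ob x)) (fob \<rho> (ob y))
             (farr \<rho> (ob x) (ob y) (f n) \<ominus>\<^bsub>Hom C (fob \<rho> (ob x)) (fob \<rho> (ob y))\<^esub> s)) \<longlonglongrightarrow> 0))\<rparr>)"

text \<open>
  The functor induced by \<open>F\<close> from \<open>A\<close> to \<open>B\<close> and \<open>F'\<close> from \<open>A'\<close> to \<open>B'\<close> between the maximal
  tensor products \<open>(T, i)\<close> of \<open>A, A'\<close> and \<open>(U, j)\<close> of \<open>B, B'\<close>.
\<close>

definition max_tensor_fctr where
  "max_tensor_fctr K A A' T i B B' U j F F' =
     completion_extension (alg_tensor K A A') T i U (j \<circ>\<^sub>F alg_tensor_fctr K B B' F F')"


section \<open>Pushouts of C*-categories\<close>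

text \<open>\<open>H\<close> is a *-functor from \<open>P\<close> to \<open>Q\<close> induced by \<open>s\<close> from \<open>Y\<close> and \<open>t\<close> from \<open>Z\<close>.\<close>

definition is_induced ::
    "complex set \<Rightarrow> ('o, 'm) cstar_cat \<Rightarrow> ('o, 'm) cstar_cat \<Rightarrow> ('o, 'm) cstar_cat
      \<Rightarrow> ('o, 'm, 'o, 'm) fctr \<Rightarrow> ('o, 'm, 'o, 'm) fctr \<Rightarrow> ('o, 'm) cstar_cat
      \<Rightarrow> ('o, 'm, 'o, 'm) fctr \<Rightarrow> ('o, 'm, 'o, 'm) fctr \<Rightarrow> ('o, 'm, 'o, 'm) fctr \<Rightarrow> bool" where
  "is_induced K Y Z P p q Q s t H \<longleftrightarrow>
     star_functor K P Q H \<and> fctr_eq Y (H \<circ>\<^sub>F p) s \<and> fctr_eq Z (H \<circ>\<^sub>F q) t"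

text \<open>\<open>P\<close> with \<open>p\<close> from \<open>Y\<close> and \<open>q\<close> from \<open>Z\<close> is a pushout of \<open>f\<close> from \<open>X\<close> to \<open>Y\<close> and \<open>g\<close> from \<open>X\<close> to \<open>Z\<close>.\<close>

definition is_pushout ::
    "complex set \<Rightarrow> ('o, 'm) cstar_cat \<Rightarrow> ('o, 'm) cstar_cat \<Rightarrow> ('o, 'm) cstar_cat
      \<Rightarrow> ('o, 'm, 'o, 'm) fctr \<Rightarrow> ('o, 'm, 'o, 'm) fctr \<Rightarrow> ('o, 'm) cstar_cat
      \<Rightarrow> ('o, 'm, 'o, 'm) fctr \<Rightarrow> ('o, 'm, 'o, 'm) fctr \<Rightarrow> bool" where
  "is_pushout K X Y Z f g P p q \<longleftrightarrow>
     cstar_category K P \<and> star_functor K Y P p \<and> star_functor K Z P q \<and>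
     fctr_eq X (p \<circ>\<^sub>F f) (q \<circ>\<^sub>F g) \<and>
     (\<forall>(Q :: ('o, 'm) cstar_cat) s t.
        cstar_category K Q \<and> star_functor K Y Q s \<and> star_functor K Z Q t \<and>
        fctr_eq X (s \<circ>\<^sub>F f) (t \<circ>\<^sub>F g) \<longrightarrow>
        (\<exists>H. is_induced K Y Z P p q Q s t H \<and>
          (\<forall>H'. is_induced K Y Z P p q Q s t H' \<longrightarrow> fctr_eq P H' H)))"

end

theory Submission
  imports Defs
begin

text \<open>
  The maximal tensor product is functorial and also carries unitary natural isomorphisms to such,
  since contractive functors out of it are determined by their values on elementary tensors.  Hence
  a cofibration \<open>F\<close> which is a unitary equivalence, and which therefore has a retraction \<open>G\<close> with a
  unitary isomorphism from \<open>F G\<close> to the identity that is trivial on the image of \<open>F\<close>, remains of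
  this kind after tensoring with any category.  The objects of a pushout are the set-theoretic pushout,
  which gives (i).  For (ii), let \<open>q\<close> be the leg of the pushout parallel to \<open>F \<otimes> id\<close>.  Then
  \<open>q \<circ> (G \<otimes> id)\<close> is an inverse of the induced functor up to unitary isomorphism, which is seen by
  conjugating one of the composites and appealing to the uniqueness of functors out of a pushout.
\<close>

section \<open>Functors and strict retractions\<close>

text \<open>A universal property can only be applied to targets in the fixed universe
  \<open>('o, 'm) cstar_cat\<close>. The targets that occur are the given categories, the pushout
  itself and a full subcategory of it, so isomorphisms on the pushout are produced by conjugation
  and uniqueness. Strictness of the retraction is what makes gluing possible. On the pushout the
  isomorphism is prescribed as \<open>p (v y)\<close> on objects \<open>p y\<close> and as the
  identity on all others; on an object that also lies in the image of \<open>q\<close> this must be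
  the identity as well, which holds because such an object comes from \<open>X\<close>, where
  \<open>v\<close> is trivial. The interchange of \<open>G \<otimes> id\<close> with
  \<open>id \<otimes> F'\<close>, which act on different factors, is the only compatibility required
  between the retraction of the leg \<open>F \<otimes> id\<close> over \<open>A'\<close> and the one
  over \<open>B'\<close>. Continuity has a single source: the maximal norm is a supremum over all
  *-functors into the universe, so each of these is bounded by it and its extension is
  contractive.\<close>

context star_category begin

lemma Star_Idn: "x \<in> Ob A \<Longrightarrow> Star A x x (Idn A x) = Idn A x"
  by (metis Comp_Idn_left Idn_closed Star_Comp Star_Star Star_closed)

lemma unitary_cancel:
  assumes "unitary_arrow A x y u" "x \<in> Ob A" "y \<in> Ob A" "z \<in> Ob A"
  shows "a \<in> Arr A z x \<Longrightarrow> Comp A z y x (Star A x y u) (Comp A z x y u a) = a"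
    and "b \<in> Arr A z y \<Longrightarrow> Comp A z x y u (Comp A z y x (Star A x y u) b) = b"
  using assms by (simp_all add: unitary_arrow_def Star_closed Comp_Idn_left flip: Comp_assoc)

lemma unitary_Star:
  "\<lbrakk>unitary_arrow A x y u; x \<in> Ob A; y \<in> Ob A\<rbrakk> \<Longrightarrow> unitary_arrow A y x (Star A x y u)"
  by (simp add: unitary_arrow_def Star_closed Star_Star)

lemma unitary_Idn: "x \<in> Ob A \<Longrightarrow> unitary_arrow A x x (Idn A x)"
  by (simp add: unitary_arrow_def Star_Idn Idn_closed Comp_Idn_left)

lemma unitary_Comp:
  assumes "unitary_arrow A x y u" "unitary_arrow A y z v" "x \<in> Ob A" "y \<in> Ob A" "z \<in> Ob A"
  shows "unitary_arrow A x z (Comp A x y z v u)"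
proof -
  have uv: "u \<in> Arr A x y" "v \<in> Arr A y z"
    using assms by (simp_all add: unitary_arrow_def)
  have "Comp A x z x (Star A x z (Comp A x y z v u)) (Comp A x y z v u)
      = Comp A x y x (Star A x y u) (Comp A x z y (Star A y z v) (Comp A x y z v u))"
    using assms uv by (simp add: Star_Comp Comp_assoc Comp_closed Star_closed)
  moreover have "Comp A z x z (Comp A x y z v u) (Star A x z (Comp A x y z v u))
      = Comp A z y z v (Comp A z x y u (Comp A z y x (Star A x y u) (Star A y z v)))"
    using assms uv by (simp add: Star_Comp Comp_assoc Comp_closed Star_closed)
  ultimately show ?thesis
    using assms uv
    by (simp add: unitary_arrow_def unitary_cancel Comp_closed Star_closed)
qed

end

lemma star_functor_id: "star_functor K A A id_fctr"
  by unfold_locales (simp_all add: id_fctr_def)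

lemma fob_comp [simp]: "fob (G \<circ>\<^sub>F F) x = fob G (fob F x)"
  and farr_comp [simp]: "farr (G \<circ>\<^sub>F F) x y a = farr G (fob F x) (fob F y) (farr F x y a)"
  and fob_id [simp]: "fob id_fctr x = x"
  and farr_id [simp]: "farr id_fctr x y a = a"
  by (simp_all add: comp_fctr_def id_fctr_def)

lemma comp_id_fctr [simp]: "F \<circ>\<^sub>F id_fctr = F" "id_fctr \<circ>\<^sub>F F = F"
  by (simp_all add: comp_fctr_def id_fctr_def)

lemma star_functor_comp:
  assumes "star_functor K A B F" "star_functor K B C G"
  shows "star_functor K A C (G \<circ>\<^sub>F F)"
proof -
  interpret F: star_functor K A B F by fact
  interpret G: star_functor K B C G by fact
  show ?thesis
    by unfold_locales
      (simp_all add: F.fob_closed F.farr_closed G.fob_closed G.farr_closed F.farr_Idn G.farr_Idn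
        F.farr_Comp G.farr_Comp F.farr_add G.farr_add F.farr_smult G.farr_smult
        F.farr_Star G.farr_Star)
qed

lemma (in star_functor) unitary_image:
  "\<lbrakk>unitary_arrow A x y u; x \<in> Ob A; y \<in> Ob A; star_category K A\<rbrakk>
    \<Longrightarrow> unitary_arrow B (fob F x) (fob F y) (farr F x y u)"
  by (simp add: unitary_arrow_def farr_closed star_category.Star_closed
      flip: farr_Star farr_Comp farr_Idn)

section \<open>Equality of functors and unitary natural isomorphisms\<close>

lemma fctr_eqD:
  assumes "fctr_eq A F G"
  shows "x \<in> Ob A \<Longrightarrow> fob F x = fob G x"
    and "\<lbrakk>x \<in> Ob A; y \<in> Ob A; a \<in> Arr A x y\<rbrakk> \<Longrightarrow> farr F x y a = farr G x y a"
  using assms by (simp_all add: fctr_eq_def)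

lemma fctr_eq_sym: "fctr_eq A F G \<Longrightarrow> fctr_eq A G F"
  and fctr_eq_trans: "fctr_eq A F G \<Longrightarrow> fctr_eq A G H \<Longrightarrow> fctr_eq A F H"
  and fctr_eq_refl: "fctr_eq A F F"
  by (simp_all add: fctr_eq_def)

lemma unitary_nat_isoD:
  assumes "unitary_nat_iso A B F G u"
  shows "x \<in> Ob A \<Longrightarrow> unitary_arrow B (fob F x) (fob G x) (u x)"
    and "x \<in> Ob A \<Longrightarrow> u x \<in> Arr B (fob F x) (fob G x)"
    and "\<lbrakk>x \<in> Ob A; y \<in> Ob A; a \<in> Arr A x y\<rbrakk>
      \<Longrightarrow> Comp B (fob F x) (fob F y) (fob G y) (u y) (farr F x y a)
        = Comp B (fob F x) (fob G x) (fob G y) (farr G x y a) (u x)"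
  using assms by (simp_all add: unitary_nat_iso_def unitary_arrow_def)

text \<open>The transport of \<open>F\<close> along unitaries \<open>w x\<close> from
  \<open>fob F x\<close> to a prescribed object \<open>ob x\<close>; \<open>w\<close> becomes
  natural from \<open>F\<close> to the result. It serves twice: to make a given inverse strict on
  objects, and to turn an endofunctor of the pushout into one with the identity as object
  map.\<close>

definition conj_fctr ::
  "('p, 'n, 'y) star_cat_scheme \<Rightarrow> ('o \<Rightarrow> 'p) \<Rightarrow> ('o \<Rightarrow> 'n) \<Rightarrow> ('o, 'm, 'p, 'n) fctr
    \<Rightarrow> ('o, 'm, 'p, 'n) fctr" where
  "conj_fctr B ob w F =
    \<lparr>fob = ob, farr = (\<lambda>x y a. Comp B (ob x) (fob F y) (ob y) (w y)
       (Comp B (ob x) (fob F x) (fob F y) (farr F x y a) (Star B (fob F x) (ob x) (w x))))\<rparr>"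

lemma fob_conj [simp]: "fob (conj_fctr B ob w F) x = ob x"
  and farr_conj: "farr (conj_fctr B ob w F) x y a = Comp B (ob x) (fob F y) (ob y) (w y)
       (Comp B (ob x) (fob F x) (fob F y) (farr F x y a) (Star B (fob F x) (ob x) (w x)))"
  by (simp_all add: conj_fctr_def)

lemma star_functor_conj:
  assumes "star_category K A" "star_category K B" "star_functor K A B F"
    and ob: "\<And>x. x \<in> Ob A \<Longrightarrow> ob x \<in> Ob B"
    and w: "\<And>x. x \<in> Ob A \<Longrightarrow> unitary_arrow B (fob F x) (ob x) (w x)"
  shows "star_functor K A B (conj_fctr B ob w F)"
proof -
  interpret A: star_category K A by fact
  interpret B: star_category K B by fact
  interpret F: star_functor K A B F by fact
  have w': "w x \<in> Arr B (fob F x) (ob x)" if "x \<in> Ob A" for x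
    using w[OF that] by (simp add: unitary_arrow_def)
  have ww: "Comp B (ob x) (fob F x) (ob x) (w x) (Star B (fob F x) (ob x) (w x)) = Idn B (ob x)"
    if "x \<in> Ob A" for x
    using w[OF that] by (simp add: unitary_arrow_def)
  note [simp] = ob w' F.fob_closed F.farr_closed A.Comp_closed A.Star_closed A.Idn_closed
    B.Comp_closed B.Star_closed B.Idn_closed
  show ?thesis
  proof
    fix x y z a b assume "x \<in> Ob A" "y \<in> Ob A" "z \<in> Ob A" "a \<in> Arr A x y" "b \<in> Arr A y z"
    then show "farr (conj_fctr B ob w F) x z (Comp A x y z b a)
      = Comp B (fob (conj_fctr B ob w F) x) (fob (conj_fctr B ob w F) y) (fob (conj_fctr B ob w F) z)
          (farr (conj_fctr B ob w F) y z b) (farr (conj_fctr B ob w F) x y a)"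
      by (simp add: farr_conj F.farr_Comp B.Comp_assoc B.unitary_cancel[OF w])
  next
    fix x y z a b assume "x \<in> Ob A" "y \<in> Ob A" "a \<in> Arr A x y"
    then show "farr (conj_fctr B ob w F) y x (Star A x y a)
      = Star B (fob (conj_fctr B ob w F) x) (fob (conj_fctr B ob w F) y)
          (farr (conj_fctr B ob w F) x y a)"
      by (simp add: farr_conj F.farr_Star B.Comp_assoc B.Star_Comp B.Star_Star)
  qed (simp_all add: farr_conj F.farr_Idn F.farr_add F.farr_smult B.Comp_Idn_left ww
      B.Comp_add_left B.Comp_add_right B.Comp_smult_left B.Comp_smult_right)
qed

text \<open>
  A given inverse \<open>G0\<close> of \<open>F\<close> is conjugated to a strict retraction \<open>G\<close>.  The induced isomorphism
  \<open>z\<close> from \<open>F G\<close> to the identity need not be trivial on the image of \<open>F\<close>; as in the passage to an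
  adjoint equivalence, this is corrected by precomposition with the inverse of \<open>z (F G b)\<close>.
\<close>

lemma strict_retraction:
  assumes "star_category K A" "star_category K B"
    and "unitary_equivalence K A B F" "inj_on (fob F) (Ob A)"
  obtains G v where "star_functor K B A G" "fctr_eq A (G \<circ>\<^sub>F F) id_fctr"
    "unitary_nat_iso B B (F \<circ>\<^sub>F G) id_fctr v"
    "\<And>x. x \<in> Ob A \<Longrightarrow> v (fob F x) = Idn B (fob F x)"
proof -
  interpret A: star_category K A by fact
  interpret B: star_category K B by fact
  obtain G0 u v0 where FG0: "star_functor K A B F" "star_functor K B A G0"
    and u: "unitary_nat_iso A A (G0 \<circ>\<^sub>F F) id_fctr u"
    and v0: "unitary_nat_iso B B (F \<circ>\<^sub>F G0) id_fctr v0"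
    using assms(3) unfolding unitary_equivalence_def by blast
  interpret F: star_functor K A B F by fact
  interpret G0: star_functor K B A G0 by fact
  \<comment> \<open>Injectivity on objects gives \<open>F\<close> an inverse on its image. The
    retraction has to use it there, and may keep the values of \<open>G0\<close> elsewhere.\<close>
  define oa where "oa = inv_into (Ob A) (fob F)"
  define im where "im = fob F ` Ob A"
  have oa: "oa (fob F x) = x" if "x \<in> Ob A" for x
    using that assms(4) by (simp add: oa_def)
  \<comment> \<open>On the image of \<open>F\<close> the unitary \<open>u\<close> moves
    \<open>G0 (F x)\<close> back to \<open>x\<close>; off the image nothing is moved, so the
    identity keeps \<open>w\<close> unitary everywhere.\<close>
  define ob where "ob b = (if b \<in> im then oa b else fob G0 b)" for b
  define w where "w b = (if b \<in> im then u (oa b) else Idn A (fob G0 b))" for b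
  have w: "unitary_arrow A (fob G0 b) (ob b) (w b)" if "b \<in> Ob B" for b
    using that unitary_nat_isoD(1)[OF u] A.unitary_Idn G0.fob_closed
    by (auto simp: ob_def w_def im_def oa)
  have ob: "ob b \<in> Ob A" if "b \<in> Ob B" for b
    using that G0.fob_closed by (auto simp: ob_def im_def oa)
  define G where "G = conj_fctr A ob w G0"
  interpret G: star_functor K B A G
    unfolding G_def using star_functor_conj[OF assms(2,1) FG0(2) ob w] by simp
  note cl [simp] = ob F.fob_closed F.farr_closed G0.fob_closed G0.farr_closed
    G.fob_closed G.farr_closed A.Comp_closed A.Star_closed A.Idn_closed
    B.Comp_closed B.Star_closed B.Idn_closed
  have GF: "fctr_eq A (G \<circ>\<^sub>F F) id_fctr"
    unfolding fctr_eq_def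
  proof (intro conjI ballI)
    fix x assume "x \<in> Ob A"
    then show "fob (G \<circ>\<^sub>F F) x = fob id_fctr x"
      by (simp add: G_def ob_def im_def oa)
  next
    fix x y a assume *: "x \<in> Ob A" "y \<in> Ob A" "a \<in> Arr A x y"
    then have ux: "unitary_arrow A (fob G0 (fob F x)) x (u x)" "u x \<in> Arr A (fob G0 (fob F x)) x"
      "u y \<in> Arr A (fob G0 (fob F y)) y"
      using unitary_nat_isoD(1,2)[OF u] by simp_all
    \<comment> \<open>On the image of \<open>F\<close> conjugation is by \<open>u\<close>, so
      naturality of \<open>u\<close> turns \<open>u y G0(F a) u x\<close>* into
      \<open>a u x u x\<close>*, which is \<open>a\<close>.\<close>
    have "farr (G \<circ>\<^sub>F F) x y a = Comp A x (fob G0 (fob F x)) y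
       (Comp A (fob G0 (fob F x)) (fob G0 (fob F y)) y (u y)
         (farr G0 (fob F x) (fob F y) (farr F x y a))) (Star A (fob G0 (fob F x)) x (u x))"
      using * ux by (simp add: G_def farr_conj ob_def im_def oa w_def A.Comp_assoc)
    also have "\<dots> = Comp A x (fob G0 (fob F x)) y (Comp A (fob G0 (fob F x)) x y a (u x))
        (Star A (fob G0 (fob F x)) x (u x))"
      using unitary_nat_isoD(3)[OF u *] by simp
    also have "\<dots> = a"
      using * ux by (simp add: A.Comp_assoc A.Comp_Idn_right unitary_arrow_def)
    finally show "farr (G \<circ>\<^sub>F F) x y a = farr id_fctr x y a" by simp
  qed
  have GFo: "fob G (fob F x) = x" if "x \<in> Ob A" for x
    using fctr_eqD(1)[OF GF that] by simp
  have GFa: "farr G (fob F x) (fob F y) (farr F x y a) = a"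
    if "x \<in> Ob A" "y \<in> Ob A" "a \<in> Arr A x y" for x y a
    using fctr_eqD(2)[OF GF that] by simp
  \<comment> \<open>The composite \<open>F G b -> F G0 b -> b\<close>: the adjoint of
    \<open>F (w b)\<close> undoes the conjugation, then \<open>v0 b\<close> applies.\<close>
  define z where "z b = Comp B (fob F (ob b)) (fob F (fob G0 b)) b (v0 b)
     (Star B (fob F (fob G0 b)) (fob F (ob b)) (farr F (fob G0 b) (ob b) (w b)))" for b
  have v0u: "unitary_arrow B (fob F (fob G0 b)) b (v0 b)" if "b \<in> Ob B" for b
    using unitary_nat_isoD(1)[OF v0 that] by simp
  have Fw: "unitary_arrow B (fob F (fob G0 b)) (fob F (ob b)) (farr F (fob G0 b) (ob b) (w b))"
    if "b \<in> Ob B" for b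
    using F.unitary_image[OF w[OF that]] that assms(1) by simp
  have obG: "ob b = fob G b" for b by (simp add: G_def)
  have z: "unitary_arrow B (fob F (fob G b)) b (z b)" if "b \<in> Ob B" for b
    unfolding z_def obG[symmetric]
    by (rule B.unitary_Comp[OF B.unitary_Star[OF Fw[OF that]] v0u[OF that]]) (use that in simp_all)
  have zc [simp]: "z b \<in> Arr B (fob F (fob G b)) b" if "b \<in> Ob B" for b
    using z[OF that] by (simp add: unitary_arrow_def)
  have znat: "Comp B (fob F (fob G b)) (fob F (fob G c)) c (z c)
      (farr F (fob G b) (fob G c) (farr G b c a)) = Comp B (fob F (fob G b)) b c a (z b)"
    if bc: "b \<in> Ob B" "c \<in> Ob B" and a: "a \<in> Arr B b c" for b c a
  proof -
    have wc: "w b \<in> Arr A (fob G0 b) (ob b)" "w c \<in> Arr A (fob G0 c) (ob c)"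
      "v0 b \<in> Arr B (fob F (fob G0 b)) b" "v0 c \<in> Arr B (fob F (fob G0 c)) c"
      using w v0u bc by (simp_all add: unitary_arrow_def)
    have Fg: "farr F (ob b) (ob c) (farr G b c a) = Comp B (fob F (ob b)) (fob F (fob G0 c)) (fob F (ob c))
       (farr F (fob G0 c) (ob c) (w c))
       (Comp B (fob F (ob b)) (fob F (fob G0 b)) (fob F (fob G0 c))
         (farr F (fob G0 b) (fob G0 c) (farr G0 b c a))
         (Star B (fob F (fob G0 b)) (fob F (ob b)) (farr F (fob G0 b) (ob b) (w b))))"
      using bc a wc by (simp add: G_def farr_conj F.farr_Comp F.farr_Star)
    have nat: "Comp B (fob F (fob G0 b)) (fob F (fob G0 c)) c (v0 c)
        (farr F (fob G0 b) (fob G0 c) (farr G0 b c a)) = Comp B (fob F (fob G0 b)) b c a (v0 b)"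
      using unitary_nat_isoD(3)[OF v0 bc a] by simp
    \<comment> \<open>The adjoint of \<open>F (w c)\<close> inside \<open>z c\<close> cancels the
      factor \<open>F (w c)\<close> that conjugation put into \<open>F (G a)\<close>; what is left
      is naturality of \<open>v0\<close>.\<close>
    have "Comp B (fob F (ob b)) (fob F (ob c)) c (z c)
      (farr F (ob b) (ob c) (farr G b c a)) =
      Comp B (fob F (ob b)) (fob F (fob G0 b)) c (Comp B (fob F (fob G0 b)) (fob F (fob G0 c)) c (v0 c)
        (farr F (fob G0 b) (fob G0 c) (farr G0 b c a)))
         (Star B (fob F (fob G0 b)) (fob F (ob b)) (farr F (fob G0 b) (ob b) (w b)))"
      using bc a wc unfolding Fg z_def by (simp add: B.Comp_assoc B.unitary_cancel[OF Fw])
    also have "\<dots> = Comp B (fob F (ob b)) b c a (z b)"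
      unfolding nat using bc a wc by (simp add: z_def B.Comp_assoc)
    finally show ?thesis by (simp add: obG)
  qed
  \<comment> \<open>As \<open>G F\<close> is the identity, \<open>F G F G b = F G b\<close>, so the
    correcting factor is an automorphism of \<open>F G b\<close> and leaves the source unchanged. At
    \<open>b = F x\<close> the two factors are \<open>z b\<close> and its adjoint, hence
    cancel.\<close>
  define v where "v b = Comp B (fob F (fob G b)) (fob F (fob G b)) b (z b)
     (Star B (fob F (fob G b)) (fob F (fob G b)) (z (fob F (fob G b))))" for b
  have zz: "unitary_arrow B (fob F (fob G b)) (fob F (fob G b)) (z (fob F (fob G b)))"
    if "b \<in> Ob B" for b
    using z[of "fob F (fob G b)"] that by (simp add: GFo)
  have vu: "unitary_arrow B (fob F (fob G b)) b (v b)" if "b \<in> Ob B" for b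
    unfolding v_def using that by (auto intro!: B.unitary_Comp[OF B.unitary_Star[OF zz]] z)
  have vnat: "Comp B (fob F (fob G b)) (fob F (fob G c)) c (v c)
      (farr F (fob G b) (fob G c) (farr G b c a)) = Comp B (fob F (fob G b)) b c a (v b)"
    if bc: "b \<in> Ob B" "c \<in> Ob B" and a: "a \<in> Arr B b c" for b c a
  proof -
    let ?b = "fob F (fob G b)" and ?c = "fob F (fob G c)"
    let ?a = "farr F (fob G b) (fob G c) (farr G b c a)"
    have zzc: "z ?b \<in> Arr B ?b ?b" "z ?c \<in> Arr B ?c ?c"
      using zz bc by (simp_all add: unitary_arrow_def)
    \<comment> \<open>Naturality of \<open>z\<close> is applied to \<open>F (G a)\<close> instead of
      \<open>a\<close>. This arrow is fixed by \<open>F G\<close>, so it intertwines the correcting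
      automorphisms, and therefore also their adjoints.\<close>
    have "Comp B ?b ?c ?c (z ?c) ?a = Comp B ?b ?b ?c ?a (z ?b)"
      using znat[of ?b ?c ?a] bc a by (simp add: GFo GFa)
    then have "Comp B ?b ?c ?c (Star B ?c ?c (z ?c)) ?a
        = Comp B ?b ?c ?c (Star B ?c ?c (z ?c)) (Comp B ?b ?b ?c ?a
            (Comp B ?b ?b ?b (z ?b) (Star B ?b ?b (z ?b))))"
      using zz[OF bc(1)] bc a by (simp add: unitary_arrow_def B.Comp_Idn_right)
    also have "\<dots> = Comp B ?b ?c ?c (Star B ?c ?c (z ?c)) (Comp B ?b ?b ?c
        (Comp B ?b ?b ?c ?a (z ?b)) (Star B ?b ?b (z ?b)))"
      using bc a zzc by (simp add: B.Comp_assoc)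
    also have "\<dots> = Comp B ?b ?c ?c (Star B ?c ?c (z ?c)) (Comp B ?b ?b ?c
        (Comp B ?b ?c ?c (z ?c) ?a) (Star B ?b ?b (z ?b)))"
      using \<open>Comp B ?b ?c ?c (z ?c) ?a = _\<close> by simp
    also have "\<dots> = Comp B ?b ?b ?c ?a (Star B ?b ?b (z ?b))"
      using bc a zzc by (simp add: B.Comp_assoc B.unitary_cancel[OF zz])
    finally have "Comp B ?b ?c c (v c) ?a
        = Comp B ?b ?c c (z c) (Comp B ?b ?b ?c ?a (Star B ?b ?b (z ?b)))"
      using bc a zzc by (simp add: v_def B.Comp_assoc)
    also have "\<dots> = Comp B ?b ?b c (Comp B ?b ?c c (z c) ?a) (Star B ?b ?b (z ?b))"
      using bc a zzc by (simp add: B.Comp_assoc)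
    also have "\<dots> = Comp B ?b b c a (v b)"
      unfolding znat[OF bc a] using bc a zzc by (simp add: v_def B.Comp_assoc)
    finally show ?thesis .
  qed
  show thesis
  proof
    show "star_functor K B A G" by unfold_locales
    show "fctr_eq A (G \<circ>\<^sub>F F) id_fctr" by fact
    show "unitary_nat_iso B B (F \<circ>\<^sub>F G) id_fctr v"
      by (simp add: unitary_nat_iso_def vu vnat)
    show "v (fob F x) = Idn B (fob F x)" if "x \<in> Ob A" for x
      using z[of "fob F x"] that by (simp add: v_def GFo unitary_arrow_def)
  qed
qed


section \<open>Pushouts\<close>

text \<open>Every axiom concerns finitely many given objects and their Hom spaces, and neither
  \<open>hom_dist\<close> nor \<open>spectrum_endo\<close> looks at \<open>Ob\<close>. The full
  subcategory has the same types, so it is an admissible target for the universal property.\<close>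

lemma cstar_category_restrict:
  assumes "cstar_category K A" "S \<subseteq> Ob A"
  shows "cstar_category K (A\<lparr>Ob := S\<rparr>)"
proof -
  interpret cstar_category K A by fact
  have S: "x \<in> Ob A" if "x \<in> S" for x
    using assms(2) that by blast
  have eqs: "hom_dist (A\<lparr>Ob := S\<rparr>) = hom_dist A"
    "spectrum_endo K (A\<lparr>Ob := S\<rparr>) = spectrum_endo K A"
    by (simp_all add: fun_eq_iff hom_dist_def spectrum_endo_def invertible_endo_def)
  show ?thesis
    by (intro cstar_category.intro star_category.intro cstar_category_axioms.intro)
      (simp_all add: S eqs Hom_module Comp_closed Idn_closed Comp_assoc Comp_Idn_right Comp_Idn_left
        Comp_add_right Comp_add_left Comp_smult_right Comp_smult_left Star_closed Star_add
        Star_smult Star_Comp Star_Star Nrm_nonneg Nrm_eq_0_iff Nrm_triangle Nrm_smult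
        Hom_complete Nrm_Comp Nrm_cstar positive)
qed

lemma is_pushoutD:
  assumes "is_pushout K X Y Z f g P p q"
  shows "cstar_category K P" "star_functor K Y P p" "star_functor K Z P q"
    "fctr_eq X (p \<circ>\<^sub>F f) (q \<circ>\<^sub>F g)"
  using assms by (simp_all add: is_pushout_def)

lemma is_induced_sym: "is_induced K Y Z P p q Q s t H \<longleftrightarrow> is_induced K Z Y P q p Q t s H"
  by (auto simp: is_induced_def)

text \<open>Exchanging the legs lets one argument cover both the case where \<open>F\<close> is an
  equivalence and the case of \<open>F'\<close>.\<close>

lemma is_pushout_sym:
  fixes P :: "('o, 'm) cstar_cat"
  assumes "is_pushout K X Y Z f g P p q"
  shows "is_pushout K X Z Y g f P q p"
  unfolding is_pushout_def
proof (intro conjI allI impI)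
  fix Q :: "('o, 'm) cstar_cat" and s t
  assume "cstar_category K Q \<and> star_functor K Z Q s \<and> star_functor K Y Q t \<and>
    fctr_eq X (s \<circ>\<^sub>F g) (t \<circ>\<^sub>F f)"
  then have "cstar_category K Q \<and> star_functor K Y Q t \<and> star_functor K Z Q s \<and>
    fctr_eq X (t \<circ>\<^sub>F f) (s \<circ>\<^sub>F g)"
    by (simp add: fctr_eq_sym)
  then have "\<exists>H. is_induced K Y Z P p q Q t s H \<and>
      (\<forall>H'. is_induced K Y Z P p q Q t s H' \<longrightarrow> fctr_eq P H' H)"
    using assms unfolding is_pushout_def by blast
  then show "\<exists>H. is_induced K Z Y P q p Q s t H \<and>
      (\<forall>H'. is_induced K Z Y P q p Q s t H' \<longrightarrow> fctr_eq P H' H)"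
    by (simp add: is_induced_sym[of K Z])
qed (use is_pushoutD[OF assms] in \<open>simp_all add: fctr_eq_sym\<close>)

text \<open>The uniqueness clause of \<open>is_pushout\<close> speaks about functors that agree on
  \<open>X\<close>. The restrictions of \<open>H1\<close> along \<open>p\<close> and
  \<open>q\<close> do, because the square of the pushout commutes, and \<open>H1\<close> and
  \<open>H2\<close> are both induced by them.\<close>

lemma pushout_induced_unique:
  assumes "is_pushout K X Y Z f g P p q" "cstar_category K Q"
    and "star_functor K X Y f" "star_functor K X Z g"
    and "is_induced K Y Z P p q Q s t H1" "is_induced K Y Z P p q Q s t H2"
  shows "fctr_eq P H1 H2"
proof -
  interpret p: star_functor K Y P p using is_pushoutD[OF assms(1)] by simp
  interpret q: star_functor K Z P q using is_pushoutD[OF assms(1)] by simp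
  interpret f: star_functor K X Y f by fact
  interpret g: star_functor K X Z g by fact
  have HP: "star_functor K P Q H1" "fctr_eq Y (H1 \<circ>\<^sub>F p) s" "fctr_eq Z (H1 \<circ>\<^sub>F q) t"
    using assms(5) by (simp_all add: is_induced_def)
  let ?s = "H1 \<circ>\<^sub>F p" and ?t = "H1 \<circ>\<^sub>F q"
  have "star_functor K Y Q ?s" "star_functor K Z Q ?t"
    using star_functor_comp HP p.star_functor_axioms q.star_functor_axioms by blast+
  moreover have "fctr_eq X (?s \<circ>\<^sub>F f) (?t \<circ>\<^sub>F g)"
    using is_pushoutD(4)[OF assms(1)] by (simp add: fctr_eq_def)
  moreover have "is_induced K Y Z P p q Q ?s ?t H1" "is_induced K Y Z P p q Q ?s ?t H2"
    using assms(5,6) by (simp_all add: is_induced_def fctr_eq_def)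
  ultimately obtain H where
    "\<And>H'. is_induced K Y Z P p q Q ?s ?t H' \<Longrightarrow> fctr_eq P H' H"
    "is_induced K Y Z P p q Q ?s ?t H1" "is_induced K Y Z P p q Q ?s ?t H2"
    using assms(1,2) unfolding is_pushout_def by blast
  then show ?thesis
    using fctr_eq_trans fctr_eq_sym by fast
qed

text \<open>
  The universal property maps \<open>P\<close> to its full subcategory on the images of \<open>p\<close> and \<open>q\<close>, and by
  uniqueness this map followed by the inclusion is the identity of \<open>P\<close>.
\<close>

lemma pushout_objects:
  assumes po: "is_pushout K X Y Z f g P p q"
    and fg: "star_functor K X Y f" "star_functor K X Z g"
  shows "Ob P = fob p ` Ob Y \<union> fob q ` Ob Z"
proof -
  note D = is_pushoutD[OF po]
  interpret p: star_functor K Y P p by (fact D)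
  interpret q: star_functor K Z P q by (fact D)
  define S where "S = fob p ` Ob Y \<union> fob q ` Ob Z"
  let ?P = "P\<lparr>Ob := S\<rparr>"
  have S: "S \<subseteq> Ob P" using p.fob_closed q.fob_closed by (auto simp: S_def)
  have P': "cstar_category K ?P" using D(1) S by (rule cstar_category_restrict)
  have pp: "star_functor K Y ?P p"
    by unfold_locales (simp_all add: S_def p.farr_closed p.farr_Idn p.farr_Comp p.farr_add
        p.farr_smult p.farr_Star)
  have qq: "star_functor K Z ?P q"
    by unfold_locales (simp_all add: S_def q.farr_closed q.farr_Idn q.farr_Comp q.farr_add
        q.farr_smult q.farr_Star)
  obtain H where H: "is_induced K Y Z P p q ?P p q H"
    using po P' pp qq D(4) unfolding is_pushout_def by meson
  then interpret H: star_functor K P ?P H by (simp add: is_induced_def)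
  have HS: "fob H x \<in> S" if "x \<in> Ob P" for x
    using H.fob_closed[OF that] by simp
  \<comment> \<open>This is \<open>H\<close> followed by the inclusion of \<open>?P\<close>; the two
    records share all Hom data, so the same functor record describes the composite.\<close>
  have "star_functor K P P H"
    using HS S H.farr_closed H.farr_Idn H.farr_Comp H.farr_add H.farr_smult H.farr_Star
    by unfold_locales (auto simp: subset_iff)
  then have "is_induced K Y Z P p q P p q H"
    using H by (simp add: is_induced_def)
  moreover have "is_induced K Y Z P p q P p q id_fctr"
    by (simp add: is_induced_def star_functor_id fctr_eq_refl)
  ultimately have "fctr_eq P H id_fctr"
    using pushout_induced_unique[OF po D(1) fg] by blast
  then have "Ob P \<subseteq> S" using HS by (auto simp: fctr_eq_def)
  then show ?thesis using S S_def by blast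
qed

text \<open>Each object of \<open>P\<close> comes from \<open>Y\<close> or \<open>Z\<close> by
  \<open>pushout_objects\<close>. Within one leg injectivity of \<open>s\<close> or \<open>t\<close>
  decides; across the legs \<open>st\<close> lifts a coincidence in \<open>W\<close> to an object of
  \<open>X\<close>, on which \<open>p f\<close> and \<open>q g\<close> agree.\<close>

lemma pushout_induced_inj:
  assumes po: "is_pushout K X Y Z f g P p q"
    and fg: "star_functor K X Y f" "star_functor K X Z g"
    and H: "is_induced K Y Z P p q W s t H"
    and inj: "inj_on (fob s) (Ob Y)" "inj_on (fob t) (Ob Z)"
    and st: "\<And>y z. \<lbrakk>y \<in> Ob Y; z \<in> Ob Z; fob s y = fob t z\<rbrakk>
      \<Longrightarrow> \<exists>x \<in> Ob X. y = fob f x \<and> z = fob g x"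
  shows "inj_on (fob H) (Ob P)"
proof -
  have s: "fob H (fob p y) = fob s y" if "y \<in> Ob Y" for y
    using H that by (simp add: is_induced_def fctr_eq_def)
  have t: "fob H (fob q z) = fob t z" if "z \<in> Ob Z" for z
    using H that by (simp add: is_induced_def fctr_eq_def)
  have pq: "fob p (fob f x) = fob q (fob g x)" if "x \<in> Ob X" for x
    using is_pushoutD(4)[OF po] that by (simp add: fctr_eq_def)
  have st_eq: "fob p y = fob q z" if "y \<in> Ob Y" "z \<in> Ob Z" "fob s y = fob t z" for y z
    using st[OF that] pq by blast
  have im: "(\<exists>y \<in> Ob Y. x = fob p y \<and> fob H x = fob s y) \<or>
      (\<exists>z \<in> Ob Z. x = fob q z \<and> fob H x = fob t z)" if "x \<in> Ob P" for x
    using that s t unfolding pushout_objects[OF po fg] by blast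
  show ?thesis
  proof (rule inj_onI)
    fix x x' assume "x \<in> Ob P" "x' \<in> Ob P" "fob H x = fob H x'"
    then show "x = x'"
      using im[OF \<open>x \<in> Ob P\<close>] im[OF \<open>x' \<in> Ob P\<close>]
      by (elim disjE bexE conjE) (metis inj_onD[OF inj(1)] inj_onD[OF inj(2)] st_eq)+
  qed
qed

text \<open>
  A deformation retraction \<open>r, v\<close> of \<open>Y\<close> onto \<open>X\<close> pushes forward to one of \<open>P\<close> onto \<open>Z\<close>, with
  retraction \<open>S \<circ> H\<close>.  Instead of a cylinder or a category of unitaries in \<open>P\<close>, which need not exist
  in the universe, the proof conjugates \<open>q \<circ> S \<circ> H\<close> by the unitaries \<open>w\<close>; by uniqueness, the
  result is the identity of \<open>P\<close>.
\<close>

lemma pushout_induced_unitary_equivalence: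
  assumes po: "is_pushout K X Y Z f g P p q"
    and cats: "star_category K Y" "star_category K W"
    and fn: "star_functor K X Y f" "star_functor K X Z g" "star_functor K Y X r"
      "star_functor K Y W s" "star_functor K Z W t" "star_functor K W Z S"
    and H: "is_induced K Y Z P p q W s t H"
    and inj: "inj_on (fob s) (Ob Y)"
    and st: "\<And>y z. \<lbrakk>y \<in> Ob Y; z \<in> Ob Z; fob s y = fob t z\<rbrakk>
      \<Longrightarrow> \<exists>x \<in> Ob X. y = fob f x \<and> z = fob g x"
    and v: "unitary_nat_iso Y Y (f \<circ>\<^sub>F r) id_fctr v"
    and vf: "\<And>x. x \<in> Ob X \<Longrightarrow> v (fob f x) = Idn Y (fob f x)"
    and St: "fctr_eq Z (S \<circ>\<^sub>F t) id_fctr"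
    and v': "unitary_nat_iso W W (t \<circ>\<^sub>F S) id_fctr v'"
    and Ss: "fctr_eq Y (S \<circ>\<^sub>F s) (g \<circ>\<^sub>F r)"
  shows "unitary_equivalence K P W H"
proof -
  note D = is_pushoutD[OF po]
  interpret P: cstar_category K P by (fact D)
  interpret p: star_functor K Y P p by (fact D)
  interpret q: star_functor K Z P q by (fact D)
  interpret Y: star_category K Y by fact
  interpret W: star_category K W by fact
  interpret f: star_functor K X Y f by fact
  interpret g: star_functor K X Z g by fact
  interpret r: star_functor K Y X r by fact
  interpret s: star_functor K Y W s by fact
  interpret t: star_functor K Z W t by fact
  interpret S: star_functor K W Z S by fact
  interpret H: star_functor K P W H using H by (simp add: is_induced_def)
  note cl [simp] = p.fob_closed q.fob_closed f.fob_closed g.fob_closed r.fob_closed s.fob_closed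
    t.fob_closed S.fob_closed H.fob_closed
    p.farr_closed q.farr_closed f.farr_closed g.farr_closed r.farr_closed s.farr_closed
    t.farr_closed S.farr_closed H.farr_closed P.Comp_closed P.Idn_closed P.Star_closed
    W.Comp_closed W.Idn_closed W.Star_closed Y.Comp_closed Y.Idn_closed Y.Star_closed
  have Hp: "fob H (fob p y) = fob s y" if "y \<in> Ob Y" for y
    using H that by (simp add: is_induced_def fctr_eq_def)
  have Hp': "farr H (fob p y) (fob p y') (farr p y y' a) = farr s y y' a"
    if "y \<in> Ob Y" "y' \<in> Ob Y" "a \<in> Arr Y y y'" for y y' a
    using H that by (simp add: is_induced_def fctr_eq_def)
  have Hq: "fob H (fob q y) = fob t y" if "y \<in> Ob Z" for y
    using H that by (simp add: is_induced_def fctr_eq_def)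
  have Hq': "farr H (fob q y) (fob q y') (farr q y y' a) = farr t y y' a"
    if "y \<in> Ob Z" "y' \<in> Ob Z" "a \<in> Arr Z y y'" for y y' a
    using H that by (simp add: is_induced_def fctr_eq_def)
  have pf: "fob q (fob g x) = fob p (fob f x)" if "x \<in> Ob X" for x
    using D(4) that by (simp add: fctr_eq_def)
  have pf': "farr q (fob g x) (fob g y) (farr g x y a) = farr p (fob f x) (fob f y) (farr f x y a)"
    if "x \<in> Ob X" "y \<in> Ob X" "a \<in> Arr X x y" for x y a
    using D(4) that by (simp add: fctr_eq_def)
  have St0: "fob S (fob t z) = z" if "z \<in> Ob Z" for z
    using St that by (simp add: fctr_eq_def)
  have St1: "farr S (fob t z) (fob t z') (farr t z z' a) = a"
    if "z \<in> Ob Z" "z' \<in> Ob Z" "a \<in> Arr Z z z'" for z z' a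
    using St that by (simp add: fctr_eq_def)
  have Ss0: "fob S (fob s y) = fob g (fob r y)" if "y \<in> Ob Y" for y
    using Ss that by (simp add: fctr_eq_def)
  have Ss1: "farr S (fob s y) (fob s y') (farr s y y' a) = farr g (fob r y) (fob r y') (farr r y y' a)"
    if "y \<in> Ob Y" "y' \<in> Ob Y" "a \<in> Arr Y y y'" for y y' a
    using Ss that by (simp add: fctr_eq_def)
  \<comment> \<open>The inverse of \<open>H\<close> up to unitary isomorphism; \<open>M\<close> is
    its composite with \<open>H\<close>, an endofunctor of \<open>P\<close>.\<close>
  define N where "N = q \<circ>\<^sub>F S"
  interpret N: star_functor K W P N
    unfolding N_def by (rule star_functor_comp) unfold_locales
  define M where "M = N \<circ>\<^sub>F H"
  interpret M: star_functor K P P M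
    unfolding M_def by (rule star_functor_comp) unfold_locales
  have vu: "unitary_arrow Y (fob f (fob r y)) y (v y)" if "y \<in> Ob Y" for y
    using unitary_nat_isoD(1)[OF v that] by simp
  \<comment> \<open>\<open>inv_into\<close> is a true inverse here: \<open>s\<close> is
    \<open>H\<close> after \<open>p\<close>, so \<open>p\<close> inherits injectivity on objects
    from \<open>s\<close>.\<close>
  define w where "w x = (if x \<in> fob p ` Ob Y then
      let y = inv_into (Ob Y) (fob p) x in farr p (fob f (fob r y)) y (v y) else Idn P x)" for x
  have injp: "inj_on (fob p) (Ob Y)"
    using inj by (auto simp: inj_on_def Hp[symmetric])
  have Mp: "fob M (fob p y) = fob p (fob f (fob r y))" if "y \<in> Ob Y" for y
    using that by (simp add: M_def N_def Hp Ss0 pf)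
  have Mq: "fob M (fob q z) = fob q z" if "z \<in> Ob Z" for z
    using that by (simp add: M_def N_def Hq St0)
  have wp: "w (fob p y) = farr p (fob f (fob r y)) y (v y)" if "y \<in> Ob Y" for y
    using that injp by (simp add: w_def Let_def)
  \<comment> \<open>The overlap of the two prescriptions. If \<open>q z = p y\<close>, then
    \<open>s y = t z\<close>, so \<open>y = f x\<close> for some \<open>x\<close>, and
    \<open>v y\<close> is the identity by \<open>vf\<close>. Since \<open>M\<close> fixes
    \<open>q z\<close>, also \<open>f (r y) = y\<close>, and \<open>p (v y)\<close> is an identity
    of \<open>P\<close>.\<close>
  have wq: "w (fob q z) = Idn P (fob q z)" if z: "z \<in> Ob Z" for z
  proof (cases "fob q z \<in> fob p ` Ob Y")
    case True
    then obtain y where y: "y \<in> Ob Y" "fob q z = fob p y" by blast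
    then obtain x where x: "x \<in> Ob X" "y = fob f x" "z = fob g x"
      using st[OF y(1) z] Hp[OF y(1)] Hq[OF z] by auto
    have "fob p (fob f (fob r y)) = fob p y"
      using Mp[OF y(1)] Mq[OF that] y(2) by simp
    then have "fob f (fob r y) = y"
      using injp y(1) by (auto simp: inj_on_def)
    then show ?thesis
      using wp[OF y(1)] y vf x p.farr_Idn[OF y(1)] by simp
  qed (simp add: w_def)
  have obP: "Ob P = fob p ` Ob Y \<union> fob q ` Ob Z"
    using pushout_objects[OF po fn(1,2)] .
  have w: "unitary_arrow P (fob M x) x (w x)" if "x \<in> Ob P" for x
    using that p.unitary_image[OF vu] P.unitary_Idn Y.star_category_axioms
    by (auto simp: obP wp wq Mp Mq)
  \<comment> \<open>\<open>E\<close> has the identity as object map and sends \<open>a\<close> to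
    \<open>w y M(a) w x\<close>*; that it is the identity functor is exactly naturality of
    \<open>w\<close>.\<close>
  define E where "E = conj_fctr P (\<lambda>x. x) w M"
  have E: "star_functor K P P E"
    unfolding E_def
    by (rule star_functor_conj) (use w in \<open>simp_all add: M.star_functor_axioms P.star_category_axioms\<close>)
  have "fctr_eq Y (E \<circ>\<^sub>F p) p"
    unfolding fctr_eq_def
  proof (intro conjI ballI)
    fix y y' a assume y: "y \<in> Ob Y" "y' \<in> Ob Y" and a: "a \<in> Arr Y y y'"
    let ?b = "fob f (fob r y)" and ?b' = "fob f (fob r y')"
      and ?a = "farr f (fob r y) (fob r y') (farr r y y' a)"
    have vc: "v y \<in> Arr Y ?b y" "v y' \<in> Arr Y ?b' y'"
      using y vu by (simp_all add: unitary_arrow_def)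
    \<comment> \<open>\<open>S s = g r\<close> and \<open>q g = p f\<close> turn
      \<open>M p = q S H p\<close> into \<open>p f r\<close>. What remains is naturality of
      \<open>v\<close>, applied inside \<open>Y\<close>.\<close>
    have "farr M (fob p y) (fob p y') (farr p y y' a) = farr p ?b ?b' ?a"
      using y a by (simp add: M_def N_def Hp Hp' Ss0 Ss1 pf')
    then have "farr (E \<circ>\<^sub>F p) y y' a = Comp P (fob p y) (fob p ?b') (fob p y')
        (farr p ?b' y' (v y')) (Comp P (fob p y) (fob p ?b) (fob p ?b') (farr p ?b ?b' ?a)
          (Star P (fob p ?b) (fob p y) (farr p ?b y (v y))))"
      using y by (simp add: E_def farr_conj wp Mp)
    also have "\<dots> = farr p y y' (Comp Y y ?b' y' (v y') (Comp Y y ?b ?b' ?a (Star Y ?b y (v y))))"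
      using y a vc by (simp add: p.farr_Comp p.farr_Star)
    also have "Comp Y y ?b' y' (v y') (Comp Y y ?b ?b' ?a (Star Y ?b y (v y)))
        = Comp Y y ?b y' (Comp Y ?b ?b' y' (v y') ?a) (Star Y ?b y (v y))"
      using y a vc by (simp add: Y.Comp_assoc)
    also have "\<dots> = Comp Y y ?b y' (Comp Y ?b y y' a (v y)) (Star Y ?b y (v y))"
      using unitary_nat_isoD(3)[OF v y a] by simp
    also have "\<dots> = a"
      using y a vc vu[OF y(1)] by (simp add: Y.Comp_assoc unitary_arrow_def Y.Comp_Idn_right)
    finally show "farr (E \<circ>\<^sub>F p) y y' a = farr p y y' a" .
  qed (simp add: E_def)
  \<comment> \<open>On this leg \<open>M q = q S t = q\<close>, and \<open>w\<close> is the identity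
    there.\<close>
  moreover have "fctr_eq Z (E \<circ>\<^sub>F q) q"
    unfolding fctr_eq_def
    by (auto simp: E_def farr_conj Mq wq M_def N_def Hq Hq' St0 St1 P.Star_Idn P.Comp_Idn_left
        P.Comp_Idn_right)
  ultimately have "is_induced K Y Z P p q P p q E"
    using E by (simp add: is_induced_def)
  moreover have "is_induced K Y Z P p q P p q id_fctr"
    by (simp add: is_induced_def star_functor_id fctr_eq_refl)
  ultimately have Eid: "fctr_eq P E id_fctr"
    using pushout_induced_unique[OF po D(1) fn(1,2)] by blast
  \<comment> \<open>Multiplying \<open>a = w y M(a) w x\<close>* on the right by \<open>w x\<close>
    gives the naturality square.\<close>
  have "unitary_nat_iso P P (N \<circ>\<^sub>F H) id_fctr w"
    unfolding unitary_nat_iso_def M_def[symmetric]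
  proof (intro conjI ballI)
    fix x y a assume x: "x \<in> Ob P" "y \<in> Ob P" and a: "a \<in> Arr P x y"
    have wc: "w x \<in> Arr P (fob M x) x" "w y \<in> Arr P (fob M y) y"
      using x w by (simp_all add: unitary_arrow_def)
    have wx: "Comp P (fob M x) x (fob M x) (Star P (fob M x) x (w x)) (w x) = Idn P (fob M x)"
      using w[OF x(1)] by (simp add: unitary_arrow_def)
    have "a = farr E x y a"
      using fctr_eqD(2)[OF Eid x a] by simp
    then have "Comp P (fob M x) x y a (w x) = Comp P (fob M x) x y (farr E x y a) (w x)"
      by simp
    also have "\<dots> = Comp P (fob M x) (fob M y) y (w y) (farr M x y a)"
      using x a wc by (simp add: E_def farr_conj P.Comp_assoc wx P.Comp_Idn_right
          M.fob_closed M.farr_closed)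
    finally show "Comp P (fob M x) (fob M y) (fob id_fctr y) (w y) (farr M x y a)
        = Comp P (fob M x) (fob id_fctr x) (fob id_fctr y) (farr id_fctr x y a) (w x)"
      by simp
  qed (simp add: w)
  \<comment> \<open>Here \<open>H N = H q S = t S\<close>, so the given \<open>v'\<close> already
    serves.\<close>
  moreover have "unitary_nat_iso W W (H \<circ>\<^sub>F N) id_fctr v'"
    using v' by (simp add: unitary_nat_iso_def N_def Hq Hq')
  ultimately show ?thesis
    unfolding unitary_equivalence_def
    using H.star_functor_axioms N.star_functor_axioms by blast
qed


section \<open>Formal sums and the tensor product of vector spaces\<close>

definition pscale :: "complex \<Rightarrow> ('a \<Rightarrow>\<^sub>0 complex) \<Rightarrow> ('a \<Rightarrow>\<^sub>0 complex)" where
  "pscale c f = Poly_Mapping.map (\<lambda>z. c * z) f"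

lemma lookup_pscale: "Poly_Mapping.lookup (pscale c f) k = c * Poly_Mapping.lookup f k"
  by (simp add: pscale_def Poly_Mapping.map.rep_eq when_def)

lemma pscale_simps [simp]:
  "pscale c 0 = 0" "pscale 0 f = 0" "pscale 1 f = f"
  "pscale c (f + g) = pscale c f + pscale c g" "pscale c (f - g) = pscale c f - pscale c g"
  "pscale c (pscale d f) = pscale (c * d) f"
  "pscale c (Poly_Mapping.single p d) = Poly_Mapping.single p (c * d)"
  by (rule poly_mapping_eqI;
      simp add: lookup_pscale lookup_add lookup_minus lookup_single when_def algebra_simps)+

lemma pscale_add: "pscale (c + d) f = pscale c f + pscale d f"
  and pscale_uminus: "pscale (- 1) f = - f"
  by (rule poly_mapping_eqI; simp add: lookup_pscale lookup_add distrib_right)+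

lemma pscale_sum: "pscale c (sum f S) = (\<Sum>x\<in>S. pscale c (f x))"
  by (induction S rule: infinite_finite_induct) simp_all

text \<open>The two scalar twists that occur: the identity for composition and for functors,
  \<open>cnj\<close> for the involution. Linear and antilinear extensions are thus treated
  together.\<close>

definition conjugation_like :: "(complex \<Rightarrow> complex) \<Rightarrow> bool" where
  "conjugation_like \<sigma> \<longleftrightarrow> \<sigma> = (\<lambda>z. z) \<or> \<sigma> = cnj"

lemma conjugation_like [simp]: "conjugation_like (\<lambda>z. z)" "conjugation_like cnj"
  by (simp_all add: conjugation_like_def)

text \<open>The semilinear extension of \<open>\<phi>\<close> from basis elements to formal sums.
  Composition, involution and \<open>F \<otimes> F'\<close> as defined on representatives are all of
  this form.\<close>

definition lext ::
  "(complex \<Rightarrow> complex) \<Rightarrow> ('a \<Rightarrow> ('b \<Rightarrow>\<^sub>0 complex)) \<Rightarrow> ('a \<Rightarrow>\<^sub>0 complex) \<Rightarrow> ('b \<Rightarrow>\<^sub>0 complex)" where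
  "lext \<sigma> \<phi> f = (\<Sum>p \<in> Poly_Mapping.keys f. pscale (\<sigma> (Poly_Mapping.lookup f p)) (\<phi> p))"

lemma conjugation_like_simps:
  assumes "conjugation_like \<sigma>"
  shows "\<sigma> 0 = 0" "\<sigma> 1 = 1" "\<sigma> (a + b) = \<sigma> a + \<sigma> b" "\<sigma> (a * b) = \<sigma> a * \<sigma> b"
  using assms by (auto simp: conjugation_like_def)

text \<open>Cancellation can make the support of a sum smaller than the union of the supports; added
  terms have coefficient zero, so formal sums can be compared over one common finite set.\<close>

lemma lext_superset:
  assumes "conjugation_like \<sigma>" "finite S" "Poly_Mapping.keys f \<subseteq> S"
  shows "lext \<sigma> \<phi> f = (\<Sum>p \<in> S. pscale (\<sigma> (Poly_Mapping.lookup f p)) (\<phi> p))"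
  unfolding lext_def
  by (rule sum.mono_neutral_left)
    (use assms conjugation_like_simps[OF assms(1)] in \<open>auto simp: in_keys_iff\<close>)

lemma lext_cong: "(\<And>p. p \<in> Poly_Mapping.keys f \<Longrightarrow> \<phi> p = \<psi> p) \<Longrightarrow> lext \<sigma> \<phi> f = lext \<sigma> \<psi> f"
  unfolding lext_def by (rule sum.cong) simp_all

lemma lext_zero [simp]: "lext \<sigma> \<phi> 0 = 0"
  by (simp add: lext_def)

lemma lext_add:
  assumes "conjugation_like \<sigma>"
  shows "lext \<sigma> \<phi> (f + g) = lext \<sigma> \<phi> f + lext \<sigma> \<phi> g"
proof -
  let ?S = "Poly_Mapping.keys f \<union> Poly_Mapping.keys g"
  have "Poly_Mapping.keys (f + g) \<subseteq> ?S" by (rule keys_add)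
  then show ?thesis
    by (simp add: lext_superset[OF assms, of ?S] lookup_add conjugation_like_simps[OF assms] pscale_add sum.distrib)
qed

lemma lext_pscale:
  assumes "conjugation_like \<sigma>"
  shows "lext \<sigma> \<phi> (pscale c f) = pscale (\<sigma> c) (lext \<sigma> \<phi> f)"
proof -
  have "Poly_Mapping.keys (pscale c f) \<subseteq> Poly_Mapping.keys f"
    by (auto simp: in_keys_iff lookup_pscale)
  then show ?thesis
    by (simp add: lext_superset[OF assms, of "Poly_Mapping.keys f"] lookup_pscale conjugation_like_simps[OF assms] pscale_sum)
qed

lemma lext_minus:
  assumes "conjugation_like \<sigma>"
  shows "lext \<sigma> \<phi> (f - g) = lext \<sigma> \<phi> f - lext \<sigma> \<phi> g"
  using lext_add[OF assms, of \<phi> "f - g" g] by simp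

lemma lext_single:
  assumes "conjugation_like \<sigma>"
  shows "lext \<sigma> \<phi> (Poly_Mapping.single p c) = pscale (\<sigma> c) (\<phi> p)"
  by (simp add: lext_superset[OF assms, of "{p}"])

lemma lext_sum:
  assumes "conjugation_like \<sigma>"
  shows "lext \<sigma> \<phi> (sum h S) = (\<Sum>x\<in>S. lext \<sigma> \<phi> (h x))"
  by (induction S rule: infinite_finite_induct) (simp_all add: lext_add[OF assms])

lemma lext_lext:
  assumes "conjugation_like \<sigma>"
  shows "lext \<sigma> \<phi> (lext \<tau> \<psi> f) = lext (\<lambda>z. \<sigma> (\<tau> z)) (\<lambda>p. lext \<sigma> \<phi> (\<psi> p)) f"
  unfolding lext_def[of \<tau>] lext_def[of "\<lambda>z. \<sigma> (\<tau> z)"]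
  by (simp add: lext_sum[OF assms] lext_pscale[OF assms])

lemma lext_diff_fun: "lext \<sigma> (\<lambda>p. \<phi> p - \<psi> p) f = lext \<sigma> \<phi> f - lext \<sigma> \<psi> f"
  by (simp add: lext_def sum_subtractf)

lemma lext_pscale_fun: "lext \<sigma> (\<lambda>p. pscale c (\<phi> p)) f = pscale c (lext \<sigma> \<phi> f)"
  by (simp add: lext_def pscale_sum mult.commute)

text \<open>Interchange of two finite sums. It presents composition as an extension in its second
  argument, so that both arguments admit the same treatment.\<close>

lemma lext_swap:
  "lext (\<lambda>z. z) (\<lambda>p. lext (\<lambda>z. z) (\<lambda>q. h p q) g) f = lext (\<lambda>z. z) (\<lambda>q. lext (\<lambda>z. z) (\<lambda>p. h p q) f) g"
  unfolding lext_def by (simp add: pscale_sum mult.commute) (rule sum.swap)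

lemma lext_singles:
  "lext (\<lambda>z. z) (\<lambda>p. Poly_Mapping.single p 1) f = f"
proof (rule poly_mapping_eqI)
  fix k
  have "Poly_Mapping.lookup (lext (\<lambda>z. z) (\<lambda>p. Poly_Mapping.single p 1) f) k
     = (\<Sum>p\<in>Poly_Mapping.keys f. if p = k then Poly_Mapping.lookup f p else 0)"
    by (simp add: lext_def lookup_sum lookup_single when_def cong: sum.cong if_cong)
  also have "\<dots> = Poly_Mapping.lookup f k"
    by (simp add: in_keys_iff)
  finally show "Poly_Mapping.lookup (lext (\<lambda>z. z) (\<lambda>p. Poly_Mapping.single p 1) f) k
    = Poly_Mapping.lookup f k" .
qed

section \<open>Subspaces of formal sums over the ground field\<close>

definition psubspace :: "complex set \<Rightarrow> ('a \<Rightarrow>\<^sub>0 complex) set \<Rightarrow> bool" where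
  "psubspace K S \<longleftrightarrow> 0 \<in> S \<and> (\<forall>f\<in>S. \<forall>g\<in>S. f + g \<in> S) \<and> (\<forall>c\<in>K. \<forall>f\<in>S. pscale c f \<in> S)"

lemma lext_mem:
  assumes "psubspace K S"
    and "\<And>p. p \<in> Poly_Mapping.keys f \<Longrightarrow> \<phi> p \<in> S"
    and "\<And>p. \<sigma> (Poly_Mapping.lookup f p) \<in> K"
  shows "lext \<sigma> \<phi> f \<in> S"
proof -
  have "sum (\<lambda>p. pscale (\<sigma> (Poly_Mapping.lookup f p)) (\<phi> p)) T \<in> S"
    if "T \<subseteq> Poly_Mapping.keys f" for T
    using that assms by (induction T rule: infinite_finite_induct) (auto simp: psubspace_def)
  then show ?thesis by (simp add: lext_def)
qed

lemma scalars_simps [simp]: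
  "carrier (scalars K) = K" "mult (scalars K) = (*)" "one (scalars K) = 1"
  "ring.zero (scalars K) = 0" "add (scalars K) = (+)"
  by (simp_all add: scalars_def)

definition ground_field :: "complex set \<Rightarrow> bool" where
  "ground_field K \<longleftrightarrow> K = \<real> \<or> K = UNIV"

lemma ground_field_simps:
  assumes "ground_field K"
  shows "0 \<in> K" "1 \<in> K" "- 1 \<in> K" "a \<in> K \<Longrightarrow> b \<in> K \<Longrightarrow> a + b \<in> K"
    "a \<in> K \<Longrightarrow> b \<in> K \<Longrightarrow> a * b \<in> K" "a \<in> K \<Longrightarrow> cnj a \<in> K" "of_real r \<in> K"
  using assms by (auto simp: ground_field_def Reals_cnj_iff)

lemma ground_field_conjugation:
  "\<lbrakk>ground_field K; conjugation_like \<sigma>; a \<in> K\<rbrakk> \<Longrightarrow> \<sigma> a \<in> K"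
  using ground_field_simps(6) by (auto simp: conjugation_like_def)

lemma psubspace_minus:
  assumes "ground_field K" "psubspace K S" "f \<in> S" "g \<in> S"
  shows "f - g \<in> S"
proof -
  have "f + pscale (- 1) g \<in> S"
    using assms ground_field_simps[OF assms(1)] by (simp add: psubspace_def)
  then show ?thesis by (simp add: pscale_uminus)
qed

lemma psubspace_formal_sums:
  fixes V :: "(complex, 'a) module" and W :: "(complex, 'b) module"
  assumes "ground_field K"
  shows "psubspace K (formal_sums K V W)"
proof -
  have "Poly_Mapping.keys (f + g) \<subseteq> T"
    if "Poly_Mapping.keys f \<subseteq> T" "Poly_Mapping.keys g \<subseteq> T"
    for f g :: "'a \<times> 'b \<Rightarrow>\<^sub>0 complex" and T
    using that keys_add[of f g] by blast
  moreover have "Poly_Mapping.keys (pscale c f) \<subseteq> T" if "Poly_Mapping.keys f \<subseteq> T"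
    for f :: "'a \<times> 'b \<Rightarrow>\<^sub>0 complex" and T c
    using that by (auto simp: in_keys_iff lookup_pscale)
  ultimately show ?thesis
    using ground_field_simps[OF assms]
    by (simp add: psubspace_def formal_sums_def lookup_add lookup_pscale)
qed

lemma psubspace_relations: "psubspace K (tensor_relations K V W)"
  by (auto simp: psubspace_def pscale_def intro: tensor_relations.intros)

lemma single_formal_sums:
  "\<lbrakk>ground_field K; a \<in> carrier V; b \<in> carrier W; c \<in> K\<rbrakk>
    \<Longrightarrow> Poly_Mapping.single (a, b) c \<in> formal_sums K V W"
  by (auto simp: formal_sums_def lookup_single when_def ground_field_simps)

text \<open>The universal property of the tensor product, modulo a subspace \<open>S\<close>: if
  \<open>\<phi>\<close> is bilinear up to \<open>S\<close> (semilinear in the scalars), its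
  extension maps all generators into \<open>S\<close>, hence also their span. In the applications
  \<open>S\<close> consists of the relations of the target space.\<close>

lemma lext_relations:
  assumes K: "ground_field K" and \<sigma>: "conjugation_like \<sigma>"
    and S: "psubspace K S"
    and rel: "\<And>a a' b. \<lbrakk>a \<in> carrier V; a' \<in> carrier V; b \<in> carrier W\<rbrakk>
        \<Longrightarrow> \<phi> (a \<oplus>\<^bsub>V\<^esub> a', b) - \<phi> (a, b) - \<phi> (a', b) \<in> S"
      "\<And>a b b'. \<lbrakk>a \<in> carrier V; b \<in> carrier W; b' \<in> carrier W\<rbrakk>
        \<Longrightarrow> \<phi> (a, b \<oplus>\<^bsub>W\<^esub> b') - \<phi> (a, b) - \<phi> (a, b') \<in> S"
      "\<And>c a b. \<lbrakk>c \<in> K; a \<in> carrier V; b \<in> carrier W\<rbrakk>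
        \<Longrightarrow> \<phi> (c \<odot>\<^bsub>V\<^esub> a, b) - pscale (\<sigma> c) (\<phi> (a, b)) \<in> S"
      "\<And>c a b. \<lbrakk>c \<in> K; a \<in> carrier V; b \<in> carrier W\<rbrakk>
        \<Longrightarrow> \<phi> (a, c \<odot>\<^bsub>W\<^esub> b) - pscale (\<sigma> c) (\<phi> (a, b)) \<in> S"
    and "f \<in> tensor_relations K V W"
  shows "lext \<sigma> \<phi> f \<in> S"
  using assms(8)
  by (induction rule: tensor_relations.induct)
    (use S rel ground_field_conjugation[OF K \<sigma>] in
      \<open>simp_all add: pscale_def[symmetric] lext_add[OF \<sigma>] lext_minus[OF \<sigma>] lext_single[OF \<sigma>] lext_pscale[OF \<sigma>]
        conjugation_like_simps[OF \<sigma>] psubspace_def\<close>)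

section \<open>Classes of formal sums and their representatives\<close>

lemma tclass_eq_iff:
  assumes "ground_field K" "f \<in> formal_sums K V W" "g \<in> formal_sums K V W"
  shows "tclass K V W f = tclass K V W g \<longleftrightarrow> f - g \<in> tensor_relations K V W"
proof
  assume "tclass K V W f = tclass K V W g"
  moreover have "f \<in> tclass K V W f"
    using assms psubspace_relations[of K V W] by (simp add: tclass_def psubspace_def)
  ultimately have "f \<in> tclass K V W g" by (rule subst)
  then show "f - g \<in> tensor_relations K V W" by (simp add: tclass_def)
next
  assume *: "f - g \<in> tensor_relations K V W"
  have "h - g \<in> tensor_relations K V W \<longleftrightarrow> h - f \<in> tensor_relations K V W" for h
  proof
    assume "h - g \<in> tensor_relations K V W"
    then have "(h - g) - (f - g) \<in> tensor_relations K V W"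
      using * by (rule psubspace_minus[OF assms(1) psubspace_relations])
    then show "h - f \<in> tensor_relations K V W" by simp
  next
    assume "h - f \<in> tensor_relations K V W"
    then have "(h - f) + (f - g) \<in> tensor_relations K V W"
      using * by (rule tensor_relations.add)
    then show "h - g \<in> tensor_relations K V W" by simp
  qed
  then show "tclass K V W f = tclass K V W g" by (simp add: tclass_def)
qed

lemma trep_tclass:
  assumes "ground_field K" "f \<in> formal_sums K V W"
  shows "trep (tclass K V W f) \<in> formal_sums K V W"
    and "trep (tclass K V W f) - f \<in> tensor_relations K V W"
proof -
  have "f \<in> tclass K V W f"
    using assms psubspace_relations[of K V W] by (simp add: tclass_def psubspace_def)
  then have "trep (tclass K V W f) \<in> tclass K V W f"
    unfolding trep_def by (rule someI)
  then show "trep (tclass K V W f) \<in> formal_sums K V W"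
    "trep (tclass K V W f) - f \<in> tensor_relations K V W"
    by (simp_all add: tclass_def)
qed

text \<open>The chosen representative differs from \<open>f\<close> by a relation, and relations
  form a subspace, so the operations can be computed on any representative.\<close>

lemma tensor_space_simps:
  assumes K: "ground_field K" and "f \<in> formal_sums K V W" "g \<in> formal_sums K V W"
  shows "tclass K V W f \<oplus>\<^bsub>tensor_space K V W\<^esub> tclass K V W g = tclass K V W (f + g)"
    and "c \<in> K \<Longrightarrow> c \<odot>\<^bsub>tensor_space K V W\<^esub> tclass K V W f = tclass K V W (pscale c f)"
proof -
  note [simp] = trep_tclass[OF K]
  note S = psubspace_formal_sums[OF K, of V W] and R = psubspace_relations[of K V W]
  let ?f = "trep (tclass K V W f)" and ?g = "trep (tclass K V W g)"
  have "(?f - f) + (?g - g) \<in> tensor_relations K V W"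
    using R assms trep_tclass by (simp add: psubspace_def)
  then have "?f + ?g - (f + g) \<in> tensor_relations K V W"
    by (simp add: algebra_simps)
  then show "tclass K V W f \<oplus>\<^bsub>tensor_space K V W\<^esub> tclass K V W g = tclass K V W (f + g)"
    using S assms trep_tclass by (simp add: tensor_space_def pscale_def[symmetric] tclass_eq_iff[OF K] psubspace_def)
  assume c: "c \<in> K"
  have "pscale c (?f - f) \<in> tensor_relations K V W"
    using R assms trep_tclass c unfolding psubspace_def by blast
  then show "c \<odot>\<^bsub>tensor_space K V W\<^esub> tclass K V W f = tclass K V W (pscale c f)"
    using S assms trep_tclass c by (simp add: tensor_space_def pscale_def[symmetric] tclass_eq_iff[OF K] psubspace_def)
qed

lemma carrier_tensor_space: "carrier (tensor_space K V W) = tclass K V W ` formal_sums K V W"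
  by (simp add: tensor_space_def)


section \<open>Functoriality of the algebraic tensor product\<close>

locale star_category_pair = A: star_category K A + B: star_category K B
  for K and A :: "('o, 'm, 'z) star_cat_scheme" and B :: "('p, 'n, 'y) star_cat_scheme" +
  assumes K: "ground_field K"
begin

lemma alg_tensor_Ob [simp]: "Ob (alg_tensor K A B) = Ob A \<times> Ob B"
  by (simp add: alg_tensor_def)

abbreviation FS where "FS x x' y y' \<equiv> formal_sums K (Hom A x y) (Hom B x' y')"

abbreviation TR where "TR x x' y y' \<equiv> tensor_relations K (Hom A x y) (Hom B x' y')"

abbreviation cls where "cls x x' y y' \<equiv> tclass K (Hom A x y) (Hom B x' y')"

lemma alg_tensor_Hom:
  "Hom (alg_tensor K A B) (x, x') (y, y') = tensor_space K (Hom A x y) (Hom B x' y')"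
  by (simp add: alg_tensor_def)

lemma alg_tensor_Arr: "Arr (alg_tensor K A B) (x, x') (y, y') = cls x x' y y' ` FS x x' y y'"
  by (simp add: alg_tensor_Hom carrier_tensor_space)

text \<open>The composite before passage to classes. As a nested extension it is bilinear, and
  descent to classes can be shown for one argument at a time.\<close>

definition tcomp where
  "tcomp x x' y y' z z' f g =
     lext (\<lambda>z. z) (\<lambda>p. lext (\<lambda>z. z) (\<lambda>q. Poly_Mapping.single
       (Comp A x y z (fst p) (fst q), Comp B x' y' z' (snd p) (snd q)) 1) g) f"

definition tstar where
  "tstar x x' y y' f = lext cnj (\<lambda>p. Poly_Mapping.single (Star A x y (fst p), Star B x' y' (snd p)) 1) f"

lemma FS_keys:
  assumes "f \<in> FS x x' y y'"
  shows "p \<in> Poly_Mapping.keys f \<Longrightarrow> fst p \<in> Arr A x y"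
    and "p \<in> Poly_Mapping.keys f \<Longrightarrow> snd p \<in> Arr B x' y'"
    and "Poly_Mapping.lookup f p \<in> K"
  using assms by (cases p; auto simp: formal_sums_def)+

lemma FS_closed:
  "\<lbrakk>f \<in> FS x x' y y'; g \<in> FS x x' y y'\<rbrakk> \<Longrightarrow> f + g \<in> FS x x' y y'"
  "\<lbrakk>c \<in> K; f \<in> FS x x' y y'\<rbrakk> \<Longrightarrow> pscale c f \<in> FS x x' y y'"
  using psubspace_formal_sums[OF K, of "Hom A x y" "Hom B x' y'"] by (simp_all add: psubspace_def)

lemma tensor_relations_intros:
  "\<lbrakk>a \<in> Arr A x y; a' \<in> Arr A x y; b \<in> Arr B x' y'\<rbrakk> \<Longrightarrow>
     Poly_Mapping.single (a \<oplus>\<^bsub>Hom A x y\<^esub> a', b) 1 - Poly_Mapping.single (a, b) 1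
       - Poly_Mapping.single (a', b) 1 \<in> TR x x' y y'"
  "\<lbrakk>a \<in> Arr A x y; b \<in> Arr B x' y'; b' \<in> Arr B x' y'\<rbrakk> \<Longrightarrow>
     Poly_Mapping.single (a, b \<oplus>\<^bsub>Hom B x' y'\<^esub> b') 1 - Poly_Mapping.single (a, b) 1
       - Poly_Mapping.single (a, b') 1 \<in> TR x x' y y'"
  "\<lbrakk>c \<in> K; a \<in> Arr A x y; b \<in> Arr B x' y'\<rbrakk> \<Longrightarrow>
     Poly_Mapping.single (c \<odot>\<^bsub>Hom A x y\<^esub> a, b) 1 - Poly_Mapping.single (a, b) c \<in> TR x x' y y'"
  "\<lbrakk>c \<in> K; a \<in> Arr A x y; b \<in> Arr B x' y'\<rbrakk> \<Longrightarrow>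
     Poly_Mapping.single (a, c \<odot>\<^bsub>Hom B x' y'\<^esub> b) 1 - Poly_Mapping.single (a, b) c \<in> TR x x' y y'"
  by (rule tensor_relations.intros; assumption)+

lemma tstar_FS:
  assumes "x \<in> Ob A" "y \<in> Ob A" "x' \<in> Ob B" "y' \<in> Ob B" "f \<in> FS x x' y y'"
  shows "tstar x x' y y' f \<in> FS y y' x x'"
  unfolding tstar_def
  by (rule lext_mem[OF psubspace_formal_sums[OF K]])
    (use assms FS_keys[OF assms(5)] ground_field_simps[OF K] in
      \<open>simp_all add: single_formal_sums[OF K] A.Star_closed B.Star_closed\<close>)

lemma tstar_TR:
  assumes "x \<in> Ob A" "y \<in> Ob A" "x' \<in> Ob B" "y' \<in> Ob B" "f \<in> TR x x' y y'"
  shows "tstar x x' y y' f \<in> TR y y' x x'"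
  unfolding tstar_def
  by (rule lext_relations[OF K _ psubspace_relations _ _ _ _ assms(5)])
    (use assms ground_field_simps[OF K] in
      \<open>simp_all add: tensor_relations_intros A.Star_closed B.Star_closed A.Star_add B.Star_add
        A.Star_smult B.Star_smult\<close>)

lemma tcomp_FS:
  assumes "x \<in> Ob A" "y \<in> Ob A" "z \<in> Ob A" "x' \<in> Ob B" "y' \<in> Ob B" "z' \<in> Ob B"
    and f: "f \<in> FS y y' z z'" and g: "g \<in> FS x x' y y'"
  shows "tcomp x x' y y' z z' f g \<in> FS x x' z z'"
  unfolding tcomp_def
  by (intro lext_mem[OF psubspace_formal_sums[OF K]])
    (use assms FS_keys[OF f] FS_keys[OF g] ground_field_simps[OF K] in
      \<open>simp_all add: single_formal_sums[OF K] A.Comp_closed B.Comp_closed\<close>)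

text \<open>For a fixed pair on the right, composition turns a generating relation into one of the
  target. The differences are moved inside the inner extension, which then combines relations with
  coefficients in \<open>K\<close>; \<open>lext_swap\<close> reduces the other argument to the same
  argument.\<close>

lemma tcomp_TR_left:
  assumes "x \<in> Ob A" "y \<in> Ob A" "z \<in> Ob A" "x' \<in> Ob B" "y' \<in> Ob B" "z' \<in> Ob B"
    and f: "f \<in> TR y y' z z'" and g: "g \<in> FS x x' y y'"
  shows "tcomp x x' y y' z z' f g \<in> TR x x' z z'"
  unfolding tcomp_def
  by (rule lext_relations[OF K _ psubspace_relations _ _ _ _ f];
      (simp only: conjugation_like lext_diff_fun[symmetric] lext_pscale_fun[symmetric])?;
      (rule lext_mem[OF psubspace_relations])?)
    (use assms FS_keys[OF g] ground_field_simps[OF K] in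
      \<open>simp_all add: tensor_relations_intros A.Comp_closed B.Comp_closed A.Comp_add_left
        B.Comp_add_left A.Comp_smult_left B.Comp_smult_left\<close>)

lemma tcomp_TR_right:
  assumes "x \<in> Ob A" "y \<in> Ob A" "z \<in> Ob A" "x' \<in> Ob B" "y' \<in> Ob B" "z' \<in> Ob B"
    and f: "f \<in> FS y y' z z'" and g: "g \<in> TR x x' y y'"
  shows "tcomp x x' y y' z z' f g \<in> TR x x' z z'"
  unfolding tcomp_def lext_swap[of _ g f]
  by (rule lext_relations[OF K _ psubspace_relations _ _ _ _ g];
      (simp only: conjugation_like lext_diff_fun[symmetric] lext_pscale_fun[symmetric])?;
      (rule lext_mem[OF psubspace_relations])?)
    (use assms FS_keys[OF f] ground_field_simps[OF K] in
      \<open>simp_all add: tensor_relations_intros A.Comp_closed B.Comp_closed A.Comp_add_right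
        B.Comp_add_right A.Comp_smult_right B.Comp_smult_right\<close>)

lemma alg_tensor_Star:
  assumes "x \<in> Ob A" "y \<in> Ob A" "x' \<in> Ob B" "y' \<in> Ob B" "f \<in> FS x x' y y'"
  shows "Star (alg_tensor K A B) (x, x') (y, y') (cls x x' y y' f) = cls y y' x x' (tstar x x' y y' f)"
proof -
  let ?f = "trep (cls x x' y y' f)"
  have f: "?f \<in> FS x x' y y'" "?f - f \<in> TR x x' y y'"
    using trep_tclass[OF K assms(5)] by simp_all
  have "tstar x x' y y' (?f - f) \<in> TR y y' x x'"
    using assms f tstar_TR by blast
  then have "cls y y' x x' (tstar x x' y y' ?f) = cls y y' x x' (tstar x x' y y' f)"
    using tclass_eq_iff[OF K tstar_FS tstar_FS] assms f by (simp add: tstar_def lext_minus)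
  then show ?thesis
    by (simp add: alg_tensor_def tstar_def lext_def case_prod_unfold)
qed

lemma alg_tensor_Comp:
  assumes ob: "x \<in> Ob A" "y \<in> Ob A" "z \<in> Ob A" "x' \<in> Ob B" "y' \<in> Ob B" "z' \<in> Ob B"
    and fg: "f \<in> FS y y' z z'" "g \<in> FS x x' y y'"
  shows "Comp (alg_tensor K A B) (x, x') (y, y') (z, z') (cls y y' z z' f) (cls x x' y y' g)
    = cls x x' z z' (tcomp x x' y y' z z' f g)"
proof -
  let ?f = "trep (cls y y' z z' f)" and ?g = "trep (cls x x' y y' g)"
  let ?c = "tcomp x x' y y' z z'"
  have f: "?f \<in> FS y y' z z'" "?f - f \<in> TR y y' z z'"
    using trep_tclass[OF K fg(1)] by simp_all
  have g: "?g \<in> FS x x' y y'" "?g - g \<in> TR x x' y y'"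
    using trep_tclass[OF K fg(2)] by simp_all
  \<comment> \<open>Independence of the representatives, changing one factor at a time:
    \<open>f'g' - fg = (f' - f) g' + f (g' - g)\<close>.\<close>
  have "?c (?f - f) ?g \<in> TR x x' z z'" "?c f (?g - g) \<in> TR x x' z z'"
    using ob fg f g tcomp_TR_left tcomp_TR_right by simp_all
  then have "?c (?f - f) ?g + ?c f (?g - g) \<in> TR x x' z z'"
    by (rule tensor_relations.add)
  moreover have "?c (?f - f) ?g = ?c ?f ?g - ?c f ?g"
    by (simp add: tcomp_def lext_minus)
  moreover have "?c f (?g - g) = ?c f ?g - ?c f g"
    by (simp add: tcomp_def lext_minus lext_diff_fun)
  ultimately have "?c ?f ?g - ?c f g \<in> TR x x' z z'" by simp
  then have "cls x x' z z' (?c ?f ?g) = cls x x' z z' (?c f g)"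
    using tclass_eq_iff[OF K tcomp_FS tcomp_FS] ob fg f g by simp
  moreover have "Comp (alg_tensor K A B) (x, x') (y, y') (z, z') (cls y y' z z' f) (cls x x' y y' g)
    = cls x x' z z' (?c ?f ?g)"
    by (simp add: alg_tensor_def tcomp_def lext_def case_prod_unfold pscale_sum)
  ultimately show ?thesis by simp
qed

lemma alg_tensor_Idn:
  "Idn (alg_tensor K A B) (x, x') = cls x x' x x' (Poly_Mapping.single (Idn A x, Idn B x') 1)"
  by (simp add: alg_tensor_def)

lemma alg_tensor_add:
  "\<lbrakk>f \<in> FS x x' y y'; g \<in> FS x x' y y'\<rbrakk> \<Longrightarrow>
    cls x x' y y' f \<oplus>\<^bsub>Hom (alg_tensor K A B) (x, x') (y, y')\<^esub> cls x x' y y' g = cls x x' y y' (f + g)"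
  by (simp add: alg_tensor_Hom tensor_space_simps K)

lemma alg_tensor_smult:
  "\<lbrakk>f \<in> FS x x' y y'; c \<in> K\<rbrakk> \<Longrightarrow>
    c \<odot>\<^bsub>Hom (alg_tensor K A B) (x, x') (y, y')\<^esub> cls x x' y y' f = cls x x' y y' (pscale c f)"
  by (simp add: alg_tensor_Hom tensor_space_simps K)

section \<open>Closure under the operations, and elementary tensors\<close>

lemma alg_tensor_closed:
  "\<lbrakk>f \<in> Arr (alg_tensor K A B) u v; g \<in> Arr (alg_tensor K A B) u v\<rbrakk>
     \<Longrightarrow> f \<oplus>\<^bsub>Hom (alg_tensor K A B) u v\<^esub> g \<in> Arr (alg_tensor K A B) u v"
  "\<lbrakk>f \<in> Arr (alg_tensor K A B) u v; c \<in> K\<rbrakk>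
     \<Longrightarrow> c \<odot>\<^bsub>Hom (alg_tensor K A B) u v\<^esub> f \<in> Arr (alg_tensor K A B) u v"
  "\<lbrakk>f \<in> Arr (alg_tensor K A B) u v; u \<in> Ob A \<times> Ob B; v \<in> Ob A \<times> Ob B\<rbrakk>
     \<Longrightarrow> Star (alg_tensor K A B) u v f \<in> Arr (alg_tensor K A B) v u"
  "\<lbrakk>f \<in> Arr (alg_tensor K A B) v w; g \<in> Arr (alg_tensor K A B) u v;
      u \<in> Ob A \<times> Ob B; v \<in> Ob A \<times> Ob B; w \<in> Ob A \<times> Ob B\<rbrakk>
     \<Longrightarrow> Comp (alg_tensor K A B) u v w f g \<in> Arr (alg_tensor K A B) u w"
  by (cases u; cases v; cases w;
      force simp: alg_tensor_Arr alg_tensor_add alg_tensor_smult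
        alg_tensor_Star alg_tensor_Comp FS_closed tstar_FS tcomp_FS)+

definition ten where "ten x x' y y' a b = cls x x' y y' (Poly_Mapping.single (a, b) 1)"

lemma ten_closed:
  "\<lbrakk>a \<in> Arr A x y; b \<in> Arr B x' y'\<rbrakk> \<Longrightarrow> ten x x' y y' a b \<in> Arr (alg_tensor K A B) (x, x') (y, y')"
  by (simp add: ten_def alg_tensor_Arr single_formal_sums K ground_field_simps)

lemma ten_Comp:
  assumes "x \<in> Ob A" "y \<in> Ob A" "z \<in> Ob A" "x' \<in> Ob B" "y' \<in> Ob B" "z' \<in> Ob B"
    and "a \<in> Arr A x y" "a' \<in> Arr B x' y'" "b \<in> Arr A y z" "b' \<in> Arr B y' z'"
  shows "Comp (alg_tensor K A B) (x, x') (y, y') (z, z') (ten y y' z z' b b') (ten x x' y y' a a')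
    = ten x x' z z' (Comp A x y z b a) (Comp B x' y' z' b' a')"
  using assms
  by (simp add: ten_def alg_tensor_Comp single_formal_sums K ground_field_simps tcomp_def lext_single)

lemma ten_Star:
  assumes "x \<in> Ob A" "y \<in> Ob A" "x' \<in> Ob B" "y' \<in> Ob B" "a \<in> Arr A x y" "a' \<in> Arr B x' y'"
  shows "Star (alg_tensor K A B) (x, x') (y, y') (ten x x' y y' a a')
    = ten y y' x x' (Star A x y a) (Star B x' y' a')"
  using assms
  by (simp add: ten_def alg_tensor_Star single_formal_sums K ground_field_simps tstar_def lext_single)

text \<open>Elementary tensors span: by \<open>lext_singles\<close> a formal sum is the linear
  combination of its pairs, and the formal sums whose class satisfies \<open>Q\<close> form a
  subspace.\<close>

lemma alg_tensor_induct:
  assumes ob: "x \<in> Ob A" "y \<in> Ob A" "x' \<in> Ob B" "y' \<in> Ob B"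
    and t: "t \<in> Arr (alg_tensor K A B) (x, x') (y, y')"
    and ten: "\<And>a b. \<lbrakk>a \<in> Arr A x y; b \<in> Arr B x' y'\<rbrakk> \<Longrightarrow> Q (ten x x' y y' a b)"
    and add: "\<And>s t. \<lbrakk>s \<in> Arr (alg_tensor K A B) (x, x') (y, y'); Q s;
        t \<in> Arr (alg_tensor K A B) (x, x') (y, y'); Q t\<rbrakk>
      \<Longrightarrow> Q (s \<oplus>\<^bsub>Hom (alg_tensor K A B) (x, x') (y, y')\<^esub> t)"
    and smult: "\<And>c s. \<lbrakk>c \<in> K; s \<in> Arr (alg_tensor K A B) (x, x') (y, y'); Q s\<rbrakk>
      \<Longrightarrow> Q (c \<odot>\<^bsub>Hom (alg_tensor K A B) (x, x') (y, y')\<^esub> s)"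
  shows "Q t"
proof -
  note kf = ground_field_simps[OF K]
  define S where "S = {f \<in> FS x x' y y'. Q (cls x x' y y' f)}"
  have single: "Poly_Mapping.single p 1 \<in> S" if "fst p \<in> Arr A x y" "snd p \<in> Arr B x' y'" for p
    using that ten[of "fst p" "snd p"]
    by (cases p) (simp add: S_def ten_def single_formal_sums K kf)
  have add': "f + g \<in> S" if "f \<in> S" "g \<in> S" for f g
    using that add[of "cls x x' y y' f" "cls x x' y y' g"]
    by (simp add: S_def alg_tensor_add alg_tensor_Arr FS_closed)
  have smult': "pscale c f \<in> S" if "f \<in> S" "c \<in> K" for c f
    using that smult[of c "cls x x' y y' f"]
    by (simp add: S_def alg_tensor_smult alg_tensor_Arr FS_closed)
  \<comment> \<open>The zero formal sum is obtained as \<open>0\<close> times an elementary tensor,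
    for which some arrow is needed on each side; Hom spaces are never empty.\<close>
  obtain a where "a \<in> Arr A x y"
    using abelian_groupE(2)[OF module.axioms(2)[OF A.Hom_module]] ob by blast
  moreover obtain b where "b \<in> Arr B x' y'"
    using abelian_groupE(2)[OF module.axioms(2)[OF B.Hom_module]] ob by blast
  ultimately have "0 \<in> S"
    using smult'[OF single, of "(a, b)" 0] kf by simp
  then have S: "psubspace K S"
    using add' smult' by (simp add: psubspace_def)
  obtain f where f: "f \<in> FS x x' y y'" "t = cls x x' y y' f"
    using t by (auto simp: alg_tensor_Arr)
  have "lext (\<lambda>z. z) (\<lambda>p. Poly_Mapping.single p 1) f \<in> S"
    using S by (rule lext_mem) (use FS_keys[OF f(1)] single in auto)
  then show ?thesis
    by (simp add: lext_singles f(2) S_def)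
qed

end

text \<open>On formal sums \<open>F \<otimes> F'\<close> is the extension \<open>\<phi>\<close> of
  the map on pairs. Linearity of \<open>F\<close> and \<open>F'\<close> makes \<open>\<phi>\<close>
  preserve the relations, so it descends to classes, and the functor laws can be verified on
  pairs.\<close>

lemma star_functor_alg_tensor:
  assumes "star_category_pair K A A'" "star_category_pair K B B'"
    and "star_functor K A B F" "star_functor K A' B' F'"
  shows "star_functor K (alg_tensor K A A') (alg_tensor K B B') (alg_tensor_fctr K B B' F F')"
    and "\<lbrakk>x \<in> Ob A; y \<in> Ob A; x' \<in> Ob A'; y' \<in> Ob A'; a \<in> Arr A x y; a' \<in> Arr A' x' y'\<rbrakk> \<Longrightarrow>
      farr (alg_tensor_fctr K B B' F F') (x, x') (y, y') (star_category_pair.ten K A A' x x' y y' a a')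
      = star_category_pair.ten K B B' (fob F x) (fob F' x') (fob F y) (fob F' y')
          (farr F x y a) (farr F' x' y' a')"
proof -
  interpret A: star_category_pair K A A' by fact
  interpret B: star_category_pair K B B' by fact
  interpret F: star_functor K A B F by fact
  interpret F': star_functor K A' B' F' by fact
  note K = A.K and kf = ground_field_simps[OF A.K]
  let ?T = "alg_tensor_fctr K B B' F F'"
  define \<phi> where "\<phi> x x' y y' f = lext (\<lambda>z. z)
    (\<lambda>p. Poly_Mapping.single (farr F x y (fst p), farr F' x' y' (snd p)) 1) f" for x x' y y' f
  have fob: "fob ?T (x, x') = (fob F x, fob F' x')" for x x'
    by (simp add: alg_tensor_fctr_def)
  have \<phi>FS: "\<phi> x x' y y' f \<in> B.FS (fob F x) (fob F' x') (fob F y) (fob F' y')"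
    if "x \<in> Ob A" "y \<in> Ob A" "x' \<in> Ob A'" "y' \<in> Ob A'" "f \<in> A.FS x x' y y'" for x x' y y' f
    unfolding \<phi>_def
    by (rule lext_mem[OF psubspace_formal_sums[OF K]])
      (use that A.FS_keys[OF that(5)] kf in
        \<open>simp_all add: single_formal_sums[OF K] F.farr_closed F'.farr_closed\<close>)
  have \<phi>TR: "\<phi> x x' y y' f \<in> B.TR (fob F x) (fob F' x') (fob F y) (fob F' y')"
    if "x \<in> Ob A" "y \<in> Ob A" "x' \<in> Ob A'" "y' \<in> Ob A'" "f \<in> A.TR x x' y y'" for x x' y y' f
    unfolding \<phi>_def
    by (rule lext_relations[OF K _ psubspace_relations _ _ _ _ that(5)])
      (use that kf in
        \<open>simp_all add: B.tensor_relations_intros F.farr_closed F'.farr_closed F.farr_add F'.farr_add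
           F.farr_smult F'.farr_smult\<close>)
  have farr: "farr ?T (x, x') (y, y') (A.cls x x' y y' f)
      = B.cls (fob F x) (fob F' x') (fob F y) (fob F' y') (\<phi> x x' y y' f)"
    if "x \<in> Ob A" "y \<in> Ob A" "x' \<in> Ob A'" "y' \<in> Ob A'" "f \<in> A.FS x x' y y'" for x x' y y' f
  proof -
    let ?f = "trep (A.cls x x' y y' f)"
    have f: "?f \<in> A.FS x x' y y'" "?f - f \<in> A.TR x x' y y'"
      using trep_tclass[OF K that(5)] by simp_all
    have "\<phi> x x' y y' (?f - f) \<in> B.TR (fob F x) (fob F' x') (fob F y) (fob F' y')"
      using \<phi>TR that f by blast
    then have "B.cls (fob F x) (fob F' x') (fob F y) (fob F' y') (\<phi> x x' y y' ?f)
        = B.cls (fob F x) (fob F' x') (fob F y) (fob F' y') (\<phi> x x' y y' f)"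
      using tclass_eq_iff[OF K \<phi>FS \<phi>FS] that f by (simp add: \<phi>_def lext_minus)
    then show ?thesis
      by (simp add: alg_tensor_fctr_def \<phi>_def lext_def case_prod_unfold)
  qed
  show "farr ?T (x, x') (y, y') (A.ten x x' y y' a a')
      = B.ten (fob F x) (fob F' x') (fob F y) (fob F' y') (farr F x y a) (farr F' x' y' a')"
    if "x \<in> Ob A" "y \<in> Ob A" "x' \<in> Ob A'" "y' \<in> Ob A'" "a \<in> Arr A x y" "a' \<in> Arr A' x' y'"
    using that
    by (simp add: A.ten_def B.ten_def farr single_formal_sums K kf \<phi>_def lext_single)
  have \<phi>add: "\<phi> x x' y y' (f + g) = \<phi> x x' y y' f + \<phi> x x' y y' g"
    "\<phi> x x' y y' (pscale c f) = pscale c (\<phi> x x' y y' f)" for x x' y y' f g c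
    by (simp_all add: \<phi>_def lext_add lext_pscale)
  \<comment> \<open>Already an equality of formal sums: by \<open>lext_lext\<close> both sides
    extend functions that agree on the pairs occurring in \<open>f\<close>. The same holds for
    \<open>\<phi>comp\<close>.\<close>
  have \<phi>star: "\<phi> y y' x x' (A.tstar x x' y y' f)
      = B.tstar (fob F x) (fob F' x') (fob F y) (fob F' y') (\<phi> x x' y y' f)"
    if "x \<in> Ob A" "y \<in> Ob A" "x' \<in> Ob A'" "y' \<in> Ob A'" "f \<in> A.FS x x' y y'" for x x' y y' f
    unfolding \<phi>_def A.tstar_def B.tstar_def
    by (simp add: lext_lext lext_single)
      (rule lext_cong, use that A.FS_keys[OF that(5)] in \<open>simp add: F.farr_Star F'.farr_Star\<close>)
  have \<phi>comp: "\<phi> x x' z z' (A.tcomp x x' y y' z z' f g)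
      = B.tcomp (fob F x) (fob F' x') (fob F y) (fob F' y') (fob F z) (fob F' z')
          (\<phi> y y' z z' f) (\<phi> x x' y y' g)"
    if "x \<in> Ob A" "y \<in> Ob A" "z \<in> Ob A" "x' \<in> Ob A'" "y' \<in> Ob A'" "z' \<in> Ob A'"
      "f \<in> A.FS y y' z z'" "g \<in> A.FS x x' y y'" for x x' y y' z z' f g
    unfolding \<phi>_def A.tcomp_def B.tcomp_def
    by (simp add: lext_lext lext_single)
      (intro lext_cong, use that A.FS_keys[OF that(7)] A.FS_keys[OF that(8)] in
        \<open>simp add: F.farr_Comp F'.farr_Comp\<close>)
  note simps = farr fob A.alg_tensor_Arr B.alg_tensor_Arr \<phi>FS
  show "star_functor K (alg_tensor K A A') (alg_tensor K B B') ?T"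
  proof
    fix x assume "x \<in> Ob (alg_tensor K A A')"
    then show "fob ?T x \<in> Ob (alg_tensor K B B')"
      by (auto simp: fob F.fob_closed F'.fob_closed)
  next
    fix u v a assume "u \<in> Ob (alg_tensor K A A')" "v \<in> Ob (alg_tensor K A A')"
      "a \<in> Arr (alg_tensor K A A') u v"
    then show "farr ?T u v a \<in> Arr (alg_tensor K B B') (fob ?T u) (fob ?T v)"
      by (auto simp: simps)
  next
    fix u assume "u \<in> Ob (alg_tensor K A A')"
    then show "farr ?T u u (Idn (alg_tensor K A A') u) = Idn (alg_tensor K B B') (fob ?T u)"
      by (auto simp: simps A.alg_tensor_Idn B.alg_tensor_Idn single_formal_sums K kf
          A.A.Idn_closed A.B.Idn_closed \<phi>_def lext_single F.farr_Idn F'.farr_Idn)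
  next
    fix u v w a b assume "u \<in> Ob (alg_tensor K A A')" "v \<in> Ob (alg_tensor K A A')"
      "w \<in> Ob (alg_tensor K A A')" "a \<in> Arr (alg_tensor K A A') u v"
      "b \<in> Arr (alg_tensor K A A') v w"
    then show "farr ?T u w (Comp (alg_tensor K A A') u v w b a)
      = Comp (alg_tensor K B B') (fob ?T u) (fob ?T v) (fob ?T w) (farr ?T v w b) (farr ?T u v a)"
      by (auto simp: simps A.alg_tensor_Comp B.alg_tensor_Comp A.tcomp_FS \<phi>comp
          F.fob_closed F'.fob_closed)
  next
    fix u v a b assume "u \<in> Ob (alg_tensor K A A')" "v \<in> Ob (alg_tensor K A A')"
      "a \<in> Arr (alg_tensor K A A') u v" "b \<in> Arr (alg_tensor K A A') u v"
    then show "farr ?T u v (a \<oplus>\<^bsub>Hom (alg_tensor K A A') u v\<^esub> b)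
      = farr ?T u v a \<oplus>\<^bsub>Hom (alg_tensor K B B') (fob ?T u) (fob ?T v)\<^esub> farr ?T u v b"
      by (auto simp: simps A.alg_tensor_add B.alg_tensor_add A.FS_closed \<phi>add)
  next
    fix u v a c assume "u \<in> Ob (alg_tensor K A A')" "v \<in> Ob (alg_tensor K A A')"
      "a \<in> Arr (alg_tensor K A A') u v" "c \<in> K"
    then show "farr ?T u v (c \<odot>\<^bsub>Hom (alg_tensor K A A') u v\<^esub> a)
      = c \<odot>\<^bsub>Hom (alg_tensor K B B') (fob ?T u) (fob ?T v)\<^esub> farr ?T u v a"
      by (auto simp: simps A.alg_tensor_smult B.alg_tensor_smult A.FS_closed \<phi>add)
  next
    fix u v a assume "u \<in> Ob (alg_tensor K A A')" "v \<in> Ob (alg_tensor K A A')"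
      "a \<in> Arr (alg_tensor K A A') u v"
    then show "farr ?T v u (Star (alg_tensor K A A') u v a)
      = Star (alg_tensor K B B') (fob ?T u) (fob ?T v) (farr ?T u v a)"
      by (auto simp: simps A.alg_tensor_Star B.alg_tensor_Star A.tstar_FS \<phi>star
          F.fob_closed F'.fob_closed)
  qed
qed


section \<open>Limits in Hom spaces\<close>

context star_category begin

lemma Hom_abelian: "\<lbrakk>x \<in> Ob A; y \<in> Ob A\<rbrakk> \<Longrightarrow> abelian_group (Hom A x y)"
  using Hom_module by (rule module.axioms(2))

lemma Hom_minus: "\<lbrakk>x \<in> Ob A; y \<in> Ob A; a \<in> Arr A x y; b \<in> Arr A x y\<rbrakk> \<Longrightarrow> a \<ominus>\<^bsub>Hom A x y\<^esub> b \<in> Arr A x y"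
  using abelian_group.minus_closed[OF Hom_abelian] by blast

lemma Hom_minus_eq_zero_iff:
  assumes "x \<in> Ob A" "y \<in> Ob A" "a \<in> Arr A x y" "b \<in> Arr A x y"
  shows "a \<ominus>\<^bsub>Hom A x y\<^esub> b = \<zero>\<^bsub>Hom A x y\<^esub> \<longleftrightarrow> a = b"
proof -
  interpret M: abelian_group "Hom A x y" using Hom_abelian assms by blast
  show ?thesis
    using assms M.minus_equality[of a "\<ominus>\<^bsub>Hom A x y\<^esub> b"] by (auto simp: a_minus_def M.r_neg)
qed

lemma Hom_smult: "\<lbrakk>x \<in> Ob A; y \<in> Ob A; c \<in> K; a \<in> Arr A x y\<rbrakk> \<Longrightarrow> c \<odot>\<^bsub>Hom A x y\<^esub> a \<in> Arr A x y"
  using module.smult_closed[OF Hom_module] by fastforce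

text \<open>Expresses subtraction through addition and scalars, the operations that composition,
  involution and functors are assumed to respect.\<close>

lemma Hom_minus_eq:
  assumes K: "ground_field K" and x: "x \<in> Ob A" "y \<in> Ob A" "a \<in> Arr A x y" "b \<in> Arr A x y"
  shows "a \<ominus>\<^bsub>Hom A x y\<^esub> b = a \<oplus>\<^bsub>Hom A x y\<^esub> (- 1) \<odot>\<^bsub>Hom A x y\<^esub> b"
proof -
  interpret M: module "scalars K" "Hom A x y" using Hom_module x by blast
  note kf = ground_field_simps[OF K]
  have "(- 1) \<odot>\<^bsub>Hom A x y\<^esub> b \<oplus>\<^bsub>Hom A x y\<^esub> b
      = (- 1) \<odot>\<^bsub>Hom A x y\<^esub> b \<oplus>\<^bsub>Hom A x y\<^esub> 1 \<odot>\<^bsub>Hom A x y\<^esub> b"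
    using M.smult_one x by simp
  also have "\<dots> = (- 1 + 1) \<odot>\<^bsub>Hom A x y\<^esub> b"
    using M.smult_l_distr[of "- 1" 1 b] kf x by simp
  also have "\<dots> = \<zero>\<^bsub>Hom A x y\<^esub>"
    using M.smult_l_null x by simp
  finally have "\<ominus>\<^bsub>Hom A x y\<^esub> b = (- 1) \<odot>\<^bsub>Hom A x y\<^esub> b"
    using x kf by (intro M.minus_equality) (simp_all add: Hom_smult)
  then show ?thesis by (simp add: a_minus_def)
qed

end

context cstar_category begin

text \<open>Convergence in the form used by \<open>completion_extension\<close>, with membership in
  the Hom space included.\<close>

definition tends :: "'o \<Rightarrow> 'o \<Rightarrow> (nat \<Rightarrow> 'm) \<Rightarrow> 'm \<Rightarrow> bool" where
  "tends x y f a \<longleftrightarrow> (\<forall>n. f n \<in> Arr A x y) \<and> a \<in> Arr A x y \<and>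
     (\<lambda>n. Nrm A x y (f n \<ominus>\<^bsub>Hom A x y\<^esub> a)) \<longlonglongrightarrow> 0"

lemma tendsD:
  assumes "tends x y f a"
  shows "f n \<in> Arr A x y" "a \<in> Arr A x y" "(\<lambda>n. Nrm A x y (f n \<ominus>\<^bsub>Hom A x y\<^esub> a)) \<longlonglongrightarrow> 0"
  using assms by (simp_all add: tends_def)

lemma Nrm_minus_triangle:
  assumes x: "x \<in> Ob A" "y \<in> Ob A" and a: "a \<in> Arr A x y" "b \<in> Arr A x y" "c \<in> Arr A x y"
  shows "Nrm A x y (a \<ominus>\<^bsub>Hom A x y\<^esub> c)
    \<le> Nrm A x y (a \<ominus>\<^bsub>Hom A x y\<^esub> b) + Nrm A x y (b \<ominus>\<^bsub>Hom A x y\<^esub> c)"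
proof -
  interpret M: abelian_group "Hom A x y" using Hom_abelian x by blast
  have "a \<ominus>\<^bsub>Hom A x y\<^esub> c = (a \<ominus>\<^bsub>Hom A x y\<^esub> b) \<oplus>\<^bsub>Hom A x y\<^esub> (b \<ominus>\<^bsub>Hom A x y\<^esub> c)"
    using a by (simp add: a_minus_def M.a_assoc M.r_neg1)
  then show ?thesis
    using Nrm_triangle[OF x] a Hom_minus x by simp
qed

text \<open>The C*-identity and submultiplicativity give
  \<open>|a|^2 = |a* a| \<le> |a*| |a|\<close>, so \<open>|a| \<le> |a*|\<close>; applied to
  \<open>a*\<close> this gives the converse.\<close>

lemma Nrm_Star:
  assumes x: "x \<in> Ob A" "y \<in> Ob A" and a: "a \<in> Arr A x y"
  shows "Nrm A y x (Star A x y a) = Nrm A x y a"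
proof -
  have le: "Nrm A x y a \<le> Nrm A y x (Star A x y a)"
    if x: "x \<in> Ob A" "y \<in> Ob A" and a: "a \<in> Arr A x y" for x y a
  proof (cases "Nrm A x y a = 0")
    case True
    then show ?thesis using Nrm_nonneg Star_closed that by simp
  next
    case False
    have "Nrm A x y a * Nrm A x y a \<le> Nrm A y x (Star A x y a) * Nrm A x y a"
      using Nrm_cstar[OF that] Nrm_Comp[OF x(1,2,1) a Star_closed[OF that]]
      by (simp add: power2_eq_square)
    then show ?thesis
      using False Nrm_nonneg[OF that] by simp
  qed
  show ?thesis
    using le[OF x a] le[OF x(2,1) Star_closed[OF x a]] Star_Star[OF x a] by simp
qed

end

locale cstar_category_over = cstar_category K A for K and A :: "('o, 'm) cstar_cat" +
  assumes K: "ground_field K"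
begin

lemma minus_eq: "\<lbrakk>x \<in> Ob A; y \<in> Ob A; a \<in> Arr A x y; b \<in> Arr A x y\<rbrakk>
    \<Longrightarrow> a \<ominus>\<^bsub>Hom A x y\<^esub> b = a \<oplus>\<^bsub>Hom A x y\<^esub> (- 1) \<odot>\<^bsub>Hom A x y\<^esub> b"
  using Hom_minus_eq K by blast

lemma Nrm_minus_commute:
  assumes x: "x \<in> Ob A" "y \<in> Ob A" and a: "a \<in> Arr A x y" "b \<in> Arr A x y"
  shows "Nrm A x y (a \<ominus>\<^bsub>Hom A x y\<^esub> b) = Nrm A x y (b \<ominus>\<^bsub>Hom A x y\<^esub> a)"
proof -
  interpret M: module "scalars K" "Hom A x y" using Hom_module x by blast
  note kf = ground_field_simps[OF K]
  have "b \<ominus>\<^bsub>Hom A x y\<^esub> a = (- 1) \<odot>\<^bsub>Hom A x y\<^esub> (a \<ominus>\<^bsub>Hom A x y\<^esub> b)"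
    using a x kf M.smult_assoc1[of "- 1" "- 1" b] M.smult_one[of b]
    by (simp add: minus_eq M.smult_r_distr Hom_smult M.a_comm)
  then show ?thesis
    using Nrm_smult[OF x Hom_minus[OF x a], of "- 1"] kf by simp
qed

lemma hom_dist_complete:
  assumes x: "x \<in> Ob A" "y \<in> Ob A" and f: "\<And>n. f n \<in> Arr A x y"
    and cau: "\<And>e. e > 0 \<Longrightarrow> \<exists>N. \<forall>m \<ge> N. \<forall>n \<ge> N. Nrm A x y (f m \<ominus>\<^bsub>Hom A x y\<^esub> f n) < e"
  obtains a where "tends x y f a"
proof -
  interpret M: abelian_group "Hom A x y" using Hom_abelian x by blast
  interpret D: Metric_space "Arr A x y" "hom_dist A x y"
  proof
    fix a b
    show "0 \<le> hom_dist A x y a b"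
      using Nrm_nonneg[OF x Hom_minus[OF x]] by (simp add: hom_dist_def)
    show "hom_dist A x y a b = hom_dist A x y b a"
      using Nrm_minus_commute[OF x] by (simp add: hom_dist_def)
    show "hom_dist A x y a b = 0 \<longleftrightarrow> a = b" if "a \<in> Arr A x y" "b \<in> Arr A x y"
      using that Nrm_eq_0_iff[OF x Hom_minus[OF x that]] Hom_minus_eq_zero_iff[OF x that] by (simp add: hom_dist_def)
    show "hom_dist A x y a c \<le> hom_dist A x y a b + hom_dist A x y b c"
      if "a \<in> Arr A x y" "b \<in> Arr A x y" "c \<in> Arr A x y" for c
      using that Nrm_minus_triangle[OF x] by (simp add: hom_dist_def)
  qed
  have "D.MCauchy f"
    unfolding D.MCauchy_def using f cau by (auto simp: hom_dist_def)
  then obtain a where "limitin D.mtopology f a sequentially"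
    using Hom_complete[OF x] D.mcomplete_def by blast
  then have a: "a \<in> Arr A x y" "\<And>e. e > 0 \<Longrightarrow> \<exists>N. \<forall>n\<ge>N. hom_dist A x y (f n) a < e"
    by (simp_all add: D.limit_metric_sequentially) blast
  then have "(\<lambda>n. Nrm A x y (f n \<ominus>\<^bsub>Hom A x y\<^esub> a)) \<longlonglongrightarrow> 0"
    using Nrm_nonneg[OF x Hom_minus[OF x]] f
    by (simp add: LIMSEQ_iff hom_dist_def)
  then show thesis
    using that a f by (simp add: tends_def)
qed

lemma tendsI:
  assumes x: "x \<in> Ob A" "y \<in> Ob A" and "\<And>n. f n \<in> Arr A x y" "a \<in> Arr A x y"
    and le: "\<And>n. Nrm A x y (f n \<ominus>\<^bsub>Hom A x y\<^esub> a) \<le> g n" and g: "g \<longlonglongrightarrow> 0"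
  shows "tends x y f a"
  unfolding tends_def
  using assms(3,4) tendsto_sandwich[OF _ _ tendsto_const g, of "\<lambda>n. Nrm A x y (f n \<ominus>\<^bsub>Hom A x y\<^esub> a)"]
    le Nrm_nonneg[OF x Hom_minus[OF x]] by simp

lemma tends_const: "\<lbrakk>x \<in> Ob A; y \<in> Ob A; a \<in> Arr A x y\<rbrakk> \<Longrightarrow> tends x y (\<lambda>_. a) a"
  using Hom_minus_eq_zero_iff[of x y a a] Nrm_eq_0_iff[OF _ _ Hom_minus, of x y a a]
  by (simp add: tends_def)

lemma tends_unique:
  assumes x: "x \<in> Ob A" "y \<in> Ob A" and ab: "tends x y f a" "tends x y f b"
  shows "a = b"
proof -
  note D = tendsD[OF ab(1)] tendsD[OF ab(2)]
  have "(\<lambda>n. Nrm A x y (f n \<ominus>\<^bsub>Hom A x y\<^esub> a) + Nrm A x y (f n \<ominus>\<^bsub>Hom A x y\<^esub> b)) \<longlonglongrightarrow> 0 + 0"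
    using D by (intro tendsto_add) simp_all
  moreover have "Nrm A x y (a \<ominus>\<^bsub>Hom A x y\<^esub> b)
      \<le> Nrm A x y (f n \<ominus>\<^bsub>Hom A x y\<^esub> a) + Nrm A x y (f n \<ominus>\<^bsub>Hom A x y\<^esub> b)" for n
    using Nrm_minus_triangle[OF x, of a "f n" b] Nrm_minus_commute[OF x, of a "f n"] D by simp
  ultimately have "Nrm A x y (a \<ominus>\<^bsub>Hom A x y\<^esub> b) \<le> 0"
    by (intro LIMSEQ_le_const) auto
  then have "a \<ominus>\<^bsub>Hom A x y\<^esub> b = \<zero>\<^bsub>Hom A x y\<^esub>"
    using Nrm_eq_0_iff[OF x Hom_minus[OF x, of a b]] Nrm_nonneg[OF x Hom_minus[OF x, of a b]] D
    by simp
  then show ?thesis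
    using Hom_minus_eq_zero_iff[OF x] D by simp
qed

lemma tends_add:
  assumes x: "x \<in> Ob A" "y \<in> Ob A" and ab: "tends x y f a" "tends x y g b"
  shows "tends x y (\<lambda>n. f n \<oplus>\<^bsub>Hom A x y\<^esub> g n) (a \<oplus>\<^bsub>Hom A x y\<^esub> b)"
proof (rule tendsI[OF x])
  note D = tendsD[OF ab(1)] tendsD[OF ab(2)]
  interpret M: module "scalars K" "Hom A x y" using Hom_module x by blast
  note kf = ground_field_simps[OF K]
  show "f n \<oplus>\<^bsub>Hom A x y\<^esub> g n \<in> Arr A x y" "a \<oplus>\<^bsub>Hom A x y\<^esub> b \<in> Arr A x y" for n
    using D by simp_all
  show "Nrm A x y (f n \<oplus>\<^bsub>Hom A x y\<^esub> g n \<ominus>\<^bsub>Hom A x y\<^esub> (a \<oplus>\<^bsub>Hom A x y\<^esub> b))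
    \<le> Nrm A x y (f n \<ominus>\<^bsub>Hom A x y\<^esub> a) + Nrm A x y (g n \<ominus>\<^bsub>Hom A x y\<^esub> b)" for n
  proof -
    have "f n \<oplus>\<^bsub>Hom A x y\<^esub> g n \<ominus>\<^bsub>Hom A x y\<^esub> (a \<oplus>\<^bsub>Hom A x y\<^esub> b)
      = (f n \<ominus>\<^bsub>Hom A x y\<^esub> a) \<oplus>\<^bsub>Hom A x y\<^esub> (g n \<ominus>\<^bsub>Hom A x y\<^esub> b)"
      using D kf x by (simp add: minus_eq M.smult_r_distr Hom_smult M.a_ac)
    then show ?thesis
      using Nrm_triangle[OF x Hom_minus[OF x] Hom_minus[OF x]] D by simp
  qed
  show "(\<lambda>n. Nrm A x y (f n \<ominus>\<^bsub>Hom A x y\<^esub> a) + Nrm A x y (g n \<ominus>\<^bsub>Hom A x y\<^esub> b)) \<longlonglongrightarrow> 0"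
    using tendsto_add[OF D(3,6)] by simp
qed

lemma tends_smult:
  assumes x: "x \<in> Ob A" "y \<in> Ob A" and c: "c \<in> K" and ab: "tends x y f a"
  shows "tends x y (\<lambda>n. c \<odot>\<^bsub>Hom A x y\<^esub> f n) (c \<odot>\<^bsub>Hom A x y\<^esub> a)"
proof (rule tendsI[OF x])
  note D = tendsD[OF ab(1)]
  interpret M: module "scalars K" "Hom A x y" using Hom_module x by blast
  note kf = ground_field_simps[OF K]
  show "c \<odot>\<^bsub>Hom A x y\<^esub> f n \<in> Arr A x y" "c \<odot>\<^bsub>Hom A x y\<^esub> a \<in> Arr A x y" for n
    using D c by simp_all
  show "Nrm A x y (c \<odot>\<^bsub>Hom A x y\<^esub> f n \<ominus>\<^bsub>Hom A x y\<^esub> (c \<odot>\<^bsub>Hom A x y\<^esub> a))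
    \<le> cmod c * Nrm A x y (f n \<ominus>\<^bsub>Hom A x y\<^esub> a)" for n
  proof -
    have "c \<odot>\<^bsub>Hom A x y\<^esub> f n \<ominus>\<^bsub>Hom A x y\<^esub> (c \<odot>\<^bsub>Hom A x y\<^esub> a)
      = c \<odot>\<^bsub>Hom A x y\<^esub> (f n \<ominus>\<^bsub>Hom A x y\<^esub> a)"
      using D kf x c M.smult_assoc1[of "- 1" c a] M.smult_assoc1[of c "- 1" a]
      by (simp add: minus_eq M.smult_r_distr Hom_smult)
    then show ?thesis
      using Nrm_smult[OF x Hom_minus[OF x] c] D by simp
  qed
  show "(\<lambda>n. cmod c * Nrm A x y (f n \<ominus>\<^bsub>Hom A x y\<^esub> a)) \<longlonglongrightarrow> 0"
    using tendsto_mult_right_zero[OF D(3)] by simp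
qed

lemma tends_Star:
  assumes x: "x \<in> Ob A" "y \<in> Ob A" and ab: "tends x y f a"
  shows "tends y x (\<lambda>n. Star A x y (f n)) (Star A x y a)"
proof (rule tendsI[OF x(2,1) _ _ _ tendsD(3)[OF ab]])
  note D = tendsD[OF ab(1)]
  note kf = ground_field_simps[OF K]
  show "Star A x y (f n) \<in> Arr A y x" "Star A x y a \<in> Arr A y x" for n
    using D x Star_closed by simp_all
  show "Nrm A y x (Star A x y (f n) \<ominus>\<^bsub>Hom A y x\<^esub> Star A x y a)
    \<le> Nrm A x y (f n \<ominus>\<^bsub>Hom A x y\<^esub> a)" for n
  proof -
    have "Star A x y (f n) \<ominus>\<^bsub>Hom A y x\<^esub> Star A x y a = Star A x y (f n \<ominus>\<^bsub>Hom A x y\<^esub> a)"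
      using D kf x Star_smult[OF x D(2), of "- 1"]
      by (simp add: minus_eq Star_add Hom_smult Star_closed)
    then show ?thesis
      using Nrm_Star[OF x Hom_minus[OF x]] D by simp
  qed
qed

lemma tends_Nrm_le:
  assumes x: "x \<in> Ob A" "y \<in> Ob A" and ab: "tends x y f a"
  shows "Nrm A x y (f n) \<le> Nrm A x y (f n \<ominus>\<^bsub>Hom A x y\<^esub> a) + Nrm A x y a"
    and "Nrm A x y a \<le> Nrm A x y (f n \<ominus>\<^bsub>Hom A x y\<^esub> a) + Nrm A x y (f n)"
proof -
  note D = tendsD[OF ab]
  interpret M: abelian_group "Hom A x y" using Hom_abelian x by blast
  have z: "b \<ominus>\<^bsub>Hom A x y\<^esub> \<zero>\<^bsub>Hom A x y\<^esub> = b" if "b \<in> Arr A x y" for b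
    using that by (simp add: a_minus_def)
  show "Nrm A x y (f n) \<le> Nrm A x y (f n \<ominus>\<^bsub>Hom A x y\<^esub> a) + Nrm A x y a"
    using Nrm_minus_triangle[OF x, of "f n" a "\<zero>\<^bsub>Hom A x y\<^esub>"] D by (simp add: z)
  show "Nrm A x y a \<le> Nrm A x y (f n \<ominus>\<^bsub>Hom A x y\<^esub> a) + Nrm A x y (f n)"
    using Nrm_minus_triangle[OF x, of a "f n" "\<zero>\<^bsub>Hom A x y\<^esub>"] D
      Nrm_minus_commute[OF x, of a "f n"] by (simp add: z)
qed

text \<open>From \<open>g f' - b a = (g - b) f' + b (f' - a)\<close>, with \<open>f'\<close> and
  \<open>g\<close> the terms of the sequences and \<open>|f'| \<le> |f' - a| + |a|\<close> as a
  bound on the first summand.\<close>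

lemma tends_Comp:
  assumes x: "x \<in> Ob A" "y \<in> Ob A" "z \<in> Ob A" and ab: "tends x y f a" "tends y z g b"
  shows "tends x z (\<lambda>n. Comp A x y z (g n) (f n)) (Comp A x y z b a)"
proof (rule tendsI[OF x(1,3)])
  note D = tendsD[OF ab(1)] tendsD[OF ab(2)]
  note kf = ground_field_simps[OF K]
  let ?g = "\<lambda>n. Nrm A y z (g n \<ominus>\<^bsub>Hom A y z\<^esub> b)" and ?f = "\<lambda>n. Nrm A x y (f n \<ominus>\<^bsub>Hom A x y\<^esub> a)"
  show cl: "Comp A x y z (g n) (f n) \<in> Arr A x z" "Comp A x y z b a \<in> Arr A x z" for n
    using D x Comp_closed by simp_all
  show "Nrm A x z (Comp A x y z (g n) (f n) \<ominus>\<^bsub>Hom A x z\<^esub> Comp A x y z b a)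
    \<le> ?g n * (?f n + Nrm A x y a) + Nrm A y z b * ?f n" for n
  proof -
    have bf: "Comp A x y z b (f n) \<in> Arr A x z" using D x Comp_closed by simp
    have "Comp A x y z (g n) (f n) \<ominus>\<^bsub>Hom A x z\<^esub> Comp A x y z b (f n)
      = Comp A x y z (g n \<ominus>\<^bsub>Hom A y z\<^esub> b) (f n)"
      using D kf x by (simp add: minus_eq Comp_add_left Comp_smult_left Hom_smult Comp_closed)
    moreover have "Comp A x y z b (f n) \<ominus>\<^bsub>Hom A x z\<^esub> Comp A x y z b a
      = Comp A x y z b (f n \<ominus>\<^bsub>Hom A x y\<^esub> a)"
      using D kf x by (simp add: minus_eq Comp_add_right Comp_smult_right Hom_smult Comp_closed)
    ultimately have "Nrm A x z (Comp A x y z (g n) (f n) \<ominus>\<^bsub>Hom A x z\<^esub> Comp A x y z b a)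
      \<le> Nrm A x z (Comp A x y z (g n \<ominus>\<^bsub>Hom A y z\<^esub> b) (f n))
        + Nrm A x z (Comp A x y z b (f n \<ominus>\<^bsub>Hom A x y\<^esub> a))"
      using Nrm_minus_triangle[OF x(1,3) cl(1)[of n] bf cl(2)] by simp
    moreover have "Nrm A x z (Comp A x y z (g n \<ominus>\<^bsub>Hom A y z\<^esub> b) (f n)) \<le> ?g n * Nrm A x y (f n)"
      using Nrm_Comp[OF x] D Hom_minus x by simp
    moreover have "?g n * Nrm A x y (f n) \<le> ?g n * (?f n + Nrm A x y a)"
      using tends_Nrm_le(1)[OF x(1,2) ab(1)] Nrm_nonneg[OF x(2,3) Hom_minus[OF x(2,3)]] D
      by (intro mult_left_mono) simp_all
    moreover have "Nrm A x z (Comp A x y z b (f n \<ominus>\<^bsub>Hom A x y\<^esub> a)) \<le> Nrm A y z b * ?f n"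
      using Nrm_Comp[OF x] D Hom_minus x by simp
    ultimately show ?thesis by linarith
  qed
  have "(\<lambda>n. ?g n * (?f n + Nrm A x y a) + Nrm A y z b * ?f n)
      \<longlonglongrightarrow> 0 * (0 + Nrm A x y a) + Nrm A y z b * 0"
    by (intro tendsto_intros D(3,6))
  then show "(\<lambda>n. ?g n * (?f n + Nrm A x y a) + Nrm A y z b * ?f n) \<longlonglongrightarrow> 0" by simp
qed

end


section \<open>Extension of functors to a completion\<close>

text \<open>The domain is described by closure under its operations; the equations are transported
  from \<open>T\<close> and \<open>C\<close> through \<open>i\<close> and \<open>\<rho>\<close>. The
  assumption \<open>bounded\<close> is the source of continuity.\<close>

locale star_completion =
  T: cstar_category_over K T + C: cstar_category_over K C +
  i: star_functor K D T i + \<rho>: star_functor K D C \<rho>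
  for K and D :: "('d, 'k, 'z) star_cat_scheme" and T :: "('o, 'm) cstar_cat" and i
    and C :: "('p, 'n) cstar_cat" and \<rho> +
  assumes D_add: "\<And>u v f g. \<lbrakk>f \<in> Arr D u v; g \<in> Arr D u v\<rbrakk> \<Longrightarrow> f \<oplus>\<^bsub>Hom D u v\<^esub> g \<in> Arr D u v"
    and D_smult: "\<And>u v f c. \<lbrakk>f \<in> Arr D u v; c \<in> K\<rbrakk> \<Longrightarrow> c \<odot>\<^bsub>Hom D u v\<^esub> f \<in> Arr D u v"
    and D_Star: "\<And>u v f. \<lbrakk>f \<in> Arr D u v; u \<in> Ob D; v \<in> Ob D\<rbrakk> \<Longrightarrow> Star D u v f \<in> Arr D v u"
    and D_Comp: "\<And>u v w f g. \<lbrakk>f \<in> Arr D v w; g \<in> Arr D u v; u \<in> Ob D; v \<in> Ob D; w \<in> Ob D\<rbrakk>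
      \<Longrightarrow> Comp D u v w f g \<in> Arr D u w"
    and D_Idn: "\<And>u. u \<in> Ob D \<Longrightarrow> Idn D u \<in> Arr D u u"
    and bij: "bij_betw (fob i) (Ob D) (Ob T)"
    and dense: "\<And>u v t e. \<lbrakk>u \<in> Ob D; v \<in> Ob D; t \<in> Arr T (fob i u) (fob i v); e > 0\<rbrakk> \<Longrightarrow>
      \<exists>f \<in> Arr D u v. Nrm T (fob i u) (fob i v) (farr i u v f \<ominus>\<^bsub>Hom T (fob i u) (fob i v)\<^esub> t) < e"
    and bounded: "\<And>u v f. \<lbrakk>u \<in> Ob D; v \<in> Ob D; f \<in> Arr D u v\<rbrakk> \<Longrightarrow>
      Nrm C (fob \<rho> u) (fob \<rho> v) (farr \<rho> u v f) \<le> Nrm T (fob i u) (fob i v) (farr i u v f)"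
begin

abbreviation ext where "ext \<equiv> completion_extension D T i C \<rho>"

lemma fob_ext: "u \<in> Ob D \<Longrightarrow> fob ext (fob i u) = fob \<rho> u"
  using bij by (simp add: completion_extension_def Let_def bij_betw_def)

lemma Ob_cases:
  assumes "x \<in> Ob T"
  obtains u where "u \<in> Ob D" "x = fob i u"
  using assms bij by (auto simp: bij_betw_def)

definition approx where
  "approx u v f t \<longleftrightarrow> (\<forall>n. f n \<in> Arr D u v) \<and> T.tends (fob i u) (fob i v) (\<lambda>n. farr i u v (f n)) t"

lemma approx_exists:
  assumes u: "u \<in> Ob D" "v \<in> Ob D" and t: "t \<in> Arr T (fob i u) (fob i v)"
  obtains f where "approx u v f t"
proof -
  let ?N = "\<lambda>f. Nrm T (fob i u) (fob i v) (farr i u v f \<ominus>\<^bsub>Hom T (fob i u) (fob i v)\<^esub> t)"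
  have "\<forall>n. \<exists>f. f \<in> Arr D u v \<and> ?N f < inverse (real (Suc n))"
    using dense[OF u t] by (metis inverse_positive_iff_positive of_nat_0_less_iff zero_less_Suc)
  then obtain f where f: "\<And>n. f n \<in> Arr D u v" "\<And>n. ?N (f n) < inverse (real (Suc n))"
    by metis
  have "T.tends (fob i u) (fob i v) (\<lambda>n. farr i u v (f n)) t"
    by (rule T.tendsI[OF _ _ _ _ _ LIMSEQ_inverse_real_of_nat])
      (use f t u less_imp_le in \<open>auto simp: i.fob_closed i.farr_closed\<close>)
  then show thesis using that[of f] f(1) by (simp add: approx_def)
qed

lemma bounded_minus:
  assumes u: "u \<in> Ob D" "v \<in> Ob D" and f: "f \<in> Arr D u v" "g \<in> Arr D u v"
  shows "Nrm C (fob \<rho> u) (fob \<rho> v) (farr \<rho> u v f \<ominus>\<^bsub>Hom C (fob \<rho> u) (fob \<rho> v)\<^esub> farr \<rho> u v g)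
    \<le> Nrm T (fob i u) (fob i v) (farr i u v f \<ominus>\<^bsub>Hom T (fob i u) (fob i v)\<^esub> farr i u v g)"
proof -
  let ?h = "f \<oplus>\<^bsub>Hom D u v\<^esub> (- 1) \<odot>\<^bsub>Hom D u v\<^esub> g"
  have m: "- 1 \<in> K" using ground_field_simps(3)[OF T.K] .
  have "farr i u v ?h = farr i u v f \<ominus>\<^bsub>Hom T (fob i u) (fob i v)\<^esub> farr i u v g"
    using u f D_smult[OF f(2) m]
    by (simp add: i.farr_add i.farr_smult m T.minus_eq i.farr_closed i.fob_closed)
  moreover have "farr \<rho> u v ?h = farr \<rho> u v f \<ominus>\<^bsub>Hom C (fob \<rho> u) (fob \<rho> v)\<^esub> farr \<rho> u v g"
    using u f D_smult[OF f(2) m]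
    by (simp add: \<rho>.farr_add \<rho>.farr_smult m C.minus_eq \<rho>.farr_closed \<rho>.fob_closed)
  ultimately show ?thesis
    using bounded[OF u D_add[OF f(1) D_smult[OF f(2) m]]] by simp
qed

text \<open>Independence of the approximating sequence: \<open>bounded_minus\<close> controls the
  distance of the two image sequences in \<open>C\<close> by their distance in \<open>T\<close>,
  which tends to zero because both tend to \<open>t\<close>.\<close>

lemma approx_difference:
  assumes u: "u \<in> Ob D" "v \<in> Ob D" and f: "approx u v f t" and g: "approx u v g t"
    and s: "C.tends (fob \<rho> u) (fob \<rho> v) (\<lambda>n. farr \<rho> u v (g n)) s"
  shows "C.tends (fob \<rho> u) (fob \<rho> v) (\<lambda>n. farr \<rho> u v (f n)) s"
proof -
  let ?T = "\<lambda>a b. Nrm T (fob i u) (fob i v) (a \<ominus>\<^bsub>Hom T (fob i u) (fob i v)\<^esub> b)"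
  let ?C = "\<lambda>a b. Nrm C (fob \<rho> u) (fob \<rho> v) (a \<ominus>\<^bsub>Hom C (fob \<rho> u) (fob \<rho> v)\<^esub> b)"
  have iu: "fob i u \<in> Ob T" "fob i v \<in> Ob T" "fob \<rho> u \<in> Ob C" "fob \<rho> v \<in> Ob C"
    using u i.fob_closed \<rho>.fob_closed by simp_all
  have fg: "f n \<in> Arr D u v" "g n \<in> Arr D u v" for n
    using f g by (simp_all add: approx_def)
  have tf: "T.tends (fob i u) (fob i v) (\<lambda>n. farr i u v (f n)) t"
    and tg: "T.tends (fob i u) (fob i v) (\<lambda>n. farr i u v (g n)) t"
    using f g by (simp_all add: approx_def)
  note D = T.tendsD[OF tf] T.tendsD[OF tg] C.tendsD[OF s]
  have *: "?C (farr \<rho> u v (f n)) s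
      \<le> ?T (farr i u v (f n)) t + ?T (farr i u v (g n)) t + ?C (farr \<rho> u v (g n)) s" for n
  proof -
    have "?C (farr \<rho> u v (f n)) s
        \<le> ?C (farr \<rho> u v (f n)) (farr \<rho> u v (g n)) + ?C (farr \<rho> u v (g n)) s"
      using C.Nrm_minus_triangle iu fg u D \<rho>.farr_closed by simp
    moreover have "?C (farr \<rho> u v (f n)) (farr \<rho> u v (g n)) \<le> ?T (farr i u v (f n)) (farr i u v (g n))"
      using bounded_minus u fg by simp
    moreover have "?T (farr i u v (f n)) (farr i u v (g n)) \<le> ?T (farr i u v (f n)) t + ?T t (farr i u v (g n))"
      using T.Nrm_minus_triangle iu fg u D i.farr_closed by simp
    moreover have "?T t (farr i u v (g n)) = ?T (farr i u v (g n)) t"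
      using T.Nrm_minus_commute iu fg u D i.farr_closed by simp
    ultimately show ?thesis by linarith
  qed
  have "(\<lambda>n. ?T (farr i u v (f n)) t + ?T (farr i u v (g n)) t + ?C (farr \<rho> u v (g n)) s) \<longlonglongrightarrow> 0 + 0 + 0"
    using D by (intro tendsto_add) simp_all
  then show ?thesis
    using C.tendsI[OF iu(3,4) _ _ *] D fg u \<rho>.farr_closed by simp
qed

text \<open>A sequence convergent in \<open>T\<close> is Cauchy there, \<open>bounded_minus\<close>
  carries this over to \<open>C\<close>, and the Hom spaces of \<open>C\<close> are
  complete.\<close>

lemma approx_converges:
  assumes u: "u \<in> Ob D" "v \<in> Ob D" and f: "approx u v f t"
  obtains s where "C.tends (fob \<rho> u) (fob \<rho> v) (\<lambda>n. farr \<rho> u v (f n)) s"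
proof -
  let ?T = "\<lambda>a b. Nrm T (fob i u) (fob i v) (a \<ominus>\<^bsub>Hom T (fob i u) (fob i v)\<^esub> b)"
  let ?C = "\<lambda>a b. Nrm C (fob \<rho> u) (fob \<rho> v) (a \<ominus>\<^bsub>Hom C (fob \<rho> u) (fob \<rho> v)\<^esub> b)"
  have iu: "fob i u \<in> Ob T" "fob i v \<in> Ob T" "fob \<rho> u \<in> Ob C" "fob \<rho> v \<in> Ob C"
    using u i.fob_closed \<rho>.fob_closed by simp_all
  have fD: "f n \<in> Arr D u v" for n using f by (simp add: approx_def)
  have tf: "T.tends (fob i u) (fob i v) (\<lambda>n. farr i u v (f n)) t"
    using f by (simp add: approx_def)
  note D = T.tendsD[OF tf]
  show thesis
  proof (rule C.hom_dist_complete[OF iu(3,4) _ _ that])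
    show "farr \<rho> u v (f n) \<in> Arr C (fob \<rho> u) (fob \<rho> v)" for n
      using fD u \<rho>.farr_closed by simp
  next
    fix e :: real assume e: "e > 0"
    then obtain N where "\<forall>n\<ge>N. norm (?T (farr i u v (f n)) t - 0) < e / 2"
      using LIMSEQ_D[OF D(3), of "e / 2"] by auto
    then have N: "?T (farr i u v (f n)) t < e / 2" if "n \<ge> N" for n
      using that by force
    have "?C (farr \<rho> u v (f m)) (farr \<rho> u v (f n)) < e" if mn: "m \<ge> N" "n \<ge> N" for m n
    proof -
      have "?C (farr \<rho> u v (f m)) (farr \<rho> u v (f n)) \<le> ?T (farr i u v (f m)) (farr i u v (f n))"
        using bounded_minus u fD by simp
      also have "\<dots> \<le> ?T (farr i u v (f m)) t + ?T t (farr i u v (f n))"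
        using T.Nrm_minus_triangle iu fD u D i.farr_closed by simp
      also have "?T t (farr i u v (f n)) = ?T (farr i u v (f n)) t"
        using T.Nrm_minus_commute iu fD u D i.farr_closed by simp
      finally show ?thesis using N[OF mn(1)] N[OF mn(2)] by linarith
    qed
    then show "\<exists>N. \<forall>m\<ge>N. \<forall>n\<ge>N. ?C (farr \<rho> u v (f m)) (farr \<rho> u v (f n)) < e" by blast
  qed
qed

text \<open>Existence of the limit comes from \<open>approx_converges\<close> and its uniqueness
  from \<open>approx_difference\<close>, so the description in \<open>completion_extension\<close>
  denotes; by \<open>approx_difference\<close> again its value is the limit along every
  approximating sequence.\<close>

lemma ext_tends:
  assumes u: "u \<in> Ob D" "v \<in> Ob D" and f: "approx u v f t"
  shows "C.tends (fob \<rho> u) (fob \<rho> v) (\<lambda>n. farr \<rho> u v (f n)) (farr ext (fob i u) (fob i v) t)"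
proof -
  have iu: "fob \<rho> u \<in> Ob C" "fob \<rho> v \<in> Ob C"
    using u \<rho>.fob_closed by simp_all
  have inv: "inv_into (Ob D) (fob i) (fob i u) = u" "inv_into (Ob D) (fob i) (fob i v) = v"
    using u bij by (simp_all add: bij_betw_def)
  let ?P = "\<lambda>s. \<exists>g. approx u v g t \<and> C.tends (fob \<rho> u) (fob \<rho> v) (\<lambda>n. farr \<rho> u v (g n)) s"
  have tC: "t \<in> Arr T (fob i u) (fob i v)"
    using f T.tendsD by (auto simp: approx_def)
  have Peq: "(s \<in> Arr C (fob \<rho> u) (fob \<rho> v) \<and> (\<exists>g. (\<forall>n. g n \<in> Arr D u v) \<and>
      (\<lambda>n. Nrm T (fob i u) (fob i v) (farr i u v (g n) \<ominus>\<^bsub>Hom T (fob i u) (fob i v)\<^esub> t)) \<longlonglongrightarrow> 0 \<and>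
      (\<lambda>n. Nrm C (fob \<rho> u) (fob \<rho> v) (farr \<rho> u v (g n) \<ominus>\<^bsub>Hom C (fob \<rho> u) (fob \<rho> v)\<^esub> s)) \<longlonglongrightarrow> 0))
      \<longleftrightarrow> ?P s" for s
    using tC u by (auto simp: approx_def T.tends_def C.tends_def i.farr_closed \<rho>.farr_closed)
  have ext: "farr ext (fob i u) (fob i v) t = (THE s. ?P s)"
    by (simp only: completion_extension_def Let_def fctr.simps inv Peq)
  obtain s where s: "C.tends (fob \<rho> u) (fob \<rho> v) (\<lambda>n. farr \<rho> u v (f n)) s"
    using approx_converges[OF u f] .
  have "?P (THE s. ?P s)"
  proof (rule theI)
    show "?P s" using f s by blast
    show "s' = s" if "?P s'" for s'
      using that approx_difference[OF u f] s C.tends_unique[OF iu] by blast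
  qed
  then show ?thesis
    using approx_difference[OF u f] unfolding ext by blast
qed

lemma ext_eqI:
  assumes u: "u \<in> Ob D" "v \<in> Ob D" and f: "approx u v f t"
    and s: "C.tends (fob \<rho> u) (fob \<rho> v) (\<lambda>n. farr \<rho> u v (f n)) s"
  shows "farr ext (fob i u) (fob i v) t = s"
  using C.tends_unique[OF _ _ ext_tends[OF u f] s] u \<rho>.fob_closed by simp

lemma ext_i:
  assumes u: "u \<in> Ob D" "v \<in> Ob D" and f: "f \<in> Arr D u v"
  shows "farr ext (fob i u) (fob i v) (farr i u v f) = farr \<rho> u v f"
  by (rule ext_eqI[OF u, of "\<lambda>_. f"])
    (use u f in \<open>simp_all add: approx_def T.tends_const C.tends_const i.farr_closed i.fob_closed
      \<rho>.farr_closed \<rho>.fob_closed\<close>)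

text \<open>Each operation is continuous in \<open>T\<close> and in \<open>C\<close>. Applied
  termwise to approximating sequences it approximates the result in \<open>T\<close>, while the
  images converge to the result in \<open>C\<close>; \<open>ext_eqI\<close> identifies the
  two.\<close>

lemma star_functor_ext: "star_functor K T C ext"
proof
  fix x assume "x \<in> Ob T"
  then show "fob ext x \<in> Ob C"
    by (metis Ob_cases fob_ext \<rho>.fob_closed)
  from \<open>x \<in> Ob T\<close> show "farr ext x x (Idn T x) = Idn C (fob ext x)"
    by (metis Ob_cases fob_ext ext_i D_Idn i.farr_Idn \<rho>.farr_Idn)
next
  fix x y a assume "x \<in> Ob T" "y \<in> Ob T" and a: "a \<in> Arr T x y"
  then obtain u v where u: "u \<in> Ob D" "v \<in> Ob D" and x: "x = fob i u" "y = fob i v"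
    by (metis Ob_cases)
  obtain f where f: "approx u v f a" using approx_exists u a x by blast
  note l = ext_tends[OF u f]
  show "farr ext x y a \<in> Arr C (fob ext x) (fob ext y)"
    using C.tendsD(2)[OF l] by (simp add: x fob_ext u)
  have "approx v u (\<lambda>n. Star D u v (f n)) (Star T x y a)"
    using f u T.tends_Star[of "fob i u" "fob i v" "\<lambda>n. farr i u v (f n)" a]
    by (simp add: approx_def D_Star i.farr_Star i.fob_closed x)
  moreover have "C.tends (fob \<rho> v) (fob \<rho> u) (\<lambda>n. farr \<rho> v u (Star D u v (f n)))
      (Star C (fob \<rho> u) (fob \<rho> v) (farr ext x y a))"
    using C.tends_Star[OF _ _ l] f u by (simp add: approx_def \<rho>.farr_Star \<rho>.fob_closed x)
  ultimately show "farr ext y x (Star T x y a) = Star C (fob ext x) (fob ext y) (farr ext x y a)"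
    using ext_eqI u by (simp add: x fob_ext)
  fix c assume c: "c \<in> K"
  have "approx u v (\<lambda>n. c \<odot>\<^bsub>Hom D u v\<^esub> f n) (c \<odot>\<^bsub>Hom T x y\<^esub> a)"
    using f u c T.tends_smult[of "fob i u" "fob i v" c "\<lambda>n. farr i u v (f n)" a]
    by (simp add: approx_def D_smult i.farr_smult i.fob_closed x)
  moreover have "C.tends (fob \<rho> u) (fob \<rho> v) (\<lambda>n. farr \<rho> u v (c \<odot>\<^bsub>Hom D u v\<^esub> f n))
      (c \<odot>\<^bsub>Hom C (fob \<rho> u) (fob \<rho> v)\<^esub> farr ext x y a)"
    using C.tends_smult[OF _ _ c l] f u c by (simp add: approx_def \<rho>.farr_smult \<rho>.fob_closed x)
  ultimately show "farr ext x y (c \<odot>\<^bsub>Hom T x y\<^esub> a) = c \<odot>\<^bsub>Hom C (fob ext x) (fob ext y)\<^esub> farr ext x y a"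
    using ext_eqI u by (simp add: x fob_ext)
next
  fix x y a a' assume "x \<in> Ob T" "y \<in> Ob T" and a: "a \<in> Arr T x y" "a' \<in> Arr T x y"
  then obtain u v where u: "u \<in> Ob D" "v \<in> Ob D" and x: "x = fob i u" "y = fob i v"
    by (metis Ob_cases)
  obtain f g where f: "approx u v f a" and g: "approx u v g a'" using approx_exists u a x by metis
  have "approx u v (\<lambda>n. f n \<oplus>\<^bsub>Hom D u v\<^esub> g n) (a \<oplus>\<^bsub>Hom T x y\<^esub> a')"
    using f g u T.tends_add[of "fob i u" "fob i v" "\<lambda>n. farr i u v (f n)" a "\<lambda>n. farr i u v (g n)" a']
    by (simp add: approx_def D_add i.farr_add i.fob_closed x)
  moreover have "C.tends (fob \<rho> u) (fob \<rho> v) (\<lambda>n. farr \<rho> u v (f n \<oplus>\<^bsub>Hom D u v\<^esub> g n))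
      (farr ext x y a \<oplus>\<^bsub>Hom C (fob \<rho> u) (fob \<rho> v)\<^esub> farr ext x y a')"
    using C.tends_add[OF _ _ ext_tends[OF u f] ext_tends[OF u g]] f g u
    by (simp add: approx_def \<rho>.farr_add \<rho>.fob_closed x)
  ultimately show "farr ext x y (a \<oplus>\<^bsub>Hom T x y\<^esub> a')
      = farr ext x y a \<oplus>\<^bsub>Hom C (fob ext x) (fob ext y)\<^esub> farr ext x y a'"
    using ext_eqI u by (simp add: x fob_ext)
next
  fix x y z a b assume "x \<in> Ob T" "y \<in> Ob T" "z \<in> Ob T" and a: "a \<in> Arr T x y" "b \<in> Arr T y z"
  then obtain u v w where u: "u \<in> Ob D" "v \<in> Ob D" "w \<in> Ob D"
    and x: "x = fob i u" "y = fob i v" "z = fob i w"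
    by (metis Ob_cases)
  obtain f g where f: "approx u v f a" and g: "approx v w g b" using approx_exists u a x by metis
  have "approx u w (\<lambda>n. Comp D u v w (g n) (f n)) (Comp T x y z b a)"
    using f g u T.tends_Comp[of "fob i u" "fob i v" "fob i w" "\<lambda>n. farr i u v (f n)" a "\<lambda>n. farr i v w (g n)" b]
    by (simp add: approx_def D_Comp i.farr_Comp i.fob_closed x)
  moreover have "C.tends (fob \<rho> u) (fob \<rho> w) (\<lambda>n. farr \<rho> u w (Comp D u v w (g n) (f n)))
      (Comp C (fob \<rho> u) (fob \<rho> v) (fob \<rho> w) (farr ext y z b) (farr ext x y a))"
    using C.tends_Comp[OF _ _ _ ext_tends[OF u(1,2) f] ext_tends[OF u(2,3) g]] f g u
    by (simp add: approx_def \<rho>.farr_Comp \<rho>.fob_closed x)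
  ultimately show "farr ext x z (Comp T x y z b a)
      = Comp C (fob ext x) (fob ext y) (fob ext z) (farr ext y z b) (farr ext x y a)"
    using ext_eqI u by (simp add: x fob_ext)
qed

lemma ext_bounded:
  assumes "x \<in> Ob T" "y \<in> Ob T" and a: "a \<in> Arr T x y"
  shows "Nrm C (fob ext x) (fob ext y) (farr ext x y a) \<le> Nrm T x y a"
proof -
  obtain u v where u: "u \<in> Ob D" "v \<in> Ob D" and x: "x = fob i u" "y = fob i v"
    using assms by (metis Ob_cases)
  obtain f where f: "approx u v f a" using approx_exists u a x by blast
  then have tf: "T.tends x y (\<lambda>n. farr i u v (f n)) a" and fD: "f n \<in> Arr D u v" for n
    by (simp_all add: approx_def x)
  note l = ext_tends[OF u f]
  let ?T = "\<lambda>n. Nrm T x y (farr i u v (f n) \<ominus>\<^bsub>Hom T x y\<^esub> a)"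
  let ?C = "\<lambda>n. Nrm C (fob \<rho> u) (fob \<rho> v)
    (farr \<rho> u v (f n) \<ominus>\<^bsub>Hom C (fob \<rho> u) (fob \<rho> v)\<^esub> farr ext (fob i u) (fob i v) a)"
  have "Nrm C (fob \<rho> u) (fob \<rho> v) (farr ext x y a) \<le> ?C n + (?T n + Nrm T x y a)" for n
    using C.tends_Nrm_le(2)[OF _ _ l, of n] T.tends_Nrm_le(1)[OF _ _ tf, of n]
      bounded[OF u fD, of n] u by (simp add: \<rho>.fob_closed i.fob_closed x)
  moreover have "(\<lambda>n. ?C n + (?T n + Nrm T x y a)) \<longlonglongrightarrow> 0 + (0 + Nrm T x y a)"
    by (intro tendsto_intros T.tendsD(3)[OF tf] C.tendsD(3)[OF l])
  ultimately have "Nrm C (fob \<rho> u) (fob \<rho> v) (farr ext x y a) \<le> 0 + (0 + Nrm T x y a)"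
    by (intro LIMSEQ_le_const) auto
  then show ?thesis using u by (simp add: x fob_ext)
qed

end


section \<open>Functoriality of the maximal tensor product\<close>

text \<open>The norm bound is carried along because it makes functors commute with limits. For
  functors between maximal tensor products it is supplied by \<open>ext_bounded\<close>.\<close>

definition contractive_functor where
  "contractive_functor K A B F \<longleftrightarrow> star_functor K A B F \<and>
     (\<forall>x \<in> Ob A. \<forall>y \<in> Ob A. \<forall>a \<in> Arr A x y. Nrm B (fob F x) (fob F y) (farr F x y a) \<le> Nrm A x y a)"

lemma contractive_functor_id: "contractive_functor K A A id_fctr"
  by (simp add: contractive_functor_def star_functor_id)

lemma contractive_functor_comp:
  assumes "contractive_functor K A B F" "contractive_functor K B C G"
  shows "contractive_functor K A C (G \<circ>\<^sub>F F)"
proof -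
  interpret F: star_functor K A B F using assms by (simp add: contractive_functor_def)
  have "Nrm C (fob G (fob F x)) (fob G (fob F y)) (farr G (fob F x) (fob F y) (farr F x y a))
      \<le> Nrm A x y a" if "x \<in> Ob A" "y \<in> Ob A" "a \<in> Arr A x y" for x y a
    using assms that F.fob_closed F.farr_closed
    by (meson contractive_functor_def order_trans)
  then show ?thesis
    using assms star_functor_comp[of K A B F C G] by (simp add: contractive_functor_def)
qed

lemma contractive_functor_tends:
  assumes A: "cstar_category_over K A" and B: "cstar_category_over K B"
    and F: "contractive_functor K A B F"
    and x: "x \<in> Ob A" "y \<in> Ob A" and f: "cstar_category.tends A x y f a"
  shows "cstar_category.tends B (fob F x) (fob F y) (\<lambda>n. farr F x y (f n)) (farr F x y a)"
proof -
  interpret A: cstar_category_over K A by fact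
  interpret B: cstar_category_over K B by fact
  interpret F: star_functor K A B F using F by (simp add: contractive_functor_def)
  note D = A.tendsD[OF f] and m = ground_field_simps(3)[OF A.K]
  show ?thesis
  proof (rule B.tendsI[OF _ _ _ _ _ D(3)])
    fix n
    have "farr F x y (f n) \<ominus>\<^bsub>Hom B (fob F x) (fob F y)\<^esub> farr F x y a
        = farr F x y (f n \<ominus>\<^bsub>Hom A x y\<^esub> a)"
      using D x m by (simp add: A.minus_eq B.minus_eq F.farr_add F.farr_smult A.Hom_smult
          F.fob_closed F.farr_closed)
    then show "Nrm B (fob F x) (fob F y)
        (farr F x y (f n) \<ominus>\<^bsub>Hom B (fob F x) (fob F y)\<^esub> farr F x y a)
      \<le> Nrm A x y (f n \<ominus>\<^bsub>Hom A x y\<^esub> a)"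
      using F D x A.Hom_minus by (simp add: contractive_functor_def)
  qed (use D x in \<open>simp_all add: F.fob_closed F.farr_closed\<close>)
qed

locale max_tensor = A: cstar_category K A + B: cstar_category K B + star_category_pair K A B
  for K and A B :: "('o, 'm) cstar_cat" +
  fixes T i
  assumes mt: "is_max_tensor K A B T i"
begin

sublocale T: cstar_category_over K T
  using mt K by (simp add: is_max_tensor_def cstar_category_over_def cstar_category_over_axioms_def)

sublocale i: star_functor K "alg_tensor K A B" T i
  using mt by (simp add: is_max_tensor_def)

lemma bij_i: "bij_betw (fob i) (Ob A \<times> Ob B) (Ob T)"
  using mt by (simp add: is_max_tensor_def)

text \<open>The pair of \<open>C\<close> and \<open>\<rho>\<close> is one of those over which
  \<open>max_norm\<close> is a supremum; this is why \<open>C\<close> has to belong to the universe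
  of \<open>A\<close> and \<open>B\<close>.\<close>

lemma Nrm_le:
  fixes C :: "('o, 'm) cstar_cat"
  assumes C: "cstar_category K C" "star_functor K (alg_tensor K A B) C \<rho>"
    and u: "u \<in> Ob A \<times> Ob B" "v \<in> Ob A \<times> Ob B" and f: "f \<in> Arr (alg_tensor K A B) u v"
  shows "Nrm C (fob \<rho> u) (fob \<rho> v) (farr \<rho> u v f) \<le> Nrm T (fob i u) (fob i v) (farr i u v f)"
proof -
  have "ereal (Nrm T (fob i u) (fob i v) (farr i u v f)) = max_norm K A B u v f"
    using mt u f unfolding is_max_tensor_def alg_tensor_Ob by blast
  moreover have "ereal (Nrm C (fob \<rho> u) (fob \<rho> v) (farr \<rho> u v f)) \<le> max_norm K A B u v f"
    unfolding max_norm_def by (rule SUP_upper2[of "(C, \<rho>)"]) (use C in auto)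
  ultimately show ?thesis by (metis ereal_less_eq(3))
qed

lemma star_completion:
  fixes C :: "('o, 'm) cstar_cat"
  assumes C: "cstar_category K C" "star_functor K (alg_tensor K A B) C \<rho>"
  shows "star_completion K (alg_tensor K A B) T i C \<rho>"
proof -
  interpret C: cstar_category_over K C
    using C K by (simp add: cstar_category_over_def cstar_category_over_axioms_def)
  interpret \<rho>: star_functor K "alg_tensor K A B" C \<rho> by (fact C)
  show ?thesis
  proof
    show "\<exists>f\<in>Arr (alg_tensor K A B) u v. Nrm T (fob i u) (fob i v)
        (farr i u v f \<ominus>\<^bsub>Hom T (fob i u) (fob i v)\<^esub> t) < e"
      if "u \<in> Ob (alg_tensor K A B)" "v \<in> Ob (alg_tensor K A B)"
        "t \<in> Arr T (fob i u) (fob i v)" "e > 0" for u v t e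
      using mt that unfolding is_max_tensor_def by blast
    show "Idn (alg_tensor K A B) u \<in> Arr (alg_tensor K A B) u u" if "u \<in> Ob (alg_tensor K A B)" for u
      using that ten_closed A.Idn_closed B.Idn_closed by (cases u) (auto simp: alg_tensor_Idn ten_def)
  qed (use bij_i Nrm_le C in \<open>simp_all add: alg_tensor_closed\<close>)
qed

definition el where
  "el x x' y y' a b = farr i (x, x') (y, y') (ten x x' y y' a b)"

lemma i_closed: "\<lbrakk>x \<in> Ob A; x' \<in> Ob B\<rbrakk> \<Longrightarrow> fob i (x, x') \<in> Ob T"
  using i.fob_closed by simp

lemma i_eq_iff: "\<lbrakk>x \<in> Ob A; x' \<in> Ob B; y \<in> Ob A; y' \<in> Ob B\<rbrakk> \<Longrightarrow>
    fob i (x, x') = fob i (y, y') \<longleftrightarrow> x = y \<and> x' = y'"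
  using bij_i by (auto simp: bij_betw_def inj_on_def)

lemma Ob_T_cases:
  assumes "u \<in> Ob T"
  obtains x x' where "x \<in> Ob A" "x' \<in> Ob B" "u = fob i (x, x')"
proof -
  have "u \<in> fob i ` (Ob A \<times> Ob B)" using assms bij_i by (simp add: bij_betw_def)
  then show thesis using that by auto
qed

lemma el_closed:
  "\<lbrakk>x \<in> Ob A; y \<in> Ob A; x' \<in> Ob B; y' \<in> Ob B; a \<in> Arr A x y; b \<in> Arr B x' y'\<rbrakk>
    \<Longrightarrow> el x x' y y' a b \<in> Arr T (fob i (x, x')) (fob i (y, y'))"
  by (simp add: el_def i.farr_closed ten_closed)

lemma el_Idn: "\<lbrakk>x \<in> Ob A; x' \<in> Ob B\<rbrakk> \<Longrightarrow> el x x' x x' (Idn A x) (Idn B x') = Idn T (fob i (x, x'))"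
  by (simp add: el_def ten_def i.farr_Idn flip: alg_tensor_Idn)

lemma el_Comp:
  assumes "x \<in> Ob A" "y \<in> Ob A" "z \<in> Ob A" "x' \<in> Ob B" "y' \<in> Ob B" "z' \<in> Ob B"
    and "a \<in> Arr A x y" "a' \<in> Arr B x' y'" "b \<in> Arr A y z" "b' \<in> Arr B y' z'"
  shows "Comp T (fob i (x, x')) (fob i (y, y')) (fob i (z, z')) (el y y' z z' b b') (el x x' y y' a a')
    = el x x' z z' (Comp A x y z b a) (Comp B x' y' z' b' a')"
  using assms by (simp add: el_def ten_closed flip: i.farr_Comp ten_Comp)

lemma el_Star:
  assumes "x \<in> Ob A" "y \<in> Ob A" "x' \<in> Ob B" "y' \<in> Ob B" "a \<in> Arr A x y" "a' \<in> Arr B x' y'"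
  shows "Star T (fob i (x, x')) (fob i (y, y')) (el x x' y y' a a')
    = el y y' x x' (Star A x y a) (Star B x' y' a')"
  using assms by (simp add: el_def ten_closed flip: i.farr_Star ten_Star)

lemma el_unitary:
  assumes "x \<in> Ob A" "y \<in> Ob A" "x' \<in> Ob B" "y' \<in> Ob B"
    and "unitary_arrow A x y a" "unitary_arrow B x' y' b"
  shows "unitary_arrow T (fob i (x, x')) (fob i (y, y')) (el x x' y y' a b)"
  using assms
  by (simp add: unitary_arrow_def el_closed el_Star el_Comp el_Idn A.Star_closed B.Star_closed)

text \<open>Elementary tensors span the algebraic tensor product, whose image is dense in
  \<open>T\<close>. A property that is stable under linear operations and limits is therefore
  decided on them.\<close>

lemma T_induct:
  assumes ob: "x \<in> Ob A" "y \<in> Ob A" "x' \<in> Ob B" "y' \<in> Ob B"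
    and t: "t \<in> Arr T (fob i (x, x')) (fob i (y, y'))"
    and el: "\<And>a b. \<lbrakk>a \<in> Arr A x y; b \<in> Arr B x' y'\<rbrakk> \<Longrightarrow> Q (el x x' y y' a b)"
    and add: "\<And>s t. \<lbrakk>s \<in> Arr T (fob i (x, x')) (fob i (y, y')); Q s;
        t \<in> Arr T (fob i (x, x')) (fob i (y, y')); Q t\<rbrakk>
      \<Longrightarrow> Q (s \<oplus>\<^bsub>Hom T (fob i (x, x')) (fob i (y, y'))\<^esub> t)"
    and smult: "\<And>c s. \<lbrakk>c \<in> K; s \<in> Arr T (fob i (x, x')) (fob i (y, y')); Q s\<rbrakk>
      \<Longrightarrow> Q (c \<odot>\<^bsub>Hom T (fob i (x, x')) (fob i (y, y'))\<^esub> s)"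
    and lim: "\<And>f s. \<lbrakk>T.tends (fob i (x, x')) (fob i (y, y')) f s; \<And>n. Q (f n)\<rbrakk> \<Longrightarrow> Q s"
  shows "Q t"
proof -
  \<comment> \<open>Taking \<open>i\<close> itself as the functor to be extended makes the
    approximating sequences available.\<close>
  interpret E: star_completion K "alg_tensor K A B" T i T i
    using star_completion T.cstar_category_axioms i.star_functor_axioms by blast
  let ?u = "(x, x')" and ?v = "(y, y')"
  have u: "?u \<in> Ob (alg_tensor K A B)" "?v \<in> Ob (alg_tensor K A B)" using ob by simp_all
  have Qi: "Q (farr i ?u ?v f)" if "f \<in> Arr (alg_tensor K A B) ?u ?v" for f
    by (rule alg_tensor_induct[OF ob that, where Q = "\<lambda>f. Q (farr i ?u ?v f)"])
      (use u add smult el in \<open>simp_all add: el_def i.farr_add i.farr_smult i.farr_closed\<close>)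
  obtain f where "E.approx ?u ?v f t"
    using E.approx_exists[OF u t] .
  then show ?thesis
    using lim Qi unfolding E.approx_def by blast
qed

text \<open>On each Hom space the arrows where \<open>M\<close> and \<open>N\<close> agree are
  stable under sums, scalars and, by contractivity, limits, so \<open>T_induct\<close>
  applies.\<close>

lemma contractive_functor_eqI:
  fixes C :: "('p, 'n) cstar_cat"
  assumes C: "cstar_category K C" and MN: "contractive_functor K T C M" "contractive_functor K T C N"
    and ob: "\<And>x x'. \<lbrakk>x \<in> Ob A; x' \<in> Ob B\<rbrakk> \<Longrightarrow> fob M (fob i (x, x')) = fob N (fob i (x, x'))"
    and el: "\<And>x x' y y' a b. \<lbrakk>x \<in> Ob A; y \<in> Ob A; x' \<in> Ob B; y' \<in> Ob B; a \<in> Arr A x y; b \<in> Arr B x' y'\<rbrakk>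
      \<Longrightarrow> farr M (fob i (x, x')) (fob i (y, y')) (el x x' y y' a b)
        = farr N (fob i (x, x')) (fob i (y, y')) (el x x' y y' a b)"
  shows "fctr_eq T M N"
proof -
  interpret C: cstar_category_over K C
    using C K by (simp add: cstar_category_over_def cstar_category_over_axioms_def)
  interpret M: star_functor K T C M using MN by (simp add: contractive_functor_def)
  interpret N: star_functor K T C N using MN by (simp add: contractive_functor_def)
  have "farr M (fob i (x, x')) (fob i (y, y')) t = farr N (fob i (x, x')) (fob i (y, y')) t"
    if xy: "x \<in> Ob A" "y \<in> Ob A" "x' \<in> Ob B" "y' \<in> Ob B"
      and t: "t \<in> Arr T (fob i (x, x')) (fob i (y, y'))" for x y x' y' t
  proof (rule T_induct[OF xy t, where Q = "\<lambda>t. farr M (fob i (x, x')) (fob i (y, y')) t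
        = farr N (fob i (x, x')) (fob i (y, y')) t"])
    let ?u = "fob i (x, x')" and ?v = "fob i (y, y')"
    have u: "?u \<in> Ob T" "?v \<in> Ob T" using xy i_closed by simp_all
    fix f s assume f: "T.tends ?u ?v f s" and eq: "\<And>n. farr M ?u ?v (f n) = farr N ?u ?v (f n)"
    note l = contractive_functor_tends[OF T.cstar_category_over_axioms C.cstar_category_over_axioms _ u f]
    show "farr M ?u ?v s = farr N ?u ?v s"
      using C.tends_unique[OF _ _ l[OF MN(1)]] l[OF MN(2)] u xy
      by (simp add: eq ob M.fob_closed N.fob_closed)
  qed (use xy ob el in \<open>simp_all add: i_closed M.farr_add N.farr_add M.farr_smult N.farr_smult\<close>)
  then show ?thesis
    unfolding fctr_eq_def using ob by (metis Ob_T_cases)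
qed

end

text \<open>The functor \<open>j\<close> after \<open>F \<otimes> F'\<close> maps into
  \<open>U\<close>, which lies in the universe, so it is bounded by the maximal norm and extends
  contractively; its values on elementary tensors can be read off from \<open>ext_i\<close>.\<close>

lemma max_tensor_fctr:
  fixes A A' B B' T U :: "('o, 'm) cstar_cat"
  assumes T: "max_tensor K A A' T i" and U: "max_tensor K B B' U j"
    and F: "star_functor K A B F" "star_functor K A' B' F'"
  defines "M \<equiv> max_tensor_fctr K A A' T i B B' U j F F'"
  shows "contractive_functor K T U M"
    and "\<lbrakk>x \<in> Ob A; x' \<in> Ob A'\<rbrakk> \<Longrightarrow> fob M (fob i (x, x')) = fob j (fob F x, fob F' x')"
    and "\<lbrakk>x \<in> Ob A; y \<in> Ob A; x' \<in> Ob A'; y' \<in> Ob A'; a \<in> Arr A x y; a' \<in> Arr A' x' y'\<rbrakk> \<Longrightarrow>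
      farr M (fob i (x, x')) (fob i (y, y')) (max_tensor.el K A A' i x x' y y' a a')
      = max_tensor.el K B B' j (fob F x) (fob F' x') (fob F y) (fob F' y') (farr F x y a) (farr F' x' y' a')"
proof -
  interpret T: max_tensor K A A' T i by fact
  interpret U: max_tensor K B B' U j by fact
  let ?t = "alg_tensor_fctr K B B' F F'"
  note t = star_functor_alg_tensor[OF T.star_category_pair_axioms U.star_category_pair_axioms F]
  have ob: "fob ?t (x, x') = (fob F x, fob F' x')" for x x'
    by (simp add: alg_tensor_fctr_def)
  interpret E: star_completion K "alg_tensor K A A'" T i U "j \<circ>\<^sub>F ?t"
    using T.star_completion U.T.cstar_category_axioms
      star_functor_comp[OF t(1) U.i.star_functor_axioms] by blast
  have M: "M = E.ext" by (simp add: M_def max_tensor_fctr_def)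
  show "contractive_functor K T U M"
    unfolding contractive_functor_def M using E.star_functor_ext E.ext_bounded by blast
  show "fob M (fob i (x, x')) = fob j (fob F x, fob F' x')" if "x \<in> Ob A" "x' \<in> Ob A'"
    using that by (simp add: M E.fob_ext ob)
  show "farr M (fob i (x, x')) (fob i (y, y')) (T.el x x' y y' a a')
      = U.el (fob F x) (fob F' x') (fob F y) (fob F' y') (farr F x y a) (farr F' x' y' a')"
    if "x \<in> Ob A" "y \<in> Ob A" "x' \<in> Ob A'" "y' \<in> Ob A'" "a \<in> Arr A x y" "a' \<in> Arr A' x' y'"
    using that t(2) by (simp add: M T.el_def U.el_def E.ext_i T.ten_closed ob)
qed

section \<open>Functor laws of the maximal tensor product, verified on elementary tensors\<close>

lemma max_tensor_fctr_id:
  fixes A A' T :: "('o, 'm) cstar_cat"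
  assumes T: "max_tensor K A A' T i"
  shows "fctr_eq T (max_tensor_fctr K A A' T i A A' T i id_fctr id_fctr) id_fctr"
proof -
  interpret T: max_tensor K A A' T i by fact
  note M = max_tensor_fctr[OF T T star_functor_id star_functor_id]
  show ?thesis
    by (rule T.contractive_functor_eqI[OF T.T.cstar_category_axioms M(1) contractive_functor_id])
      (simp_all add: M)
qed

lemma max_tensor_fctr_cong:
  fixes A A' B B' T U :: "('o, 'm) cstar_cat"
  assumes T: "max_tensor K A A' T i" and U: "max_tensor K B B' U j"
    and F: "star_functor K A B F" "star_functor K A' B' F'"
    and G: "star_functor K A B G" "star_functor K A' B' G'"
    and eq: "fctr_eq A F G" "fctr_eq A' F' G'"
  shows "fctr_eq T (max_tensor_fctr K A A' T i B B' U j F F') (max_tensor_fctr K A A' T i B B' U j G G')"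
proof -
  interpret T: max_tensor K A A' T i by fact
  interpret U: max_tensor K B B' U j by fact
  note M = max_tensor_fctr[OF T U F] and N = max_tensor_fctr[OF T U G]
  show ?thesis
    by (rule T.contractive_functor_eqI[OF U.T.cstar_category_axioms M(1) N(1)])
      (use eq in \<open>simp_all add: M N fctr_eq_def\<close>)
qed

lemma max_tensor_fctr_comp:
  fixes A A' B B' C C' T U V :: "('o, 'm) cstar_cat"
  assumes T: "max_tensor K A A' T i" and U: "max_tensor K B B' U j" and V: "max_tensor K C C' V k"
    and F: "star_functor K A B F" "star_functor K A' B' F'"
    and G: "star_functor K B C G" "star_functor K B' C' G'"
  shows "fctr_eq T (max_tensor_fctr K B B' U j C C' V k G G' \<circ>\<^sub>F max_tensor_fctr K A A' T i B B' U j F F')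
    (max_tensor_fctr K A A' T i C C' V k (G \<circ>\<^sub>F F) (G' \<circ>\<^sub>F F'))"
proof -
  interpret T: max_tensor K A A' T i by fact
  interpret U: max_tensor K B B' U j by fact
  interpret V: max_tensor K C C' V k by fact
  interpret F: star_functor K A B F by fact
  interpret F': star_functor K A' B' F' by fact
  note M = max_tensor_fctr[OF T U F] and N = max_tensor_fctr[OF U V G]
    and MN = max_tensor_fctr[OF T V star_functor_comp[OF F(1) G(1)] star_functor_comp[OF F(2) G(2)]]
  show ?thesis
    by (rule T.contractive_functor_eqI[OF V.T.cstar_category_axioms
          contractive_functor_comp[OF M(1) N(1)] MN(1)])
      (simp_all add: M N MN F.fob_closed F'.fob_closed F.farr_closed F'.farr_closed)
qed

lemma unitary_nat_iso_cong:
  assumes "unitary_nat_iso A B F G u" "fctr_eq A F F'" "fctr_eq A G G'"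
  shows "unitary_nat_iso A B F' G' u"
  using assms by (simp add: unitary_nat_iso_def fctr_eq_def)

text \<open>The components \<open>v y \<otimes> v' y'\<close>; an object of \<open>T\<close> must be
  decoded into its pair because \<open>T\<close> lives in the universe.\<close>

definition max_tensor_nat where
  "max_tensor_nat K A A' i B B' j F F' G G' v v' x =
     (let (y, y') = inv_into (Ob A \<times> Ob A') (fob i) x
      in max_tensor.el K B B' j (fob F y) (fob F' y') (fob G y) (fob G' y') (v y) (v' y'))"

text \<open>Naturality holds on elementary tensors factor by factor. Both sides of the square are
  linear and continuous in the arrow, so \<open>T_induct\<close> extends it to \<open>T\<close>; a
  tensor of unitaries is unitary by \<open>el_unitary\<close>.\<close>

lemma max_tensor_nat:
  fixes A A' B B' T U :: "('o, 'm) cstar_cat"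
  assumes T: "max_tensor K A A' T i" and U: "max_tensor K B B' U j"
    and F: "star_functor K A B F" "star_functor K A' B' F'"
    and G: "star_functor K A B G" "star_functor K A' B' G'"
    and v: "unitary_nat_iso A B F G v" "unitary_nat_iso A' B' F' G' v'"
  defines "w \<equiv> max_tensor_nat K A A' i B B' j F F' G G' v v'"
  shows "\<lbrakk>x \<in> Ob A; x' \<in> Ob A'\<rbrakk> \<Longrightarrow> w (fob i (x, x'))
      = max_tensor.el K B B' j (fob F x) (fob F' x') (fob G x) (fob G' x') (v x) (v' x')"
    and "unitary_nat_iso T U (max_tensor_fctr K A A' T i B B' U j F F')
      (max_tensor_fctr K A A' T i B B' U j G G') w"
proof -
  interpret T: max_tensor K A A' T i by fact
  interpret U: max_tensor K B B' U j by fact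
  interpret F: star_functor K A B F by fact
  interpret F': star_functor K A' B' F' by fact
  interpret G: star_functor K A B G by fact
  interpret G': star_functor K A' B' G' by fact
  show w: "w (fob i (x, x')) = U.el (fob F x) (fob F' x') (fob G x) (fob G' x') (v x) (v' x')"
    if "x \<in> Ob A" "x' \<in> Ob A'" for x x'
  proof -
    have "inv_into (Ob A \<times> Ob A') (fob i) (fob i (x, x')) = (x, x')"
      using T.bij_i that by (simp add: bij_betw_def)
    then show ?thesis by (simp add: w_def max_tensor_nat_def)
  qed
  note cl [simp] = F.fob_closed F'.fob_closed G.fob_closed G'.fob_closed
    F.farr_closed F'.farr_closed G.farr_closed G'.farr_closed
    U.A.Comp_closed U.B.Comp_closed U.i_closed T.i_closed U.el_closed T.el_closed
  note vc [simp] = unitary_nat_isoD(2)[OF v(1)] unitary_nat_isoD(2)[OF v(2)]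
  note M = max_tensor_fctr[OF T U F] and N = max_tensor_fctr[OF T U G]
  let ?M = "max_tensor_fctr K A A' T i B B' U j F F'"
  let ?N = "max_tensor_fctr K A A' T i B B' U j G G'"
  interpret M: star_functor K T U ?M using M(1) by (simp add: contractive_functor_def)
  interpret N: star_functor K T U ?N using N(1) by (simp add: contractive_functor_def)
  have wu: "unitary_arrow U (fob j (fob F x, fob F' x')) (fob j (fob G x, fob G' x')) (w (fob i (x, x')))"
    if "x \<in> Ob A" "x' \<in> Ob A'" for x x'
    using that unitary_nat_isoD(1)[OF v(1)] unitary_nat_isoD(1)[OF v(2)]
    by (simp add: w U.el_unitary)
  have "Comp U (fob j (fob F x, fob F' x')) (fob j (fob F y, fob F' y')) (fob j (fob G y, fob G' y'))
        (w (fob i (y, y'))) (farr ?M (fob i (x, x')) (fob i (y, y')) t)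
      = Comp U (fob j (fob F x, fob F' x')) (fob j (fob G x, fob G' x')) (fob j (fob G y, fob G' y'))
        (farr ?N (fob i (x, x')) (fob i (y, y')) t) (w (fob i (x, x')))"
    if xy: "x \<in> Ob A" "y \<in> Ob A" "x' \<in> Ob A'" "y' \<in> Ob A'"
      and t: "t \<in> Arr T (fob i (x, x')) (fob i (y, y'))" for x x' y y' t
  proof -
    let ?u = "fob i (x, x')" and ?v = "fob i (y, y')"
    let ?fx = "fob j (fob F x, fob F' x')" and ?fy = "fob j (fob F y, fob F' y')"
    let ?gx = "fob j (fob G x, fob G' x')" and ?gy = "fob j (fob G y, fob G' y')"
    have u: "?u \<in> Ob T" "?v \<in> Ob T" using xy by simp_all
    have Uob: "?fx \<in> Ob U" "?fy \<in> Ob U" "?gx \<in> Ob U" "?gy \<in> Ob U" using xy by simp_all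
    have wc: "w ?u \<in> Arr U ?fx ?gx" "w ?v \<in> Arr U ?fy ?gy"
      using wu xy by (simp_all add: unitary_arrow_def)
    have Mc: "farr ?M ?u ?v s \<in> Arr U ?fx ?fy" and Nc: "farr ?N ?u ?v s \<in> Arr U ?gx ?gy"
      if "s \<in> Arr T ?u ?v" for s
      using M.farr_closed[OF u that] N.farr_closed[OF u that] xy by (simp_all add: M N)
    show ?thesis
    proof (rule T.T_induct[OF xy t, where Q = "\<lambda>t. Comp U ?fx ?fy ?gy (w ?v) (farr ?M ?u ?v t)
          = Comp U ?fx ?gx ?gy (farr ?N ?u ?v t) (w ?u)"])
      fix a b assume ab: "a \<in> Arr A x y" "b \<in> Arr A' x' y'"
      show "Comp U ?fx ?fy ?gy (w ?v) (farr ?M ?u ?v (T.el x x' y y' a b))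
          = Comp U ?fx ?gx ?gy (farr ?N ?u ?v (T.el x x' y y' a b)) (w ?u)"
        using xy ab by (simp add: M N w U.el_Comp unitary_nat_isoD(3)[OF v(1)] unitary_nat_isoD(3)[OF v(2)])
    next
      fix s t assume st: "s \<in> Arr T ?u ?v" "t \<in> Arr T ?u ?v"
        and "Comp U ?fx ?fy ?gy (w ?v) (farr ?M ?u ?v s) = Comp U ?fx ?gx ?gy (farr ?N ?u ?v s) (w ?u)"
          "Comp U ?fx ?fy ?gy (w ?v) (farr ?M ?u ?v t) = Comp U ?fx ?gx ?gy (farr ?N ?u ?v t) (w ?u)"
      then show "Comp U ?fx ?fy ?gy (w ?v) (farr ?M ?u ?v (s \<oplus>\<^bsub>Hom T ?u ?v\<^esub> t))
          = Comp U ?fx ?gx ?gy (farr ?N ?u ?v (s \<oplus>\<^bsub>Hom T ?u ?v\<^esub> t)) (w ?u)"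
        using M.farr_add[OF u st] N.farr_add[OF u st] xy Uob wc Mc Nc
        by (simp add: M N U.T.Comp_add_left U.T.Comp_add_right)
    next
      fix c s assume c: "c \<in> K" and s: "s \<in> Arr T ?u ?v"
        and "Comp U ?fx ?fy ?gy (w ?v) (farr ?M ?u ?v s) = Comp U ?fx ?gx ?gy (farr ?N ?u ?v s) (w ?u)"
      then show "Comp U ?fx ?fy ?gy (w ?v) (farr ?M ?u ?v (c \<odot>\<^bsub>Hom T ?u ?v\<^esub> s))
          = Comp U ?fx ?gx ?gy (farr ?N ?u ?v (c \<odot>\<^bsub>Hom T ?u ?v\<^esub> s)) (w ?u)"
        using M.farr_smult[OF u s c] N.farr_smult[OF u s c] xy Uob wc Mc Nc
        by (simp add: M N U.T.Comp_smult_left U.T.Comp_smult_right)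
    next
      fix f s assume f: "T.T.tends ?u ?v f s"
        and eq: "\<And>n. Comp U ?fx ?fy ?gy (w ?v) (farr ?M ?u ?v (f n))
          = Comp U ?fx ?gx ?gy (farr ?N ?u ?v (f n)) (w ?u)"
      note l = contractive_functor_tends[OF T.T.cstar_category_over_axioms U.T.cstar_category_over_axioms _ u f]
      have "U.T.tends ?fx ?gy (\<lambda>n. Comp U ?fx ?fy ?gy (w ?v) (farr ?M ?u ?v (f n)))
          (Comp U ?fx ?fy ?gy (w ?v) (farr ?M ?u ?v s))"
        using U.T.tends_Comp[OF Uob(1,2,4) _ U.T.tends_const[OF Uob(2,4) wc(2)]] l[OF M(1)] xy
        by (simp add: M)
      moreover have "U.T.tends ?fx ?gy (\<lambda>n. Comp U ?fx ?gx ?gy (farr ?N ?u ?v (f n)) (w ?u))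
          (Comp U ?fx ?gx ?gy (farr ?N ?u ?v s) (w ?u))"
        using U.T.tends_Comp[OF Uob(1,3,4) U.T.tends_const[OF Uob(1,3) wc(1)]] l[OF N(1)] xy
        by (simp add: N)
      ultimately show "Comp U ?fx ?fy ?gy (w ?v) (farr ?M ?u ?v s)
          = Comp U ?fx ?gx ?gy (farr ?N ?u ?v s) (w ?u)"
        using U.T.tends_unique[OF Uob(1,4)] by (simp add: eq)
    qed
  qed
  then show "unitary_nat_iso T U ?M ?N w"
    unfolding unitary_nat_iso_def
    by (auto elim!: T.Ob_T_cases simp: M N wu)
qed


section \<open>The pushout product\<close>

lemma unitary_nat_iso_Idn:
  assumes "star_category K A"
  shows "unitary_nat_iso A A id_fctr id_fctr (Idn A)"
proof -
  interpret star_category K A by fact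
  show ?thesis
    by (simp add: unitary_nat_iso_def unitary_Idn Comp_Idn_left Comp_Idn_right)
qed

text \<open>Both paths equal the tensor product of the composites. This yields the square that
  induces the pushout product, and the interchange of a retraction on one factor with a functor on
  the other.\<close>

lemma max_tensor_fctr_square:
  fixes A A' B B' C C' D D' S T U V :: "('o, 'm) cstar_cat"
  assumes T: "max_tensor K A A' T i" and U: "max_tensor K B B' U j" and U': "max_tensor K D D' S l"
    and V: "max_tensor K C C' V k"
    and F: "star_functor K A B F" "star_functor K A' B' F'"
    and G: "star_functor K B C G" "star_functor K B' C' G'"
    and H: "star_functor K A D H" "star_functor K A' D' H'"
    and J: "star_functor K D C J" "star_functor K D' C' J'"
    and eq: "fctr_eq A (G \<circ>\<^sub>F F) (J \<circ>\<^sub>F H)" "fctr_eq A' (G' \<circ>\<^sub>F F') (J' \<circ>\<^sub>F H')"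
  shows "fctr_eq T (max_tensor_fctr K B B' U j C C' V k G G' \<circ>\<^sub>F max_tensor_fctr K A A' T i B B' U j F F')
    (max_tensor_fctr K D D' S l C C' V k J J' \<circ>\<^sub>F max_tensor_fctr K A A' T i D D' S l H H')"
  by (rule fctr_eq_trans[OF max_tensor_fctr_comp[OF T U V F G] fctr_eq_trans[OF
        max_tensor_fctr_cong[OF T V star_functor_comp[OF F(1) G(1)] star_functor_comp[OF F(2) G(2)]
          star_functor_comp[OF H(1) J(1)] star_functor_comp[OF H(2) J(2)] eq]
        fctr_eq_sym[OF max_tensor_fctr_comp[OF T U' V H J]]]])

text \<open>All data of a strict retraction are tensored with those of a second one, which is
  trivial in the applications. On the image of \<open>F \<otimes> F'\<close> the component is a
  tensor of identities, so triviality there is preserved.\<close>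

lemma max_tensor_deformation:
  fixes A A' B B' T U :: "('o, 'm) cstar_cat"
  assumes T: "max_tensor K A A' T i" and U: "max_tensor K B B' U j"
    and F: "star_functor K A B F" "star_functor K A' B' F'"
    and G: "star_functor K B A G" "star_functor K B' A' G'"
    and GF: "fctr_eq A (G \<circ>\<^sub>F F) id_fctr" "fctr_eq A' (G' \<circ>\<^sub>F F') id_fctr"
    and v: "unitary_nat_iso B B (F \<circ>\<^sub>F G) id_fctr v" "unitary_nat_iso B' B' (F' \<circ>\<^sub>F G') id_fctr v'"
    and vF: "\<And>x. x \<in> Ob A \<Longrightarrow> v (fob F x) = Idn B (fob F x)"
      "\<And>x. x \<in> Ob A' \<Longrightarrow> v' (fob F' x) = Idn B' (fob F' x)"
  defines "M \<equiv> max_tensor_fctr K A A' T i B B' U j F F'"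
    and "N \<equiv> max_tensor_fctr K B B' U j A A' T i G G'"
  obtains w where "star_functor K T U M" "star_functor K U T N"
    "fctr_eq T (N \<circ>\<^sub>F M) id_fctr" "unitary_nat_iso U U (M \<circ>\<^sub>F N) id_fctr w"
    "\<And>x. x \<in> Ob T \<Longrightarrow> w (fob M x) = Idn U (fob M x)"
proof -
  interpret T: max_tensor K A A' T i by fact
  interpret U: max_tensor K B B' U j by fact
  interpret F: star_functor K A B F by fact
  interpret F': star_functor K A' B' F' by fact
  note FG = star_functor_comp[OF G(1) F(1)] star_functor_comp[OF G(2) F(2)]
    and GF' = star_functor_comp[OF F(1) G(1)] star_functor_comp[OF F(2) G(2)]
  define w where "w = max_tensor_nat K B B' j B B' j (F \<circ>\<^sub>F G) (F' \<circ>\<^sub>F G')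
    (id_fctr :: ('o, 'm, 'o, 'm) fctr) (id_fctr :: ('o, 'm, 'o, 'm) fctr) v v'"
  note nat = max_tensor_nat[OF U U FG star_functor_id star_functor_id v]
  have "fctr_eq T (N \<circ>\<^sub>F M) id_fctr"
    unfolding M_def N_def
    by (rule fctr_eq_trans[OF max_tensor_fctr_comp[OF T U T F G] fctr_eq_trans[OF
          max_tensor_fctr_cong[OF T T GF' star_functor_id star_functor_id GF] max_tensor_fctr_id[OF T]]])
  moreover have "unitary_nat_iso U U (M \<circ>\<^sub>F N) id_fctr w"
    unfolding M_def N_def w_def
    by (rule unitary_nat_iso_cong[OF nat(2) fctr_eq_sym[OF max_tensor_fctr_comp[OF U T U G F]]
          max_tensor_fctr_id[OF U]])
  moreover have "w (fob M x) = Idn U (fob M x)" if x: "x \<in> Ob T" for x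
  proof -
    obtain a a' where a: "a \<in> Ob A" "a' \<in> Ob A'" "x = fob i (a, a')"
      using T.Ob_T_cases[OF x] .
    \<comment> \<open>The component starts at the pair of \<open>F G F a\<close> and
      \<open>F' G' F' a'\<close>; these objects have to be recognised as \<open>F a\<close> and
      \<open>F' a'\<close> before it can be an identity.\<close>
    have GFo: "fob F (fob G (fob F a)) = fob F a" "fob F' (fob G' (fob F' a')) = fob F' a'"
      using GF a by (simp_all add: fctr_eq_def)
    show ?thesis
      using a by (simp add: M_def max_tensor_fctr(2)[OF T U F] w_def nat(1) F.fob_closed F'.fob_closed
          vF GFo U.el_Idn)
  qed
  ultimately show thesis
    using that max_tensor_fctr(1)[OF T U F] max_tensor_fctr(1)[OF U T G]
    unfolding contractive_functor_def M_def N_def by blast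
qed

theorem proposition4p16:
  fixes K :: "complex set"
    and A A' B B' AA' BA' AB' BB' P :: "('o, 'm) cstar_cat"
    and F F' p q :: "('o, 'm, 'o, 'm) fctr"
    and iAA' iBA' iAB' iBB' :: "('o \<times> 'o, ('m \<times> 'm \<Rightarrow>\<^sub>0 complex) set, 'o, 'm) fctr"
  assumes "K = \<real> \<or> K = UNIV"
    and "cstar_category K A" and "cstar_category K A'"
    and "cstar_category K B" and "cstar_category K B'"
    and "star_functor K A B F" and "star_functor K A' B' F'"
    and "is_max_tensor K A A' AA' iAA'" and "is_max_tensor K B A' BA' iBA'"
    and "is_max_tensor K A B' AB' iAB'" and "is_max_tensor K B B' BB' iBB'"
    and "is_pushout K AA' BA' AB'
           (max_tensor_fctr K A A' AA' iAA' B A' BA' iBA' F id_fctr)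
           (max_tensor_fctr K A A' AA' iAA' A B' AB' iAB' id_fctr F') P p q"
  shows "let induced = is_induced K BA' AB' P p q BB'
           (max_tensor_fctr K B A' BA' iBA' B B' BB' iBB' id_fctr F')
           (max_tensor_fctr K A B' AB' iAB' B B' BB' iBB' F id_fctr)
         in (\<exists>H. induced H) \<and>
            (\<forall>H. induced H \<longrightarrow> cofibration K A B F \<and> cofibration K A' B' F' \<longrightarrow>
               cofibration K P BB' H \<and>
               (unitary_equivalence K A B F \<or> unitary_equivalence K A' B' F' \<longrightarrow>
                  unitary_equivalence K P BB' H))"
proof -
  note F = assms(6) and F' = assms(7) and po = assms(12)
  have K: "ground_field K" using assms(1) by (simp add: ground_field_def)
  have max_tensor: "max_tensor K X Y T i"
    if "cstar_category K X" "cstar_category K Y" "is_max_tensor K X Y T i"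
    for X Y T :: "('o, 'm) cstar_cat" and i
    using that K by (simp add: max_tensor_def max_tensor_axioms_def star_category_pair_def
        star_category_pair_axioms_def cstar_category_def)
  note X = max_tensor[OF assms(2,3,8)] and Y = max_tensor[OF assms(4,3,9)]
    and Z = max_tensor[OF assms(2,5,10)] and W = max_tensor[OF assms(4,5,11)]
  note star_cat = assms(2-5)[THEN cstar_category.axioms(1)]
  interpret X: max_tensor K A A' AA' iAA' by (fact X)
  interpret Y: max_tensor K B A' BA' iBA' by (fact Y)
  interpret Z: max_tensor K A B' AB' iAB' by (fact Z)
  interpret W: max_tensor K B B' BB' iBB' by (fact W)
  interpret F: star_functor K A B F by (fact F)
  interpret F': star_functor K A' B' F' by (fact F')
  let ?f = "max_tensor_fctr K A A' AA' iAA' B A' BA' iBA' F id_fctr"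
  let ?g = "max_tensor_fctr K A A' AA' iAA' A B' AB' iAB' id_fctr F'"
  let ?s = "max_tensor_fctr K B A' BA' iBA' B B' BB' iBB' id_fctr F'"
  let ?t = "max_tensor_fctr K A B' AB' iAB' B B' BB' iBB' F id_fctr"
  note fM = max_tensor_fctr[OF X Y F star_functor_id]
    and gM = max_tensor_fctr[OF X Z star_functor_id F']
    and sM = max_tensor_fctr[OF Y W star_functor_id F']
    and tM = max_tensor_fctr[OF Z W F star_functor_id]
  have fn: "star_functor K AA' BA' ?f" "star_functor K AA' AB' ?g"
      "star_functor K BA' BB' ?s" "star_functor K AB' BB' ?t"
    using fM(1) gM(1) sM(1) tM(1) by (simp_all add: contractive_functor_def)
  have "fctr_eq AA' (?s \<circ>\<^sub>F ?f) (?t \<circ>\<^sub>F ?g)"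
    by (rule max_tensor_fctr_square[OF X Y Z W F star_functor_id star_functor_id F'
          star_functor_id F' F star_functor_id]) (simp_all add: fctr_eq_refl)
  then have ex: "\<exists>H. is_induced K BA' AB' P p q BB' ?s ?t H"
    using po fn W.T.cstar_category_axioms unfolding is_pushout_def by meson
  have main: "cofibration K P BB' H \<and>
      (unitary_equivalence K A B F \<or> unitary_equivalence K A' B' F' \<longrightarrow> unitary_equivalence K P BB' H)"
    if H: "is_induced K BA' AB' P p q BB' ?s ?t H"
      and cof: "cofibration K A B F" "cofibration K A' B' F'" for H
  proof -
    have inj: "inj_on (fob F) (Ob A)" "inj_on (fob F') (Ob A')"
      using cof by (simp_all add: cofibration_def)
    have sinj: "inj_on (fob ?s) (Ob BA')"
      using inj by (auto elim!: Y.Ob_T_cases intro!: inj_onI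
          simp: sM W.i_eq_iff Y.i_eq_iff F'.fob_closed inj_on_def)
    have tinj: "inj_on (fob ?t) (Ob AB')"
      using inj by (auto elim!: Z.Ob_T_cases intro!: inj_onI
          simp: tM W.i_eq_iff Z.i_eq_iff F.fob_closed inj_on_def)
    \<comment> \<open>An object in both images is a pair \<open>(b, F' a')\<close> and also
      \<open>(F a, b')\<close>; comparing coordinates, it comes from \<open>(a, a')\<close>.\<close>
    have st: "\<exists>x\<in>Ob AA'. y = fob ?f x \<and> z = fob ?g x"
      if "y \<in> Ob BA'" "z \<in> Ob AB'" and eq: "fob ?s y = fob ?t z" for y z
    proof -
      obtain b a' where y: "b \<in> Ob B" "a' \<in> Ob A'" "y = fob iBA' (b, a')"
        using Y.Ob_T_cases[OF \<open>y \<in> Ob BA'\<close>] .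
      obtain a b' where z: "a \<in> Ob A" "b' \<in> Ob B'" "z = fob iAB' (a, b')"
        using Z.Ob_T_cases[OF \<open>z \<in> Ob AB'\<close>] .
      have "b = fob F a" "b' = fob F' a'"
        using eq y z by (simp_all add: sM tM W.i_eq_iff F.fob_closed F'.fob_closed)
      then have "y = fob ?f (fob iAA' (a, a'))" "z = fob ?g (fob iAA' (a, a'))"
        using y z by (simp_all add: fM gM)
      then show ?thesis using X.i_closed y z by blast
    qed
    have "inj_on (fob H) (Ob P)"
      using pushout_induced_inj[OF po fn(1,2) H sinj tinj st] .
    then have "cofibration K P BB' H"
      using H by (simp add: cofibration_def is_induced_def)
    moreover have "unitary_equivalence K P BB' H" if ue: "unitary_equivalence K A B F"
    proof -
      obtain G v where G: "star_functor K B A G" and GF: "fctr_eq A (G \<circ>\<^sub>F F) id_fctr"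
        and v: "unitary_nat_iso B B (F \<circ>\<^sub>F G) id_fctr v"
          "\<And>x. x \<in> Ob A \<Longrightarrow> v (fob F x) = Idn B (fob F x)"
        using strict_retraction[OF star_cat(1,3) ue inj(1)] by metis
      \<comment> \<open>The same \<open>G\<close> on the first factor gives two deformation
        retractions, \<open>?r\<close> over \<open>A'\<close> and \<open>?S\<close> over
        \<open>B'\<close>.\<close>
      let ?r = "max_tensor_fctr K B A' BA' iBA' A A' AA' iAA' G id_fctr"
      let ?S = "max_tensor_fctr K B B' BB' iBB' A B' AB' iAB' G id_fctr"
      obtain w where r: "star_functor K BA' AA' ?r"
        and w: "unitary_nat_iso BA' BA' (?f \<circ>\<^sub>F ?r) id_fctr w"
          "\<And>x. x \<in> Ob AA' \<Longrightarrow> w (fob ?f x) = Idn BA' (fob ?f x)"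
        by (rule max_tensor_deformation[OF X Y F star_functor_id G star_functor_id GF _ v(1) _ v(2)])
          (use unitary_nat_iso_Idn[OF star_cat(2)] in \<open>simp_all add: fctr_eq_refl\<close>)
      obtain w' where S: "star_functor K BB' AB' ?S"
        and w': "fctr_eq AB' (?S \<circ>\<^sub>F ?t) id_fctr" "unitary_nat_iso BB' BB' (?t \<circ>\<^sub>F ?S) id_fctr w'"
        by (rule max_tensor_deformation[OF Z W F star_functor_id G star_functor_id GF _ v(1) _ v(2)])
          (use unitary_nat_iso_Idn[OF star_cat(4)] in \<open>simp_all add: fctr_eq_refl\<close>)
      \<comment> \<open>Both composites are \<open>G \<otimes> F'\<close>; they differ only in the
        order in which \<open>G\<close> and \<open>F'\<close> act.\<close>
      have "fctr_eq BA' (?S \<circ>\<^sub>F ?s) (?g \<circ>\<^sub>F ?r)"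
        by (rule max_tensor_fctr_square[OF Y W X Z star_functor_id F' G star_functor_id
              G star_functor_id star_functor_id F']) (simp_all add: fctr_eq_refl)
      with st show ?thesis
        by (intro pushout_induced_unitary_equivalence[OF po Y.T.star_category_axioms
            W.T.star_category_axioms fn(1,2) r fn(3,4) S H sinj _ w w'])
    qed
    moreover have "unitary_equivalence K P BB' H" if ue: "unitary_equivalence K A' B' F'"
    proof -
      obtain G v where G: "star_functor K B' A' G" and GF: "fctr_eq A' (G \<circ>\<^sub>F F') id_fctr"
        and v: "unitary_nat_iso B' B' (F' \<circ>\<^sub>F G) id_fctr v"
          "\<And>x. x \<in> Ob A' \<Longrightarrow> v (fob F' x) = Idn B' (fob F' x)"
        using strict_retraction[OF star_cat(2,4) ue inj(2)] by metis
      \<comment> \<open>Now the retraction acts on the second factor, so the leg that deforms is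
        \<open>?g\<close> and the pushout is used with its legs exchanged.\<close>
      let ?r = "max_tensor_fctr K A B' AB' iAB' A A' AA' iAA' id_fctr G"
      let ?S = "max_tensor_fctr K B B' BB' iBB' B A' BA' iBA' id_fctr G"
      obtain w where r: "star_functor K AB' AA' ?r"
        and w: "unitary_nat_iso AB' AB' (?g \<circ>\<^sub>F ?r) id_fctr w"
          "\<And>x. x \<in> Ob AA' \<Longrightarrow> w (fob ?g x) = Idn AB' (fob ?g x)"
        by (rule max_tensor_deformation[OF X Z star_functor_id F' star_functor_id G _ GF _ v(1) _ v(2)])
          (use unitary_nat_iso_Idn[OF star_cat(1)] in \<open>simp_all add: fctr_eq_refl\<close>)
      obtain w' where S: "star_functor K BB' BA' ?S"
        and w': "fctr_eq BA' (?S \<circ>\<^sub>F ?s) id_fctr" "unitary_nat_iso BB' BB' (?s \<circ>\<^sub>F ?S) id_fctr w'"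
        by (rule max_tensor_deformation[OF Y W star_functor_id F' star_functor_id G _ GF _ v(1) _ v(2)])
          (use unitary_nat_iso_Idn[OF star_cat(3)] in \<open>simp_all add: fctr_eq_refl\<close>)
      have Ss: "fctr_eq AB' (?S \<circ>\<^sub>F ?t) (?f \<circ>\<^sub>F ?r)"
        by (rule max_tensor_fctr_square[OF Z W X Y F star_functor_id star_functor_id G
              star_functor_id G F star_functor_id]) (simp_all add: fctr_eq_refl)
      have st': "\<exists>x\<in>Ob AA'. z = fob ?g x \<and> y = fob ?f x"
        if "z \<in> Ob AB'" "y \<in> Ob BA'" "fob ?t z = fob ?s y" for y z
        using st[OF that(2,1)] that(3) by metis
      from st' Ss show ?thesis
        by (intro pushout_induced_unitary_equivalence[OF is_pushout_sym[OF po] Z.T.star_category_axioms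
            W.T.star_category_axioms fn(2,1) r fn(4,3) S is_induced_sym[THEN iffD1, OF H] tinj _ w w'])
    qed
    ultimately show ?thesis by blast
  qed
  show ?thesis
    unfolding Let_def using ex main by blast
qed

end
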